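(* Let $A\in\mathbb{R}^{m\times m}$, $B\in\mathbb{R}^{m\times n}$, $C\in\mathbb{R}^{n\times m}$, and $H(s)=C(sI-A)^{-1}B$. Let $r>0$, $0<L\le\infty$, and let $f:\mathbb{R}^n\to\mathbb{R}$ be a $\mathcal{C}^1$ function such that $\nabla f$ belongs to the sector $[0,L]$. Let $\lambda,\mu,\nu\ge0$ be real numbers, and define $$\Phi(\eta,\zeta)=(\lambda+\mu\bar\eta+\nu(\bar\eta+2r))H(\eta)^*+(\lambda+\mu\zeta+\nu(\zeta+2r))H(\zeta)+2\mu rL\,H(\eta)^*H(\zeta)-2\lambda L^{-1}I$$ for $\eta,\zeta\in\mathbb{C}$ that are not eigenvalues of $A$. Suppose that: 1. $B\ne0$; 2. $A+kBC+rI$ is Hurwitz for some (finite) $k\in[0,L]$; 3. $\det\Phi(\eta,\zeta)$ is not identically zero; 4. $\mu=0$ if $L=\infty$; 5. $\nu=0$ if $f$ is not $0$-quasi-strongly convex. If the frequency inequality $$\operatorname{Re}\left[(\lambda+\mu(i\omega-r)+\nu(i\omega+r))H(i\omega-r)\right]+\mu Lr\,H(i\omega-r)^*H(i\omega-r)\le\lambda L^{-1}I$$ holds whenever $\omega\in\mathbb{R}$ and $\det(A-(i\omega-r)I)\ne0$, then the system $\dot z=Az+B\nabla f(Cz)$ is $r$-exponentially stable.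
   Context: Conventions: when $L=\infty$, $L^{-1}=0$ and the terms containing $\mu L$ are interpreted as $0$ (since then $\mu=0$). For a square matrix $N$, $\operatorname{Re}N=(N+N^* )/2$, and matrix inequalities are in the sense of Hermitian forms. A matrix is Hurwitz if all its eigenvalues have negative real part. Sector: for $m<L\le\infty$, a continuous function $\phi:\mathbb{R}^n\to\mathbb{R}^n$ belongs to the sector $[m,L]$ if $\langle mw-\phi(w),\,w-L^{-1}\phi(w)\rangle\le 0$ for all $w\in\mathbb{R}^n$ ($L^{-1}=0$ if $L=\infty$). Quasi-strong convexity: a $\mathcal{C}^1$ function $f:\mathbb{R}^n\to\mathbb{R}$ is $0$-quasi-strongly convex (with respect to the origin) if $\nabla f$ belongs to the sector $[0,\infty]$ and $f(w)-\langle\nabla f(w),w\rangle\le f(0)$ for all $w\in\mathbb{R}^n$. Exponential stability: an autonomous system $\dot z=F(z)$ with $F$ continuous is $r$-exponentially stable if $z=0$ is an equilibrium point and there is an increasing continuous function $\kappa:[0,\infty)\to[0,\infty)$ with $\kappa(0)=0$ such that $|z(t)|\le\kappa(|z(0)|)\,e^{-rt}$ for each solution $z$ and every $t\ge0$ for which $z$ exists. *)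

theory Defs
  imports "HOL-Analysis.Analysis"
begin

section \<open>Complex matrices\<close>

abbreviation complexify :: "real^'a^'b \<Rightarrow> complex^'a^'b" where
  "complexify \<equiv> map_matrix complex_of_real"

definition cscale :: "complex \<Rightarrow> complex^'a^'b \<Rightarrow> complex^'a^'b" (infixr "*\<^sub>C" 75) where
  "c *\<^sub>C M = map_matrix ((*) c) M"

definition conj_transpose :: "complex^'a^'b \<Rightarrow> complex^'b^'a" where
  "conj_transpose M = map_matrix cnj (transpose M)"

definition hermitian :: "complex^'a^'a \<Rightarrow> bool" where
  "hermitian M \<longleftrightarrow> conj_transpose M = M"

definition re_part :: "complex^'a^'a \<Rightarrow> complex^'a^'a" where
  "re_part N = (1/2) *\<^sub>C (N + conj_transpose N)"

definition hform :: "complex^'a^'a \<Rightarrow> complex^'a \<Rightarrow> complex" where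
  "hform M v = (\<Sum>i\<in>UNIV. \<Sum>j\<in>UNIV. cnj (v $ i) * M $ i $ j * v $ j)"

text \<open>For Hermitian matrices the values of \<^const>\<open>hform\<close> are real, so comparing real parts
  loses nothing.\<close>

definition hermitian_le :: "complex^'a^'a \<Rightarrow> complex^'a^'a \<Rightarrow> bool" where
  "hermitian_le M N \<longleftrightarrow>
     hermitian M \<and> hermitian N \<and> (\<forall>v. Re (hform M v) \<le> Re (hform N v))"

definition is_eigenvalue :: "complex^'a^'a \<Rightarrow> complex \<Rightarrow> bool" where
  "is_eigenvalue M s \<longleftrightarrow> (\<exists>v. v \<noteq> 0 \<and> M *v v = s *s v)"

definition hurwitz :: "real^'a^'a \<Rightarrow> bool" where
  "hurwitz M \<longleftrightarrow> (\<forall>s. is_eigenvalue (complexify M) s \<longrightarrow> Re s < 0)"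


section \<open>Sectors and quasi-strong convexity\<close>

text \<open>The upper sector bound is an extended real; \<^term>\<open>inverse \<infinity> = (0 :: ereal)\<close> gives the
  convention for an infinite bound.\<close>

definition in_sector :: "('a::euclidean_space \<Rightarrow> 'a) \<Rightarrow> real \<Rightarrow> ereal \<Rightarrow> bool" where
  "in_sector \<phi> m L \<longleftrightarrow> ereal m < L \<and> continuous_on UNIV \<phi> \<and>
     (\<forall>w. (m *\<^sub>R w - \<phi> w) \<bullet> (w - real_of_ereal (inverse L) *\<^sub>R \<phi> w) \<le> 0)"

definition gradient :: "('a::euclidean_space \<Rightarrow> real) \<Rightarrow> 'a \<Rightarrow> 'a" where
  "gradient f x = (THE D. GDERIV f x :> D)"

definition is_C1 :: "('a::euclidean_space \<Rightarrow> real) \<Rightarrow> bool" where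
  "is_C1 f \<longleftrightarrow> (\<forall>x. f differentiable (at x)) \<and> continuous_on UNIV (gradient f)"

definition zero_quasi_strongly_convex :: "('a::euclidean_space \<Rightarrow> real) \<Rightarrow> bool" where
  "zero_quasi_strongly_convex f \<longleftrightarrow> is_C1 f \<and> in_sector (gradient f) 0 \<infinity> \<and>
     (\<forall>w. f w - gradient f w \<bullet> w \<le> f 0)"


section \<open>Exponential stability\<close>

text \<open>Solutions live on an arbitrary nondegenerate interval containing the initial time 0;
  at endpoints belonging to the interval the derivative is one-sided.\<close>

definition is_solution ::
    "('a::euclidean_space \<Rightarrow> 'a) \<Rightarrow> real set \<Rightarrow> (real \<Rightarrow> 'a) \<Rightarrow> bool" where
  "is_solution F J z \<longleftrightarrow> is_interval J \<and> 0 \<in> J \<and> J \<noteq> {0} \<and>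
     (\<forall>t\<in>J. (z has_vector_derivative F (z t)) (at t within J))"

definition exp_stable :: "real \<Rightarrow> ('a::euclidean_space \<Rightarrow> 'a) \<Rightarrow> bool" where
  "exp_stable r F \<longleftrightarrow> continuous_on UNIV F \<and> F 0 = 0 \<and>
     (\<exists>\<kappa> :: real \<Rightarrow> real. continuous_on {0..} \<kappa> \<and> strict_mono_on {0..} \<kappa> \<and>
        \<kappa> ` {0..} \<subseteq> {0..} \<and> \<kappa> 0 = 0 \<and>
        (\<forall>J z. is_solution F J z \<longrightarrow>
           (\<forall>t\<in>J. 0 \<le> t \<longrightarrow> norm (z t) \<le> \<kappa> (norm (z 0)) * exp (- r * t))))"


section \<open>Transfer function and frequency-domain matrix\<close>

definition transfer ::
    "real^'m^'m \<Rightarrow> real^'n^'m \<Rightarrow> real^'m^'n \<Rightarrow> complex \<Rightarrow> complex^'n^'n" where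
  "transfer A B C s =
     complexify C ** matrix_inv (mat s - complexify A) ** complexify B"

text \<open>\<^const>\<open>real_of_ereal\<close> maps \<open>\<infinity>\<close> to 0, so terms containing \<open>\<mu> L\<close> vanish for \<open>L = \<infinity>\<close>.\<close>

definition Phi ::
    "real^'m^'m \<Rightarrow> real^'n^'m \<Rightarrow> real^'m^'n \<Rightarrow> real \<Rightarrow> ereal \<Rightarrow> real \<Rightarrow> real \<Rightarrow> real
      \<Rightarrow> complex \<Rightarrow> complex \<Rightarrow> complex^'n^'n" where
  "Phi A B C r L lam \<mu> \<nu> \<eta> \<zeta> =
     (of_real lam + of_real \<mu> * cnj \<eta> + of_real \<nu> * (cnj \<eta> + 2 * of_real r))
       *\<^sub>C conj_transpose (transfer A B C \<eta>)
     + (of_real lam + of_real \<mu> * \<zeta> + of_real \<nu> * (\<zeta> + 2 * of_real r))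
       *\<^sub>C transfer A B C \<zeta>
     + of_real (2 * \<mu> * r * real_of_ereal L)
       *\<^sub>C (conj_transpose (transfer A B C \<eta>) ** transfer A B C \<zeta>)
     - mat (of_real (2 * lam * real_of_ereal (inverse L)))"

end

theory Submission
  imports Defs "HOL-Computational_Algebra.Fundamental_Theorem_Algebra"
begin

text \<open>With \<open>y(t) = e\<^sup>r\<^sup>t z(t)\<close> and \<open>v(t) = e\<^sup>r\<^sup>t \<nabla>f(C z(t))\<close> the system becomes
  \<open>y' = (A + r I) y + B v\<close>, and the claim is that \<open>y\<close> stays bounded (Popov's hyperstability). The sector and
  convexity conditions bound a quadratic form \<open>G(y, v)\<close> from below by the derivative of
  \<open>h = (\<mu> + \<nu>) e\<^sup>2\<^sup>r\<^sup>t (f(C z) - f(0))\<close>, and the frequency inequality says that \<open>G \<le> 0\<close> on the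
  imaginary axis. A finite-dimensional separation argument (the Kalman-Yakubovich-Popov lemma) turns this into a
  storage function \<open>\<langle>x, P x\<rangle>\<close> on the reachable subspace, and the stabilizing gain \<open>k\<close> forces \<open>P \<ge> 0\<close>.
  \<open>P\<close> may have a kernel; since \<open>det \<Phi>\<close> does not vanish identically, inputs that are neither dissipated nor visible
  through \<open>P\<close> are zero, which allows one to recover the remaining part of the state from the stored and the
  dissipated energy. The unreachable part of the state decays exponentially and is absorbed by a Gronwall argument.\<close>

section \<open>Quadratic forms\<close>

text \<open>The frequency inequality is not strict and neither controllability nor observability is
  assumed, so \<open>P\<close> need not be definite. Three quantities are therefore tracked
  together: the stored energy \<open>x \<bullet> (P *v x)\<close>, the dissipation, and the distance
  to the reachable subspace. A state seen by none of them is reachable and lies in the kernel of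
  \<open>P\<close>. There the output obeys a stable law \<open>C (F x) = - c * C x\<close>, which
  makes the feedback term separating \<open>F\<close> from the Hurwitz closed loop harmless. Origin
  of the coefficients: at \<open>s = \<i> \<omega> - r\<close> the multiplier of the theorem is
  \<open>\<theta> + \<i> \<sigma> \<omega>\<close> with \<open>\<sigma> = \<mu> + \<nu>\<close> and
  \<open>\<theta> = lam - \<mu> r + \<nu> r\<close>; the remaining terms give
  \<open>\<delta> = lam / L\<close> and \<open>\<rho> = \<mu> L r\<close>. For
  \<open>v = k C x\<close> the part of \<open>G\<close> that is not an exact derivative is
  \<open>|C x|^2\<close> times \<open>k \<theta> - \<delta> k^2 + \<rho> = lam k (1 - k / L) + \<nu>
  r k + \<mu> r (L - k)\<close>, positive for \<open>0 < k < L\<close>; this links the stabilizing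
  gain to the sign of \<open>P\<close>. Complex vectors are handled as pairs of real ones, so that
  all forms stay real.\<close>

lemmas bilinear_rules = bilinear_ladd bilinear_radd bilinear_lmul bilinear_rmul
lemmas linear_rules = linear_add linear_scale
lemmas form_rules = matrix_vector_right_distrib matrix_vector_mult_scaleR inner_add_left inner_add_right

text \<open>Along \<open>t *\<^sub>R x + y\<close> the form is affine in \<open>t\<close>, so a
  nonzero slope would make it negative somewhere. It is stated on a subspace because some forms
  below are nonnegative only on \<open>reachable\<close>. This is the device that turns equality in
  a quadratic inequality into linear identities.\<close>

lemma psd_form_kernel:
  fixes b :: "'a::real_vector \<Rightarrow> 'a \<Rightarrow> real"
  assumes b: "bilinear b" and sym: "\<And>x y. b x y = b y x"
    and S: "subspace S" and psd: "\<And>x. x \<in> S \<Longrightarrow> b x x \<ge> 0"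
    and x: "x \<in> S" "b x x = 0" and y: "y \<in> S"
  shows "b x y = 0"
proof (rule ccontr)
  assume ne: "b x y \<noteq> 0"
  define t where "t = - (b y y + 1) / (2 * b x y)"
  have "t *\<^sub>R x + y \<in> S"
    using S x(1) y by (simp add: subspace_add subspace_scale)
  then have "0 \<le> b (t *\<^sub>R x + y) (t *\<^sub>R x + y)" by (rule psd)
  also have "\<dots> = 2 * t * b x y + b y y"
    using x(2) sym[of y x]
    by (simp add: bilinear_rules[OF b])
  also have "2 * t * b x y = - (b y y + 1)" using ne by (simp add: t_def)
  finally show False by simp
qed

text \<open>Both sides depend only on the component orthogonal to the kernel of \<open>b\<close>,
  and on the unit sphere of that complement \<open>b\<close> has a positive minimum by compactness.
  Many constants of the energy estimates come from here.\<close>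

lemma psd_form_dominates:
  fixes b :: "'a::euclidean_space \<Rightarrow> 'a \<Rightarrow> real" and l :: "'a \<Rightarrow> 'b::real_normed_vector"
  assumes b: "bilinear b" and sym: "\<And>x y. b x y = b y x" and psd: "\<And>x. b x x \<ge> 0"
    and l: "linear l" and ker: "\<And>x. b x x = 0 \<Longrightarrow> l x = 0"
  obtains c where "c > 0" "\<And>x. (norm (l x))\<^sup>2 \<le> c * b x x"
proof -
  define N where "N = {x. b x x = 0}"
  have Nker: "b x y = 0" if "x \<in> N" for x y
    using psd_form_kernel[OF b sym subspace_UNIV, of x y] psd that by (auto simp: N_def)
  have N: "subspace N"
    unfolding N_def subspace_def
    using Nker unfolding N_def
    by (auto simp: bilinear_rules[OF b]
        bilinear_lzero[OF b])
  define K where "K = sphere 0 1 \<inter> orthogonal_comp N"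
  have K: "compact K"
    unfolding K_def by (intro compact_Int_closed compact_sphere closed_subspace subspace_orthogonal_comp)
  have bl: "bounded_bilinear b" using b by (simp add: bilinear_conv_bounded_bilinear)
  have cont: "continuous_on K (\<lambda>x. b x x)"
    by (intro bounded_bilinear.continuous_on[OF bl] continuous_on_id)
  obtain m where m: "m > 0" "\<And>x. x \<in> K \<Longrightarrow> m \<le> b x x"
  proof (cases "K = {}")
    case True then show ?thesis using that[of 1] by auto
  next
    case False
    from continuous_attains_inf[OF K this cont] obtain z where z: "z \<in> K" "\<forall>x\<in>K. b z z \<le> b x x" by auto
    have "b z z \<noteq> 0"
    proof
      assume "b z z = 0"
      then have "z \<in> N" by (simp add: N_def)
      then have "z \<bullet> z = 0" using z(1) unfolding K_def orthogonal_comp_def orthogonal_def by auto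
      then show False using z(1) by (auto simp: K_def)
    qed
    then show ?thesis using that[of "b z z"] z psd[of z] by (auto simp: less_le)
  qed
  have coer: "m * (norm w)\<^sup>2 \<le> b w w" if "w \<in> orthogonal_comp N" for w
  proof (cases "w = 0")
    case True then show ?thesis by (simp add: bilinear_lzero[OF b])
  next
    case False
    have "(1 / norm w) *\<^sub>R w \<in> K"
      using False that subspace_orthogonal_comp[of N] by (auto simp: K_def subspace_scale)
    from m(2)[OF this] show ?thesis using False
      by (simp add: bilinear_lmul[OF b] bilinear_rmul[OF b] field_simps power2_eq_square)
  qed
  obtain B where B: "B > 0" "\<And>x. norm (l x) \<le> B * norm x"
    using linear_bounded_pos[OF l] by blast
  show ?thesis
  proof
    show "B\<^sup>2 / m > 0" using B m by simp
    fix x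
    obtain u w where uw: "u \<in> span N" "\<And>y. y \<in> span N \<Longrightarrow> orthogonal w y" "x = u + w"
      using orthogonal_subspace_decomp_exists[of N x] by metis
    have uN: "u \<in> N" using uw(1) N by (metis span_eq_iff)
    have w: "w \<in> orthogonal_comp N"
      using uw(2) by (auto simp: orthogonal_comp_def orthogonal_commute span_base)
    have lx: "l x = l w" using uN ker by (simp add: uw(3) linear_add[OF l] N_def)
    have bx: "b x x = b w w" using Nker[OF uN] sym[of w u]
      by (simp add: uw(3) bilinear_ladd[OF b] bilinear_radd[OF b])
    have "(norm (l x))\<^sup>2 \<le> (B * norm w)\<^sup>2" unfolding lx by (intro power_mono B norm_ge_zero)
    also have "\<dots> = B\<^sup>2 / m * (m * (norm w)\<^sup>2)" using m by (simp add: power_mult_distrib)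
    also have "\<dots> \<le> B\<^sup>2 / m * b w w" using coer[OF w] m by (intro mult_left_mono) auto
    finally show "(norm (l x))\<^sup>2 \<le> B\<^sup>2 / m * b x x" by (simp add: bx)
  qed
qed

section \<open>Traces and the normal form of skew maps\<close>

lemma trace_orthonormal_basis:
  fixes b :: "'a::euclidean_space \<Rightarrow> 'a \<Rightarrow> real"
  assumes b: "bilinear b" and fin: "finite T" and orth: "pairwise orthogonal T"
    and unit: "\<And>u. u \<in> T \<Longrightarrow> norm u = 1" and span: "span T = UNIV"
  shows "(\<Sum>e\<in>Basis. b e e) = (\<Sum>u\<in>T. b u u)"
proof -
  have ex: "x = (\<Sum>u\<in>T. (x \<bullet> u) *\<^sub>R u)" for x
    using orthonormal_basis_expand[OF orth unit _ fin, of x] span by simp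
  have bs: "b (\<Sum>i\<in>A. f i) y = (\<Sum>i\<in>A. b (f i) y)" "b y (\<Sum>i\<in>A. f i) = (\<Sum>i\<in>A. b y (f i))"
    for A y and f :: "'a \<Rightarrow> 'a"
    using b linear_sum[of "\<lambda>x. b x y" f A] linear_sum[of "b y" f A] by (auto simp: bilinear_def)
  have "(\<Sum>e\<in>Basis. b e e) = (\<Sum>e\<in>Basis. \<Sum>u\<in>T. \<Sum>u'\<in>T. (e \<bullet> u) * (e \<bullet> u') * b u u')"
  proof (rule sum.cong[OF refl])
    fix e :: 'a
    have "b e e = b (\<Sum>u\<in>T. (e \<bullet> u) *\<^sub>R u) (\<Sum>u\<in>T. (e \<bullet> u) *\<^sub>R u)" using ex[of e] by simp
    also have "\<dots> = (\<Sum>u\<in>T. b ((e \<bullet> u) *\<^sub>R u) (\<Sum>u\<in>T. (e \<bullet> u) *\<^sub>R u))"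
      by (rule bs(1))
    also have "\<dots> = (\<Sum>u\<in>T. \<Sum>u'\<in>T. (e \<bullet> u) * (e \<bullet> u') * b u u')"
      by (simp add: bs(2) bilinear_lmul[OF b] bilinear_rmul[OF b] sum_distrib_left mult_ac)
    finally show "b e e = \<dots>" .
  qed
  also have "\<dots> = (\<Sum>u\<in>T. \<Sum>u'\<in>T. \<Sum>e\<in>Basis. (e \<bullet> u) * (e \<bullet> u') * b u u')"
    by (subst sum.swap) (intro sum.cong refl sum.swap)
  also have "\<dots> = (\<Sum>u\<in>T. \<Sum>u'\<in>T. (u \<bullet> u') * b u u')"
  proof (intro sum.cong refl)
    fix u u'
    show "(\<Sum>e\<in>Basis. (e \<bullet> u) * (e \<bullet> u') * b u u') = (u \<bullet> u') * b u u'"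
      unfolding euclidean_inner[of u u'] sum_distrib_right by (simp add: inner_commute)
  qed
  also have "\<dots> = (\<Sum>u\<in>T. \<Sum>u'\<in>T. if u = u' then b u u' else 0)"
  proof (intro sum.cong refl)
    fix u u' assume "u \<in> T" "u' \<in> T"
    then show "u \<bullet> u' * b u u' = (if u = u' then b u u' else 0)"
      using orth unit by (auto simp: pairwise_def orthogonal_def norm_eq_1)
  qed
  also have "\<dots> = (\<Sum>u\<in>T. b u u)" using fin by simp
  finally show ?thesis .
qed

text \<open>The real spectral theorem for skew maps: \<open>W\<close> splits into kernel lines and
  planes on which \<open>S\<close> is a rotation scaled by \<open>\<omega>\<close>. Each block
  contributes a nonnegative amount by \<open>pos\<close>; a line is the case
  \<open>\<omega> = 0\<close> with second vector \<open>0\<close>. The induction passes to the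
  orthogonal complement of one block, which is invariant by skewness.\<close>

lemma skew_invariant_basis:
  fixes S :: "'a::euclidean_space \<Rightarrow> 'a" and b :: "'a \<Rightarrow> 'a \<Rightarrow> real"
  assumes S: "linear S" and W: "subspace W" and inv: "S ` W \<subseteq> W"
    and skew: "\<And>c d. c \<in> W \<Longrightarrow> d \<in> W \<Longrightarrow> S c \<bullet> d = - (c \<bullet> S d)"
    and pos: "\<And>\<omega> c d. c \<in> W \<Longrightarrow> d \<in> W \<Longrightarrow> S c = - \<omega> *\<^sub>R d \<Longrightarrow> S d = \<omega> *\<^sub>R c
                \<Longrightarrow> b c c + b d d \<ge> 0"
    and b0: "b 0 0 = 0"
  shows "\<exists>T. finite T \<and> T \<subseteq> W \<and> pairwise orthogonal T \<and> (\<forall>u\<in>T. norm u = 1) \<and> span T = W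
           \<and> (\<Sum>u\<in>T. b u u) \<ge> 0"
  using W inv skew pos
proof (induction "dim W" arbitrary: W rule: less_induct)
  case less
  note W = less.prems(1) and inv = less.prems(2) and skew = less.prems(3) and pos = less.prems(4)
  show ?case
  proof (cases "W = {0}")
    case True
    then show ?thesis by (intro exI[of _ "{}"]) auto
  next
    case False
    define K where "K = sphere 0 1 \<inter> W"
    have K: "compact K" unfolding K_def by (intro compact_Int_closed compact_sphere closed_subspace W)
    from False W obtain w where w: "w \<in> W" "w \<noteq> 0" by (auto dest: subspace_0)
    then have "(1 / norm w) *\<^sub>R w \<in> K" using W by (auto simp: K_def subspace_scale)
    then have Kne: "K \<noteq> {}" by auto
    have "continuous_on K (\<lambda>x. S x \<bullet> S x)"
      by (intro continuous_intros linear_continuous_on linear_conv_bounded_linear[THEN iffD1] S)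
    from continuous_attains_sup[OF K Kne this] obtain c where
      c: "c \<in> K" "\<forall>x\<in>K. S x \<bullet> S x \<le> S c \<bullet> S c" by auto
    define \<omega> where "\<omega> = norm (S c)"
    have cW: "c \<in> W" and nc: "norm c = 1" using c by (auto simp: K_def)
    have ScW: "S c \<in> W" using inv cW by auto
    \<comment> \<open>A maximiser \<open>c\<close> of \<open>norm (S x)\<close> on the unit sphere
      lies in the kernel of this form, which is semidefinite on \<open>W\<close>. Together with
      skewness this yields \<open>S (S c) = - \<omega>\<^sup>2 c\<close>, so \<open>c\<close> and
      \<open>S c\<close> span an invariant subspace.\<close>
    have bil: "bilinear (\<lambda>x y. \<omega>\<^sup>2 * (x \<bullet> y) - S x \<bullet> S y)"
      unfolding bilinear_def
      by (auto intro!: linearI simp: linear_rules[OF S] inner_add_left inner_add_right algebra_simps)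
    have bpsd: "\<omega>\<^sup>2 * (x \<bullet> x) - S x \<bullet> S x \<ge> 0" if "x \<in> W" for x
    proof (cases "x = 0")
      case True then show ?thesis by (simp add: linear_0[OF S])
    next
      case False
      then have "(1 / norm x) *\<^sub>R x \<in> K" using that W by (auto simp: K_def subspace_scale)
      with c(2) have "S ((1 / norm x) *\<^sub>R x) \<bullet> S ((1 / norm x) *\<^sub>R x) \<le> S c \<bullet> S c" by blast
      then have "(1 / norm x)\<^sup>2 * (S x \<bullet> S x) \<le> \<omega>\<^sup>2"
        by (simp add: linear_scale[OF S] \<omega>_def dot_square_norm power2_eq_square)
      then show ?thesis using False
        by (simp add: field_simps power2_norm_eq_inner[symmetric])
    qed
    have bc0: "\<omega>\<^sup>2 * (c \<bullet> c) - S c \<bullet> S c = 0"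
      using nc by (simp add: \<omega>_def power2_norm_eq_inner norm_eq_1)
    have k: "\<omega>\<^sup>2 * (c \<bullet> y) - S c \<bullet> S y = 0" if "y \<in> W" for y
      by (rule psd_form_kernel[OF bil _ W bpsd cW bc0 that]) (simp_all add: inner_commute)
    have SS: "S (S c) = - (\<omega>\<^sup>2) *\<^sub>R c"
    proof -
      define e where "e = S (S c) + (\<omega>\<^sup>2) *\<^sub>R c"
      have eW: "e \<in> W" unfolding e_def using inv cW ScW W by (auto simp: subspace_add subspace_scale)
      have "e \<bullet> e = S (S c) \<bullet> e + \<omega>\<^sup>2 * (c \<bullet> e)" by (simp add: e_def inner_add_left)
      also have "\<dots> = 0" using k[OF eW] skew[OF ScW eW] by simp
      finally have "e = 0" by simp
      then show ?thesis by (simp add: e_def eq_neg_iff_add_eq_0)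
    qed
    have Scc: "S c \<bullet> c = 0" using skew[OF cW cW] by (simp add: inner_commute)
    obtain T0 where T0: "finite T0" "T0 \<subseteq> W" "pairwise orthogonal T0" "\<forall>u\<in>T0. norm u = 1"
      "(\<Sum>u\<in>T0. b u u) \<ge> 0" "S ` T0 \<subseteq> span T0" "c \<in> T0"
    proof (cases "\<omega> = 0")
      case True
      then have "S c = 0" by (simp add: \<omega>_def)
      moreover have "b c c \<ge> 0" using pos[of c 0 0] cW W b0 calculation by (simp add: subspace_0 linear_0[OF S])
      ultimately show ?thesis using that[of "{c}"] cW nc by (auto simp: span_0)
    next
      case False
      \<comment> \<open>The sign makes \<open>(c, d)\<close> match the orientation
        \<open>S c = - \<omega> d\<close>, \<open>S d = \<omega> c\<close> required by
        \<open>pos\<close>.\<close>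
      define d where "d = (- 1/\<omega>) *\<^sub>R S c"
      have d: "d \<in> W" "norm d = 1" "c \<bullet> d = 0" "S c = - \<omega> *\<^sub>R d" "S d = \<omega> *\<^sub>R c"
        using False Scc ScW W unfolding d_def
        by (auto simp: subspace_scale subspace_neg \<omega>_def inner_commute linear_scale[OF S] linear_neg[OF S] SS power2_eq_square)
      have cd: "c \<noteq> d" using d(3) nc by (auto simp: norm_eq_1)
      have "b c c + b d d \<ge> 0" using pos[OF cW d(1) d(4) d(5)] .
      then show ?thesis using that[of "{c,d}"] cW nc d cd
        by (auto simp: pairwise_insert orthogonal_def inner_commute span_base span_scale span_neg)
    qed
    define W' where "W' = W \<inter> orthogonal_comp (span T0)"
    have W': "subspace W'" unfolding W'_def by (intro subspace_inter W subspace_orthogonal_comp)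
    have "W' \<subset> W"
    proof -
      have "c \<notin> W'"
      proof
        assume "c \<in> W'"
        then have "orthogonal c c"
          using span_base[OF T0(7)] unfolding W'_def orthogonal_comp_def by blast
        then show False using nc by (simp add: orthogonal_def norm_eq_1)
      qed
      then show ?thesis using cW by (auto simp: W'_def)
    qed
    then have dl: "dim W' < dim W"
      using W W' by (metis dim_psubset span_eq_iff)
    have spT0: "S ` span T0 \<subseteq> span T0"
    proof -
      have "S ` span T0 = span (S ` T0)" using S by (simp add: linear_span_image)
      also have "\<dots> \<subseteq> span T0" using T0(6) by (meson span_minimal subspace_span)
      finally show ?thesis .
    qed
    have T0W: "span T0 \<subseteq> W" using T0(2) W by (simp add: span_minimal)
    have inv': "S ` W' \<subseteq> W'"
    proof (rule image_subsetI)
      fix y assume y: "y \<in> W'"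
      then have yW: "y \<in> W" by (simp add: W'_def)
      have "orthogonal z (S y)" if z: "z \<in> span T0" for z
      proof -
        have "S z \<in> span T0" using spT0 z by auto
        then have "S z \<bullet> y = 0" using y by (auto simp: W'_def orthogonal_comp_def orthogonal_def)
        then show ?thesis using skew[of z y] z T0W yW by (auto simp: orthogonal_def)
      qed
      then show "S y \<in> W'" using inv yW by (auto simp: W'_def orthogonal_comp_def)
    qed
    have sub: "W' \<subseteq> W" by (simp add: W'_def)
    have skew': "S u \<bullet> v = - (u \<bullet> S v)" if "u \<in> W'" "v \<in> W'" for u v
      using skew[of u v] that sub by blast
    have pos': "b u u + b v v \<ge> 0" if "u \<in> W'" "v \<in> W'" "S u = - \<tau> *\<^sub>R v" "S v = \<tau> *\<^sub>R u" for \<tau> u v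
      using pos[of u v \<tau>] that sub by blast
    have "\<exists>T. finite T \<and> T \<subseteq> W' \<and> pairwise orthogonal T \<and> (\<forall>u\<in>T. norm u = 1) \<and> span T = W'
           \<and> (\<Sum>u\<in>T. b u u) \<ge> 0"
      by (rule less.hyps[OF dl W' inv' skew' pos'])
    then obtain T' where T': "finite T'" "T' \<subseteq> W'" "pairwise orthogonal T'" "\<forall>u\<in>T'. norm u = 1" "span T' = W'"
      "(\<Sum>u\<in>T'. b u u) \<ge> 0"
      by (elim exE conjE)
    have xo: "orthogonal u v" if "u \<in> T0" "v \<in> T'" for u v
      using that T'(2) span_base[of u T0] by (auto simp: W'_def orthogonal_comp_def)
    have disj: "T0 \<inter> T' = {}"
    proof (rule ccontr)
      assume "T0 \<inter> T' \<noteq> {}"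
      then obtain u where "u \<in> T0" "u \<in> T'" by auto
      with xo[of u u] T0(4) show False by (auto simp: orthogonal_def)
    qed
    show ?thesis
    proof (intro exI[of _ "T0 \<union> T'"] conjI)
      show "finite (T0 \<union> T')" using T0 T' by simp
      show "T0 \<union> T' \<subseteq> W" using T0 T' sub by auto
      show "pairwise orthogonal (T0 \<union> T')"
        using T0(3) T'(3) xo xo[THEN orthogonal_commute[THEN iffD1]] unfolding pairwise_def by blast
      show "\<forall>u\<in>T0 \<union> T'. norm u = 1" using T0 T' by auto
      show "0 \<le> (\<Sum>u\<in>T0 \<union> T'. b u u)" using T0 T' disj by (simp add: sum.union_disjoint)
      show "span (T0 \<union> T') = W"
      proof
        show "span (T0 \<union> T') \<subseteq> W" using T0 T' sub W by (intro span_minimal) auto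
        show "W \<subseteq> span (T0 \<union> T')"
        proof
          fix x assume x: "x \<in> W"
          obtain u w where uw: "u \<in> span T0" "\<And>y. y \<in> span T0 \<Longrightarrow> orthogonal w y" "x = u + w"
            using orthogonal_subspace_decomp_exists[of T0 x] by metis
          have "w = x - u" using uw by simp
          then have "w \<in> W" using uw(1) x T0W W by (auto intro: subspace_diff)
          then have "w \<in> W'" using uw(2)
            by (auto simp: W'_def orthogonal_comp_def orthogonal_commute)
          then have "w \<in> span T'" using T' by simp
          then show "x \<in> span (T0 \<union> T')" using uw
            by (metis span_add span_mono subsetD sup_ge1 sup_ge2)
        qed
      qed
    qed
  qed
qed

section \<open>Eigenvectors in invariant subspaces\<close>

text \<open>Pairs \<open>(x, y)\<close> encode \<open>x + \<i> y\<close>.\<close>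

definition pair_scale :: "complex \<Rightarrow> 'a::real_vector \<times> 'a \<Rightarrow> 'a \<times> 'a" where
  "pair_scale c z = (Re c *\<^sub>R fst z - Im c *\<^sub>R snd z, Im c *\<^sub>R fst z + Re c *\<^sub>R snd z)"

text \<open>This is \<open>p(F)\<close>, extended to the complexification and evaluated by Horner's
  scheme. Complex coefficients are wanted so that an annihilating polynomial has a root.\<close>

definition poly_action :: "('a::real_vector \<Rightarrow> 'a) \<Rightarrow> complex poly \<Rightarrow> 'a \<times> 'a \<Rightarrow> 'a \<times> 'a" where
  "poly_action F p z = fold_coeffs (\<lambda>c w. pair_scale c z + map_prod F F w) p 0"

lemma poly_action_simps:
  assumes F: "linear F"
  shows "poly_action F 0 z = 0"
    "poly_action F (pCons c p) z = pair_scale c z + map_prod F F (poly_action F p z)"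
proof -
  show "poly_action F 0 z = 0" by (simp add: poly_action_def)
  show "poly_action F (pCons c p) z = pair_scale c z + map_prod F F (poly_action F p z)"
    using linear_0[OF F] by (cases "c = 0 \<and> p = 0") (auto simp: poly_action_def pair_scale_def zero_prod_def)
qed

lemma poly_action_add:
  assumes F: "linear F"
  shows "poly_action F (p + q) z = poly_action F p z + poly_action F q z"
proof (induction p q rule: poly_induct2)
  case 0 then show ?case by (simp add: poly_action_simps[OF F])
next
  case (pCons a p b q)
  have "map_prod F F (u + w) = map_prod F F u + map_prod F F w" for u w
    by (cases u; cases w) (simp add: linear_add[OF F])
  then show ?case using pCons
    by (simp add: poly_action_simps[OF F]) (simp add: pair_scale_def algebra_simps)
qed

lemma poly_action_smult:
  assumes F: "linear F"
  shows "poly_action F (smult c p) z = pair_scale c (poly_action F p z)"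
proof (induction p)
  case 0 then show ?case by (simp add: poly_action_simps[OF F] pair_scale_def zero_prod_def)
next
  case (pCons a p)
  then show ?case
    by (cases "poly_action F p z")
      (simp add: poly_action_simps[OF F], simp add: pair_scale_def linear_add[OF F] linear_diff[OF F] linear_scale[OF F] algebra_simps)
qed

lemma poly_action_invariant:
  assumes F: "linear F" and S: "subspace S" and inv: "F ` S \<subseteq> S" and z: "z \<in> S \<times> S"
  shows "poly_action F p z \<in> S \<times> S"
proof (induction p)
  case 0 then show ?case using S by (simp add: poly_action_simps[OF F] zero_prod_def subspace_0)
next
  case (pCons a p)
  then show ?case using S z inv
    by (cases "poly_action F p z"; cases z)
      (auto simp: poly_action_simps[OF F] pair_scale_def intro!: subspace_add subspace_diff subspace_scale)
qed

lemma poly_action_monom: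
  assumes F: "linear F"
  shows "poly_action F (monom (of_real c) i) (x, 0) = (c *\<^sub>R (F ^^ i) x, 0)"
proof (induction i)
  case 0 show ?case by (simp add: monom_0 poly_action_simps[OF F] pair_scale_def linear_0[OF F] zero_prod_def)
next
  case (Suc i) then show ?case
    by (simp add: monom_Suc poly_action_simps[OF F])
      (simp add: pair_scale_def linear_0[OF F] linear_scale[OF F])
qed

text \<open>The iterates \<open>x, F x, ...\<close> up to exponent \<open>DIM('a)\<close> are too
  many to be independent. Since \<open>dependent\<close> speaks of sets, a repetition among the
  iterates is treated separately and gives a difference of two monomials.\<close>

lemma poly_action_annihilator:
  fixes F :: "'a::euclidean_space \<Rightarrow> 'a"
  assumes F: "linear F"
  obtains p where "p \<noteq> 0" "poly_action F p (x, 0) = 0"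
proof (cases "inj_on (\<lambda>i. (F ^^ i) x) {..DIM('a)}")
  case False
  then obtain i j where ij: "i \<noteq> j" "(F ^^ i) x = (F ^^ j) x" by (auto simp: inj_on_def)
  define p :: "complex poly" where "p = monom 1 i + monom (-1) j"
  have "coeff p i = 1" using ij by (simp add: p_def)
  then have "p \<noteq> 0" by auto
  moreover have "poly_action F p (x, 0) = 0"
    using poly_action_monom[OF F, of 1 i x] poly_action_monom[OF F, of "-1" j x] ij
    by (simp add: p_def poly_action_add[OF F] zero_prod_def)
  ultimately show ?thesis by (rule that)
next
  case True
  define A where "A = (\<lambda>i. (F ^^ i) x) ` {..DIM('a)}"
  have "card A = Suc DIM('a)" using True by (simp add: A_def card_image)
  then have "dependent A" using dependent_biggerset[of A] by (simp add: A_def)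
  then obtain u where u: "\<exists>v\<in>A. u v \<noteq> 0" "(\<Sum>v\<in>A. u v *\<^sub>R v) = 0"
    using dependent_finite[of A] by (auto simp: A_def)
  define p :: "complex poly" where "p = (\<Sum>i\<le>DIM('a). monom (of_real (u ((F ^^ i) x))) i)"
  have "poly_action F (\<Sum>i\<in>I. monom (of_real (u ((F ^^ i) x))) i) (x, 0)
      = ((\<Sum>i\<in>I. u ((F ^^ i) x) *\<^sub>R (F ^^ i) x), 0)" if "finite I" for I
    using that by induction
      (simp_all add: poly_action_simps[OF F] poly_action_add[OF F] poly_action_monom[OF F] zero_prod_def)
  then have "poly_action F p (x, 0) = ((\<Sum>i\<le>DIM('a). u ((F ^^ i) x) *\<^sub>R (F ^^ i) x), 0)"
    by (simp add: p_def)
  also have "(\<Sum>i\<le>DIM('a). u ((F ^^ i) x) *\<^sub>R (F ^^ i) x) = (\<Sum>v\<in>A. u v *\<^sub>R v)"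
    unfolding A_def by (subst sum.reindex[OF True]) simp
  finally have "poly_action F p (x, 0) = 0" using u by (simp add: zero_prod_def)
  moreover obtain i where "i \<le> DIM('a)" "u ((F ^^ i) x) \<noteq> 0" using u by (auto simp: A_def)
  then have "coeff p i \<noteq> 0" by (simp add: p_def coeff_sum)
  then have "p \<noteq> 0" by auto
  ultimately show ?thesis by (intro that)
qed

text \<open>Take an annihilating polynomial of \<open>x0\<close> of minimal degree and split off a
  root \<open>s\<close>: the cofactor applied to \<open>x0\<close> is nonzero by minimality and is
  an eigenvector for \<open>s\<close>. As a polynomial in \<open>F\<close> applied to
  \<open>x0\<close> it stays in the complexification of \<open>S\<close>, so no matrix of the
  restriction of \<open>F\<close> is needed.\<close>

lemma invariant_subspace_eigenpair:
  fixes F :: "'a::euclidean_space \<Rightarrow> 'a"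
  assumes F: "linear F" and S: "subspace S" and inv: "F ` S \<subseteq> S" and x0: "x0 \<in> S" "x0 \<noteq> 0"
  obtains a b x y where "x \<in> S" "y \<in> S" "x \<noteq> 0 \<or> y \<noteq> 0"
    "F x = a *\<^sub>R x - b *\<^sub>R y" "F y = b *\<^sub>R x + a *\<^sub>R y"
proof -
  define ann where "ann p \<longleftrightarrow> p \<noteq> 0 \<and> poly_action F p (x0, 0) = 0" for p
  obtain p0 where "ann p0" unfolding ann_def using poly_action_annihilator[OF F, of x0] by blast
  then obtain p where p: "ann p" "\<And>q. ann q \<Longrightarrow> degree p \<le> degree q"
    using ex_has_least_nat[of ann p0 degree] by blast
  have "degree p \<noteq> 0"
  proof
    assume "degree p = 0"
    then obtain c where c: "p = [:c:]" by (rule degree_eq_zeroE)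
    then have "c \<noteq> 0" "pair_scale c (x0, 0) = 0"
      using p(1) linear_0[OF F] by (auto simp: ann_def poly_action_simps[OF F] zero_prod_def)
    then show False using x0 by (auto simp: pair_scale_def zero_prod_def complex_eq_iff)
  qed
  then have "\<not> constant (poly p)" by (simp add: constant_degree)
  then obtain s where "poly p s = 0" using fundamental_theorem_of_algebra by blast
  then obtain q where q: "p = [:- s, 1:] * q" by (auto simp: poly_eq_0_iff_dvd elim: dvdE)
  have q0: "q \<noteq> 0" using p(1) q by (auto simp: ann_def)
  then have "degree p = Suc (degree q)" unfolding q by (subst degree_mult_eq) auto
  then have "\<not> ann q" using p(2)[of q] by auto
  then have nz: "poly_action F q (x0, 0) \<noteq> 0" using q0 by (simp add: ann_def)
  obtain x y where xy: "poly_action F q (x0, 0) = (x, y)" by (cases "poly_action F q (x0, 0)")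
  have peq: "p = smult (- s) q + pCons 0 q" by (simp add: q)
  have "poly_action F p (x0, 0) = pair_scale (- s) (x, y) + map_prod F F (x, y)"
    unfolding peq poly_action_add[OF F] poly_action_smult[OF F] poly_action_simps[OF F] xy
    by (simp add: pair_scale_def)
  then have "pair_scale (- s) (x, y) + map_prod F F (x, y) = 0" using p(1) by (simp add: ann_def)
  then have "F x = Re s *\<^sub>R x - Im s *\<^sub>R y" "F y = Im s *\<^sub>R x + Re s *\<^sub>R y"
    by (auto simp: pair_scale_def zero_prod_def algebra_simps add_eq_0_iff)
  moreover have "x \<in> S" "y \<in> S"
    using poly_action_invariant[OF F S inv, of "(x0, 0)" q] x0 S xy by (auto simp: subspace_0)
  moreover have "x \<noteq> 0 \<or> y \<noteq> 0" using nz xy by (auto simp: zero_prod_def)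
  ultimately show ?thesis using that by blast
qed

section \<open>The Kalman-Yakubovich-Popov inequality and Lyapunov matrices\<close>

text \<open>Since \<open>p q\<^sup>* + q p\<^sup>* = 0\<close>, one can write \<open>q = p S\<close> with \<open>S\<close> skew on the orthogonal complement of
  the kernel of \<open>p\<close>; an orthonormal basis adapted to the planes on which \<open>S\<close> is a rotation reduces the trace to
  the two assumptions (finite and infinite frequency).\<close>

lemma skew_family_trace_nonneg:
  fixes p q :: "'e::euclidean_space \<Rightarrow> 'a::euclidean_space" and b :: "'e \<Rightarrow> 'e \<Rightarrow> real"
  assumes p: "linear p" and q: "linear q" and b: "bilinear b"
    and skew: "\<And>h. adjoint p h \<bullet> adjoint q h = 0"
    and fin: "\<And>\<omega> c d. q c = - \<omega> *\<^sub>R p d \<Longrightarrow> q d = \<omega> *\<^sub>R p c \<Longrightarrow> b c c + b d d \<ge> 0"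
    and inf: "\<And>c. p c = 0 \<Longrightarrow> b c c \<ge> 0"
  shows "(\<Sum>e\<in>Basis. b e e) \<ge> 0"
proof -
  define K where "K = {c. p c = 0}"
  define E where "E = range (adjoint p)"
  note lap = adjoint_linear[OF p] and laq = adjoint_linear[OF q]
  have K: "subspace K" unfolding K_def using p by (rule linear_subspace_kernel)
  have E: "subspace E" unfolding E_def by (intro linear_subspace_image lap subspace_UNIV)
  have polar: "adjoint p h \<bullet> adjoint q h' = - (adjoint p h' \<bullet> adjoint q h)" for h h'
    using skew[of "h + h'"] skew[of h] skew[of h']
    by (simp add: linear_add[OF lap] linear_add[OF laq] inner_add_left inner_add_right)
  have inj: "inj_on p E"
  proof (rule linear_inj_on_iff_eq_0[OF p E, THEN iffD2], safe)
    fix c assume c: "c \<in> E" "p c = 0"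
    then obtain h where h: "c = adjoint p h" by (auto simp: E_def)
    have "c \<bullet> c = p c \<bullet> h" using adjoint_works[OF p, of c h] h by simp
    then show "c = 0" using c by simp
  qed
  \<comment> \<open>A vector \<open>h\<close> orthogonal to the image of \<open>E\<close> under
    \<open>p\<close> satisfies \<open>adjoint p h = 0\<close>; the polarised skewness then makes
    \<open>h\<close> orthogonal to \<open>q c\<close>. This is what allows \<open>q\<close> to be
    written as \<open>p\<close> after \<open>S\<close> on \<open>E\<close>.\<close>
  have qE: "q c \<in> p ` E" if "c \<in> E" for c
  proof -
    have "subspace (p ` E)" using E p by (rule linear_subspace_image[rotated])
    then have eq: "(p ` E)\<^sup>\<bottom>\<^sup>\<bottom> = p ` E" by (rule orthogonal_comp_self)
    obtain h' where h': "c = adjoint p h'" using \<open>c \<in> E\<close> by (auto simp: E_def)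
    have "h \<bullet> q c = 0" if h: "h \<in> (p ` E)\<^sup>\<bottom>" for h
    proof -
      have "p (adjoint p h) \<bullet> h = 0"
        using h by (auto simp: orthogonal_comp_def orthogonal_def E_def)
      then have "adjoint p h \<bullet> adjoint p h = 0" using adjoint_works[OF p, of "adjoint p h" h] by simp
      then have "adjoint p h = 0" by simp
      moreover have "h \<bullet> q c = adjoint p h' \<bullet> adjoint q h"
        using adjoint_works[OF q, of c h] h' by (simp add: inner_commute)
      ultimately show ?thesis using polar[of h' h] by simp
    qed
    then have "q c \<in> (p ` E)\<^sup>\<bottom>\<^sup>\<bottom>" by (subst orthogonal_comp_def) (auto simp: orthogonal_def)
    then show ?thesis by (simp add: eq)
  qed
  obtain g where g: "range g \<subseteq> E" "linear g" "\<forall>v\<in>E. g (p v) = v"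
    using linear_exists_left_inverse_on[OF p E inj] by blast
  define S where "S = g \<circ> q"
  have S: "linear S" unfolding S_def by (intro linear_compose q g)
  have pS: "p (S c) = q c" if "c \<in> E" for c
    using qE[OF that] g(3) by (auto simp: S_def)
  have Sin: "S ` E \<subseteq> E" using g(1) by (auto simp: S_def)
  have Sad: "S c \<bullet> adjoint p h = c \<bullet> adjoint q h" if "c \<in> E" for c h
    using adjoint_works[OF p, of "S c" h] adjoint_works[OF q, of c h] pS[OF that] by simp
  have Sskew: "S c \<bullet> d = - (c \<bullet> S d)" if cd: "c \<in> E" "d \<in> E" for c d
  proof -
    obtain h h' where h: "c = adjoint p h" "d = adjoint p h'" using cd by (auto simp: E_def)
    have "S c \<bullet> d = c \<bullet> adjoint q h'" using Sad[OF that(1)] h by simp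
    also have "\<dots> = - (d \<bullet> adjoint q h)" using polar[of h h'] h by simp
    also have "\<dots> = - (c \<bullet> S d)" using Sad[OF that(2), of h] h by (simp add: inner_commute)
    finally show ?thesis .
  qed
  have Spos: "b c c + b d d \<ge> 0"
    if "c \<in> E" "d \<in> E" "S c = - \<omega> *\<^sub>R d" "S d = \<omega> *\<^sub>R c" for c d \<omega>
  proof (rule fin)
    show "q c = - \<omega> *\<^sub>R p d" "q d = \<omega> *\<^sub>R p c"
      using pS[OF that(1)] pS[OF that(2)] unfolding that(3,4)
      by (simp_all add: linear_scale[OF p] linear_neg[OF p])
  qed
  have "\<exists>T. finite T \<and> T \<subseteq> E \<and> pairwise orthogonal T \<and> (\<forall>u\<in>T. norm u = 1) \<and> span T = E
           \<and> (\<Sum>u\<in>T. b u u) \<ge> 0"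
    by (rule skew_invariant_basis[where b = b, OF S E Sin Sskew Spos bilinear_lzero[OF b]])
  then obtain T where T: "finite T" "T \<subseteq> E" "pairwise orthogonal T" "\<forall>u\<in>T. norm u = 1" "span T = E"
    "(\<Sum>u\<in>T. b u u) \<ge> 0" by (elim exE conjE)
  \<comment> \<open>The complement of \<open>E\<close> is the kernel of \<open>p\<close>, where no
    frequency is attached to a vector and \<open>inf\<close> applies instead of
    \<open>fin\<close>.\<close>
  obtain T' where T': "T' \<subseteq> K" "pairwise orthogonal T'" "\<And>u. u \<in> T' \<Longrightarrow> norm u = 1"
      "independent T'" "span T' = K"
    using orthonormal_basis_subspace[OF K] by metis
  have fT': "finite T'" using T'(4) by (rule independent_imp_finite)
  have xo: "orthogonal u v" if uv: "u \<in> E" "v \<in> K" for u v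
  proof -
    obtain h where "u = adjoint p h" using uv by (auto simp: E_def)
    then show ?thesis using adjoint_works[OF p, of v h] uv
      by (simp add: orthogonal_def inner_commute K_def)
  qed
  have disj: "T \<inter> T' = {}"
  proof (rule ccontr)
    assume "T \<inter> T' \<noteq> {}"
    then obtain u where u: "u \<in> T" "u \<in> T'" by auto
    then have "u \<in> E" "u \<in> K" using T(2) T'(1) by auto
    then have "u = 0" using xo[of u u] by (simp add: orthogonal_def)
    then show False using T(4) u(1) by auto
  qed
  have "pairwise orthogonal (T \<union> T')"
    using T(2,3) T'(1,2) xo xo[THEN orthogonal_commute[THEN iffD1]] unfolding pairwise_def by blast
  moreover have "span (T \<union> T') = UNIV"
  proof -
    have "x \<in> span (T \<union> T')" for x
    proof -
      obtain u w where uw: "u \<in> span T" "\<And>y. y \<in> span T \<Longrightarrow> orthogonal w y" "x = u + w"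
        using orthogonal_subspace_decomp_exists[of T x] by metis
      have "p w \<bullet> p w = w \<bullet> adjoint p (p w)" by (simp add: adjoint_works[OF p])
      also have "\<dots> = 0" using uw(2)[of "adjoint p (p w)"] T(5) by (auto simp: E_def orthogonal_def)
      finally have "w \<in> span T'" by (simp add: T'(5) K_def)
      then show ?thesis using uw by (metis span_add span_mono subsetD sup_ge1 sup_ge2)
    qed
    then show ?thesis by auto
  qed
  ultimately have "(\<Sum>e\<in>Basis. b e e) = (\<Sum>u\<in>T \<union> T'. b u u)"
    using T T' fT' by (intro trace_orthonormal_basis[OF b]) auto
  also have "\<dots> = (\<Sum>u\<in>T. b u u) + (\<Sum>u\<in>T'. b u u)"
    using T fT' disj by (simp add: sum.union_disjoint)
  also have "\<dots> \<ge> 0"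
    using T'(1) inf by (intro add_nonneg_nonneg[OF T(6)] sum_nonneg) (auto simp: K_def)
  finally show ?thesis .
qed

section \<open>Convex duality on symmetric matrices\<close>

definition outer :: "real^'m \<Rightarrow> real^'n \<Rightarrow> real^'n^'m" where
  "outer x y = (\<chi> i j. x $ i * y $ j)"

lemma inner_outer: "M \<bullet> outer x y = x \<bullet> (M *v y)"
  by (simp add: outer_def inner_vec_def matrix_vector_mult_def sum_distrib_left mult_ac)

lemma outer_mult_vec: "outer x y *v z = (y \<bullet> z) *\<^sub>R x"
  by (simp add: outer_def inner_vec_def matrix_vector_mult_def vec_eq_iff sum_distrib_left mult_ac)

lemma sum_mult_vec: "(\<Sum>i\<in>I. M i) *v z = (\<Sum>i\<in>I. M i *v z)"
  for M :: "'i \<Rightarrow> real^'n^'m"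
  by (induction I rule: infinite_finite_induct) (simp_all add: matrix_vector_mult_add_rdistrib)

text \<open>The vectors \<open>sqrt (u i) *\<^sub>R \<xi> i\<close> become the columns of one linear
  map \<open>U\<close>, so that \<open>sym0\<close> is exactly the skewness
  \<open>p q^T + q p^T = 0\<close> for \<open>p\<close>, \<open>q\<close> equal to \<open>X\<close>,
  \<open>Y\<close> after \<open>U\<close>, and the weighted sum is a trace. The type
  \<open>'t\<close> only supplies enough coordinates; surplus ones are mapped to
  \<open>0\<close>.\<close>

lemma weighted_family_nonneg:
  fixes X Y :: "'k::euclidean_space \<Rightarrow> real^'m" and b :: "'k \<Rightarrow> 'k \<Rightarrow> real"
  assumes X: "linear X" and Y: "linear Y" and b: "bilinear b"
    and fin: "\<And>\<omega> \<xi> \<eta>. Y \<xi> = - \<omega> *\<^sub>R X \<eta> \<Longrightarrow> Y \<eta> = \<omega> *\<^sub>R X \<xi> \<Longrightarrow> b \<xi> \<xi> + b \<eta> \<eta> \<ge> 0"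
    and inf: "\<And>\<xi>. X \<xi> = 0 \<Longrightarrow> b \<xi> \<xi> \<ge> 0"
    and I: "finite I" "card I \<le> CARD('t::finite)" and u: "\<And>i. i \<in> I \<Longrightarrow> u i \<ge> 0"
    and sym0: "(\<Sum>i\<in>I. u i *\<^sub>R (outer (X (\<xi> i)) (Y (\<xi> i)) + outer (Y (\<xi> i)) (X (\<xi> i)))) = 0"
  shows "(\<Sum>i\<in>I. u i * b (\<xi> i) (\<xi> i)) \<ge> 0"
proof -
  obtain j where j: "inj_on j I" "j ` I \<subseteq> (UNIV :: 't set)"
    using card_le_inj[OF I(1), of "UNIV :: 't set"] I(2) by auto
  define \<eta> where "\<eta> t = (if t \<in> j ` I then sqrt (u (inv_into I j t)) *\<^sub>R \<xi> (inv_into I j t) else 0)" for t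
  define U where "U c = (\<Sum>t\<in>UNIV. (c $ t) *\<^sub>R \<eta> t)" for c :: "real^'t"
  have U: "linear U"
    unfolding U_def by (auto intro!: linearI simp: scaleR_add_left sum.distrib scaleR_sum_right)
  have Uax: "U (axis t 1) = \<eta> t" for t
    unfolding U_def axis_def by (simp add: if_distrib[of "\<lambda>x. x *\<^sub>R _"] cong: if_cong)
  have transfer: "(\<Sum>e\<in>Basis. f (U e)) = (\<Sum>i\<in>I. f (sqrt (u i) *\<^sub>R \<xi> i))"
    if f0: "f 0 = (0::real)" for f
  proof -
    have Bas: "(Basis :: (real^'t) set) = (\<lambda>t. axis t 1) ` UNIV" by (auto simp: Basis_vec_def)
    have "(\<Sum>e\<in>Basis. f (U e)) = (\<Sum>t\<in>UNIV. f (\<eta> t))"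
      unfolding Bas by (subst sum.reindex) (auto simp: Uax inj_on_def axis_eq_axis)
    also have "\<dots> = (\<Sum>t\<in>j ` I. f (\<eta> t))"
      by (rule sum.mono_neutral_right) (auto simp: \<eta>_def f0)
    also have "\<dots> = (\<Sum>i\<in>I. f (sqrt (u i) *\<^sub>R \<xi> i))"
      by (subst sum.reindex[OF j(1)]) (auto intro!: sum.cong simp: \<eta>_def j(1))
    finally show ?thesis .
  qed
  have p: "linear (\<lambda>c. X (U c))" and q: "linear (\<lambda>c. Y (U c))"
    using linear_compose[OF U X] linear_compose[OF U Y] by (simp_all add: o_def)
  have bU: "bilinear (\<lambda>c d. b (U c) (U d))"
    using b unfolding bilinear_def
    by (auto intro!: linearI simp: linear_rules[OF U]
        bilinear_rules[OF b])
  have skew: "adjoint (\<lambda>c. X (U c)) h \<bullet> adjoint (\<lambda>c. Y (U c)) h = 0" for h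
  proof -
    have "adjoint (\<lambda>c. X (U c)) h \<bullet> adjoint (\<lambda>c. Y (U c)) h
        = (\<Sum>e\<in>Basis. (X (U e) \<bullet> h) * (Y (U e) \<bullet> h))"
      by (subst euclidean_inner) (simp add: inner_commute[of "adjoint _ _"] adjoint_works[OF p] adjoint_works[OF q])
    also have "\<dots> = (\<Sum>i\<in>I. (X (sqrt (u i) *\<^sub>R \<xi> i) \<bullet> h) * (Y (sqrt (u i) *\<^sub>R \<xi> i) \<bullet> h))"
      by (rule transfer) (simp add: linear_0[OF X])
    also have "\<dots> = (\<Sum>i\<in>I. u i * ((X (\<xi> i) \<bullet> h) * (Y (\<xi> i) \<bullet> h)))"
      using u by (intro sum.cong) (simp_all add: linear_scale[OF X] linear_scale[OF Y])
    also have "2 * \<dots> = h \<bullet> ((\<Sum>i\<in>I. u i *\<^sub>R (outer (X (\<xi> i)) (Y (\<xi> i)) + outer (Y (\<xi> i)) (X (\<xi> i)))) *v h)"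
      by (simp add: sum_mult_vec inner_sum_right sum_distrib_left scaleR_matrix_vector_assoc[symmetric]
          matrix_vector_mult_add_rdistrib outer_mult_vec inner_add_right inner_commute algebra_simps)
    also have "\<dots> = 0" unfolding sym0 by simp
    finally show ?thesis by simp
  qed
  have "(\<Sum>e\<in>Basis. b (U e) (U e)) \<ge> 0"
  proof (rule skew_family_trace_nonneg[OF p q bU skew])
    show "b (U c) (U c) + b (U d) (U d) \<ge> 0"
      if "Y (U c) = - \<omega> *\<^sub>R X (U d)" "Y (U d) = \<omega> *\<^sub>R X (U c)" for \<omega> c d
      using fin[OF that] .
    show "b (U c) (U c) \<ge> 0" if "X (U c) = 0" for c using inf[OF that] .
  qed
  also have "(\<Sum>e\<in>Basis. b (U e) (U e)) = (\<Sum>i\<in>I. b (sqrt (u i) *\<^sub>R \<xi> i) (sqrt (u i) *\<^sub>R \<xi> i))"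
    by (rule transfer) (simp add: bilinear_lzero[OF b])
  also have "\<dots> = (\<Sum>i\<in>I. u i * b (\<xi> i) (\<xi> i))"
    using u by (intro sum.cong) (simp_all add: bilinear_lmul[OF b] bilinear_rmul[OF b])
  finally show ?thesis .
qed

lemma inner_transpose_mult: "x \<bullet> (transpose P *v y) = y \<bullet> (P *v x)" for P :: "real^'n^'m"
  by (metis dot_lmul_matrix inner_commute transpose_matrix_vector)

text \<open>\<open>P\<close> is a Lagrange multiplier for minimising \<open>b\<close> over families
  with vanishing symmetrised matrix \<open>X Y^T + Y X^T\<close>: by the trace argument no such
  family gives a negative value, and a hyperplane separating the negative ray from the attainable
  pairs has \<open>P\<close> as its matrix part. The hypothesis \<open>reach\<close> takes the place
  of controllability on the range of \<open>X\<close>.\<close>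

theorem kyp_inequality:
  fixes X Y :: "'k::euclidean_space \<Rightarrow> real^'m" and b :: "'k \<Rightarrow> 'k \<Rightarrow> real"
  assumes X: "linear X" and Y: "linear Y" and b: "bilinear b"
    and fin: "\<And>\<omega> \<xi> \<eta>. Y \<xi> = - \<omega> *\<^sub>R X \<eta> \<Longrightarrow> Y \<eta> = \<omega> *\<^sub>R X \<xi> \<Longrightarrow> b \<xi> \<xi> + b \<eta> \<eta> \<ge> 0"
    and inf: "\<And>\<xi>. X \<xi> = 0 \<Longrightarrow> b \<xi> \<xi> \<ge> 0"
    and Yin: "\<And>\<xi>. Y \<xi> \<in> range X"
    and reach: "\<And>P x y. transpose P = P \<Longrightarrow> (\<And>\<xi>. 0 \<le> X \<xi> \<bullet> (P *v Y \<xi>)) \<Longrightarrow>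
        x \<in> range X \<Longrightarrow> y \<in> range X \<Longrightarrow> x \<bullet> (P *v y) = 0"
  shows "\<exists>P. transpose P = P \<and> (\<forall>\<xi>. 2 * (X \<xi> \<bullet> (P *v Y \<xi>)) \<le> b \<xi> \<xi>)"
proof -
  define so where "so \<xi> = outer (X \<xi>) (Y \<xi>) + outer (Y \<xi>) (X \<xi>)" for \<xi>
  \<comment> \<open>Adding the annihilator \<open>N\<close> of the symmetric forms on the range of \<open>X\<close> to the cone makes the separating
    functional vanish on \<open>N\<close>, so that by \<open>reach\<close> it cannot be vertical and no closedness of the cone is needed.\<close>
  define N :: "(real^'m^'m) set" where
    "N = {S. \<forall>x\<in>range X. \<forall>y\<in>range X. x \<bullet> (S *v y) + y \<bullet> (S *v x) = 0}"
  have N: "subspace N"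
  proof (rule subspaceI)
    show "0 \<in> N" by (simp add: N_def)
    fix S S' assume S: "S \<in> N"
    show "c *\<^sub>R S \<in> N" for c
      using S by (auto simp: N_def scaleR_matrix_vector_assoc[symmetric] simp flip: distrib_left)
    assume S': "S' \<in> N"
    show "S + S' \<in> N"
      unfolding N_def
    proof (intro CollectI ballI)
      fix x y assume "x \<in> range X" "y \<in> range X"
      then have "x \<bullet> (S *v y) + y \<bullet> (S *v x) = 0" "x \<bullet> (S' *v y) + y \<bullet> (S' *v x) = 0"
        using S S' unfolding N_def by blast+
      then show "x \<bullet> ((S + S') *v y) + y \<bullet> ((S + S') *v x) = 0"
        by (simp add: matrix_vector_mult_add_rdistrib inner_add_right)
    qed
  qed
  have inner_so: "M \<bullet> so \<xi> = X \<xi> \<bullet> ((M + transpose M) *v Y \<xi>)" for M \<xi>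
    by (simp add: so_def inner_add_right inner_outer matrix_vector_mult_add_rdistrib inner_transpose_mult del: transpose_matrix_vector)
  have N_so: "S \<bullet> so \<xi> = 0" if "S \<in> N" for S \<xi>
    using that Yin[of \<xi>] unfolding N_def
    by (auto simp: so_def inner_add_right inner_outer)
  define D where "D = {(b \<xi> \<xi>, so \<xi> + S) | \<xi> S. S \<in> N}"
  define ray :: "(real \<times> (real^'m^'m)) set" where "ray = {..<0} \<times> {0}"
  have "ray \<inter> convex hull D = {}"
  proof (rule ccontr)
    assume "ray \<inter> convex hull D \<noteq> {}"
    then obtain r where r: "r < 0" "(r, 0) \<in> convex hull D" by (auto simp: ray_def)
    then obtain T u where T: "finite T" "T \<subseteq> D" "card T \<le> DIM(real \<times> (real^'m^'m)) + 1"
        "\<forall>v\<in>T. 0 \<le> u v" "(\<Sum>v\<in>T. u v *\<^sub>R v) = (r, 0)"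
      unfolding convex_hull_caratheodory by auto
    have "\<forall>v\<in>T. \<exists>\<xi> S. S \<in> N \<and> v = (b \<xi> \<xi>, so \<xi> + S)" using T(2) unfolding D_def by blast
    then obtain \<xi> S where S: "\<And>v. v \<in> T \<Longrightarrow> S v \<in> N" and v: "\<And>v. v \<in> T \<Longrightarrow> v = (b (\<xi> v) (\<xi> v), so (\<xi> v) + S v)"
      by metis
    have "(\<Sum>v\<in>T. u v *\<^sub>R v) = (\<Sum>v\<in>T. u v *\<^sub>R (b (\<xi> v) (\<xi> v), so (\<xi> v) + S v))"
      using v by (intro sum.cong) auto
    then have eq: "(\<Sum>v\<in>T. u v * b (\<xi> v) (\<xi> v)) = r" "(\<Sum>v\<in>T. u v *\<^sub>R so (\<xi> v)) + (\<Sum>v\<in>T. u v *\<^sub>R S v) = 0"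
      unfolding T(5) by (auto simp: sum_prod scaleR_add_right sum.distrib)
    \<comment> \<open>\<open>M\<close> lies in \<open>N\<close>, being minus a combination of
      elements of \<open>N\<close>, and is orthogonal to \<open>N\<close>, being a combination of
      matrices \<open>so\<close>; hence it vanishes and the trace lemma applies.\<close>
    define M where "M = (\<Sum>v\<in>T. u v *\<^sub>R so (\<xi> v))"
    have SN: "(\<Sum>v\<in>T. u v *\<^sub>R S v) \<in> N" using S N by (intro subspace_sum subspace_scale) auto
    have "(\<Sum>v\<in>T. u v *\<^sub>R S v) = - M" using eq(2) by (simp add: M_def eq_neg_iff_add_eq_0 add.commute)
    with SN N have "M \<in> N" using subspace_neg[OF N, of "- M"] by simp
    then have "M \<bullet> M = 0" by (subst (2) M_def) (simp add: inner_sum_right N_so)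
    then have M0: "M = 0" by simp
    \<comment> \<open>Caratheodory needs at most dimension plus one points, here
      \<open>CARD('m) * CARD('m) + 2\<close>, which is the cardinality of the type with two
      \<open>option\<close> layers.\<close>
    have dim: "card T \<le> CARD(('m \<times> 'm) option option)" using T(3) by simp
    have "0 \<le> (\<Sum>v\<in>T. u v * b (\<xi> v) (\<xi> v))"
      by (rule weighted_family_nonneg[OF X Y b fin inf T(1) dim, where u = u and \<xi> = \<xi>])
        (use T(4) M0 in \<open>auto simp: M_def so_def\<close>)
    with eq r show False by simp
  qed
  moreover have "convex ray" unfolding ray_def by (intro convex_Times convex_real_interval convex_singleton)
  moreover have "(-1, 0) \<in> ray" by (simp add: ray_def)
  moreover have "(0, 0) \<in> D"
  proof -
    have "(0, 0) = (b 0 0, so 0 + 0)"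
      using bilinear_lzero[OF b, of 0] by (simp add: so_def outer_def linear_0[OF X] linear_0[OF Y] vec_eq_iff)
    then show ?thesis unfolding D_def using subspace_0[OF N] by blast
  qed
  ultimately obtain a c where ac: "a \<noteq> 0" "\<forall>x\<in>ray. a \<bullet> x \<le> c" "\<forall>x\<in>convex hull D. a \<bullet> x \<ge> c"
    using separating_hyperplane_sets[of ray "convex hull D"] by (metis convex_convex_hull empty_iff hull_inc)
  obtain \<alpha> M where a: "a = (\<alpha>, M)" by (cases a)
  have lower: "\<alpha> * b \<xi> \<xi> + M \<bullet> so \<xi> + M \<bullet> S \<ge> c" if "S \<in> N" for \<xi> S
  proof -
    have "(b \<xi> \<xi>, so \<xi> + S) \<in> convex hull D" using that by (auto simp: D_def intro!: hull_inc)
    then have "a \<bullet> (b \<xi> \<xi>, so \<xi> + S) \<ge> c" using ac(3) by blast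
    then show ?thesis by (simp add: a inner_add_right)
  qed
  have so0: "so 0 = 0" by (simp add: so_def outer_def linear_0[OF X] linear_0[OF Y] vec_eq_iff)
  have c0: "c \<le> 0" using lower[of 0 0] subspace_0[OF N] bilinear_lzero[OF b, of 0] so0 by simp
  have \<alpha>: "\<alpha> \<ge> 0"
  proof -
    have "a \<bullet> (-1, 0) \<le> c" using ac(2) by (auto simp: ray_def)
    then show ?thesis using c0 by (simp add: a)
  qed
  have nonneg: "m \<ge> 0" if m: "\<And>t. t \<ge> 0 \<Longrightarrow> t * m \<ge> c" for m :: real
  proof (rule ccontr)
    assume "\<not> m \<ge> 0"
    then show False using m[of "(c - 1) / m"] c0 by (auto simp: divide_nonpos_neg)
  qed
  \<comment> \<open>The left side is quadratic in \<open>\<xi>\<close>. Scaling \<open>\<xi>\<close>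
    by \<open>sqrt t\<close> and letting \<open>t\<close> grow improves the lower bound
    \<open>c\<close> to \<open>0\<close>.\<close>
  have form: "\<alpha> * b \<xi> \<xi> + M \<bullet> so \<xi> \<ge> 0" for \<xi>
  proof (rule nonneg)
    fix t :: real assume t: "t \<ge> 0"
    then have tt: "sqrt t * (sqrt t * z) = t * z" for z by (simp flip: mult.assoc)
    have "so (sqrt t *\<^sub>R \<xi>) = t *\<^sub>R so \<xi>"
      by (simp add: tt so_def outer_def vec_eq_iff linear_scale[OF X] linear_scale[OF Y] algebra_simps)
    then show "t * (\<alpha> * b \<xi> \<xi> + M \<bullet> so \<xi>) \<ge> c"
      using lower[of 0 "sqrt t *\<^sub>R \<xi>"] subspace_0[OF N]
      by (simp add: tt bilinear_lmul[OF b] bilinear_rmul[OF b] algebra_simps)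
  qed
  have MN: "M \<bullet> S = 0" if S: "S \<in> N" for S
  proof -
    have "t * (M \<bullet> S) \<ge> c" for t
      using lower[of "t *\<^sub>R S" 0] subspace_scale[OF N S] bilinear_lzero[OF b, of 0] so0 by simp
    note this this[of "- t" for t]
    then have "M \<bullet> S \<ge> 0" "- (M \<bullet> S) \<ge> 0"
      using nonneg[of "M \<bullet> S"] nonneg[of "- (M \<bullet> S)"] by auto
    then show ?thesis by simp
  qed
  define Q where "Q = M + transpose M"
  have Qt: "transpose Q = Q" by (simp add: Q_def transpose_def vec_eq_iff)
  have Qform: "\<alpha> * b \<xi> \<xi> + X \<xi> \<bullet> (Q *v Y \<xi>) \<ge> 0" for \<xi>
    using form[of \<xi>] by (simp add: inner_so Q_def)
  have "\<alpha> \<noteq> 0"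
  proof
    assume "\<alpha> = 0"
    then have "x \<bullet> (Q *v y) = 0" if "x \<in> range X" "y \<in> range X" for x y
      using Qform by (intro reach[OF Qt _ that]) simp
    then have "M \<in> N"
      by (simp add: N_def Q_def matrix_vector_mult_add_rdistrib inner_add_right inner_transpose_mult
          del: transpose_matrix_vector)
    then have "M \<bullet> M = 0" by (rule MN)
    then show False using \<open>\<alpha> = 0\<close> ac(1) a by (simp add: zero_prod_def)
  qed
  with \<alpha> have pos: "\<alpha> > 0" by simp
  define P where "P = (- 1 / (2 * \<alpha>)) *\<^sub>R Q"
  have "transpose P = P" using Qt by (simp add: P_def transpose_def vec_eq_iff)
  moreover have "2 * (X \<xi> \<bullet> (P *v Y \<xi>)) \<le> b \<xi> \<xi>" for \<xi>
  proof -
    have "P *v Y \<xi> = (- 1 / (2 * \<alpha>)) *\<^sub>R (Q *v Y \<xi>)" by (simp only: P_def scaleR_matrix_vector_assoc)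
    then show ?thesis using Qform[of \<xi>] pos by (simp add: field_simps)
  qed
  ultimately show ?thesis by blast
qed

text \<open>A theorem of alternatives: if no such \<open>P\<close> exists, \<open>0\<close> is a
  convex combination of the matrices \<open>x x^T\<close> and of minus the symmetrised
  \<open>x (F x)^T\<close>. This produces a nonzero semidefinite \<open>Z\<close> with
  \<open>F Z + Z F^T\<close> semidefinite, whose range is \<open>F\<close>-invariant and contains an
  eigenpair with nonnegative real part. Restricting to unit vectors keeps both families compact, so
  the separation is strict.\<close>

theorem lyapunov_matrix_exists:
  fixes F :: "real^'m \<Rightarrow> real^'m"
  assumes F: "linear F"
    and stable: "\<And>a c x y. x \<noteq> 0 \<or> y \<noteq> 0 \<Longrightarrow> F x = a *\<^sub>R x - c *\<^sub>R y \<Longrightarrow> F y = c *\<^sub>R x + a *\<^sub>R y \<Longrightarrow> a < 0"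
  shows "\<exists>P. transpose P = P \<and> (\<forall>x. x \<noteq> 0 \<longrightarrow> 0 < x \<bullet> (P *v x)) \<and> (\<forall>x. x \<noteq> 0 \<longrightarrow> x \<bullet> (P *v F x) < 0)"
proof -
  define so where "so x = outer x (F x) + outer (F x) x" for x
  define A where "A = (\<lambda>x. outer x x) ` sphere (0::real^'m) 1"
  define B where "B = (\<lambda>x. - so x) ` sphere (0::real^'m) 1"
  have cF: "continuous_on S F" for S
    using F by (simp add: linear_continuous_on linear_conv_bounded_linear)
  have "continuous_on (sphere 0 1) (\<lambda>x::real^'m. outer x x)"
    unfolding outer_def by (intro continuous_on_vec_lambda continuous_intros)
  then have A: "compact A" unfolding A_def by (intro compact_continuous_image compact_sphere)
  have "continuous_on (sphere 0 1) (\<lambda>x. - so x)"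
    unfolding so_def outer_def by (intro continuous_on_vec_lambda continuous_intros cF)
  then have B: "compact B" unfolding B_def by (intro compact_continuous_image compact_sphere)
  have "0 \<notin> convex hull (A \<union> B)"
  proof
    assume "0 \<in> convex hull (A \<union> B)"
    then obtain T u where T: "finite T" "T \<subseteq> A \<union> B" "\<forall>v\<in>T. 0 \<le> u v" "sum u T = 1"
        "(\<Sum>v\<in>T. u v *\<^sub>R v) = 0"
      unfolding convex_hull_caratheodory by auto
    define T1 where "T1 = T \<inter> A"
    define T2 where "T2 = T - A"
    have T12: "T = T1 \<union> T2" "T1 \<inter> T2 = {}" "finite T1" "finite T2" using T by (auto simp: T1_def T2_def)
    have "\<forall>v\<in>T. \<exists>x. norm x = 1 \<and> (v \<in> T1 \<longrightarrow> v = outer x x) \<and> (v \<in> T2 \<longrightarrow> v = - so x)"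
    proof
      fix v assume v: "v \<in> T"
      show "\<exists>x. norm x = 1 \<and> (v \<in> T1 \<longrightarrow> v = outer x x) \<and> (v \<in> T2 \<longrightarrow> v = - so x)"
      proof (cases "v \<in> A")
        case True
        then obtain x where "norm x = 1" "v = outer x x" by (auto simp: A_def)
        then show ?thesis using True by (auto simp: T2_def)
      next
        case False
        then obtain x where "norm x = 1" "v = - so x" using v T(2) by (auto simp: B_def)
        then show ?thesis using False by (auto simp: T1_def)
      qed
    qed
    then obtain x where x: "\<And>v. v \<in> T \<Longrightarrow> norm (x v) = 1" "\<And>v. v \<in> T1 \<Longrightarrow> v = outer (x v) (x v)"
        "\<And>v. v \<in> T2 \<Longrightarrow> v = - so (x v)" using T12(1) by (metis UnCI)
    define Z where "Z h = (\<Sum>v\<in>T2. (u v * (x v \<bullet> h)) *\<^sub>R x v)" for h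
    have Z: "linear Z"
      unfolding Z_def by (auto intro!: linearI simp: inner_add_right algebra_simps sum.distrib scaleR_sum_right)
    have Zsym: "Z h \<bullet> h' = h \<bullet> Z h'" for h h'
      by (simp add: Z_def inner_sum_left inner_sum_right inner_commute mult_ac)
    have Zpsd: "h \<bullet> Z h \<ge> 0" for h
      using T T12 by (auto simp: Z_def inner_sum_right inner_commute mult.assoc intro!: sum_nonneg)
    have FZ: "F (Z h) = (\<Sum>v\<in>T2. (u v * (x v \<bullet> h)) *\<^sub>R F (x v))" for h
      by (simp add: Z_def linear_sum[OF F] linear_scale[OF F])
    \<comment> \<open>The vanishing convex combination, tested on \<open>h\<close>: the quadratic
      form of \<open>F Z + Z F^T\<close> equals that of the combination of the
      \<open>x x^T\<close>.\<close>
    have lyap: "(\<Sum>v\<in>T1. u v * (x v \<bullet> h)\<^sup>2) = 2 * (h \<bullet> F (Z h))" for h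
    proof -
      have "(\<Sum>v\<in>T. u v *\<^sub>R v) = (\<Sum>v\<in>T1. u v *\<^sub>R v) + (\<Sum>v\<in>T2. u v *\<^sub>R v)"
        using T12 by (simp add: sum.union_disjoint)
      also have "(\<Sum>v\<in>T1. u v *\<^sub>R v) = (\<Sum>v\<in>T1. u v *\<^sub>R outer (x v) (x v))"
        using x(2) by (intro sum.cong) auto
      also have "(\<Sum>v\<in>T2. u v *\<^sub>R v) = - (\<Sum>v\<in>T2. u v *\<^sub>R so (x v))"
        unfolding sum_negf[symmetric] using x(3) by (intro sum.cong) (auto, metis scaleR_minus_right)
      finally have "(\<Sum>v\<in>T1. u v *\<^sub>R outer (x v) (x v)) *v h = (\<Sum>v\<in>T2. u v *\<^sub>R so (x v)) *v h"
        using T by simp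
      then have "h \<bullet> ((\<Sum>v\<in>T1. u v *\<^sub>R outer (x v) (x v)) *v h) = h \<bullet> ((\<Sum>v\<in>T2. u v *\<^sub>R so (x v)) *v h)"
        by simp
      then show ?thesis
        by (simp add: sum_mult_vec scaleR_matrix_vector_assoc[symmetric] outer_mult_vec inner_sum_right so_def
            matrix_vector_mult_add_rdistrib FZ sum_distrib_left power2_eq_square inner_commute algebra_simps)
    qed
    have lyap_pos: "h \<bullet> F (Z h) \<ge> 0" for h
    proof -
      have "(\<Sum>v\<in>T1. u v * (x v \<bullet> h)\<^sup>2) \<ge> 0" using T T12 by (intro sum_nonneg) auto
      then show ?thesis using lyap[of h] by simp
    qed
    \<comment> \<open>For \<open>h\<close> in the kernel of \<open>Z\<close> the semidefinite form
      \<open>h \<bullet> F (Z h)\<close> vanishes, so its polar form does too. Thus the kernel of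
      \<open>Z\<close> is orthogonal to the image under \<open>F\<close> of the range of
      \<open>Z\<close>, and that image lies in the orthogonal complement of the kernel, which is the
      range itself.\<close>
    have Zker: "h \<bullet> F (Z h') = 0" if h: "Z h = 0" for h h'
    proof -
      have bil: "bilinear (\<lambda>h h'. h \<bullet> F (Z h') + h' \<bullet> F (Z h))"
        unfolding bilinear_def
        by (auto intro!: linearI simp: linear_rules[OF Z] linear_rules[OF F]
            inner_add_left inner_add_right algebra_simps)
      have "h \<bullet> F (Z h') + h' \<bullet> F (Z h) = 0"
        by (rule psd_form_kernel[OF bil _ subspace_UNIV]) (use lyap_pos h in \<open>auto simp: linear_0[OF F]\<close>)
      then show ?thesis using h by (simp add: linear_0[OF F])
    qed
    have "adjoint Z = Z" by (rule adjoint_unique) (simp add: Zsym)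
    then have rZ: "range Z = (Z -` {0})\<^sup>\<bottom>"
      using ker_orthogonal_comp_adjoint[OF Z] orthogonal_comp_self[OF linear_subspace_image[OF Z subspace_UNIV]] by simp
    have FrZ: "F ` range Z \<subseteq> range Z"
    proof (rule image_subsetI)
      fix w assume "w \<in> range Z"
      then obtain h' where "w = Z h'" by auto
      then show "F w \<in> range Z" unfolding rZ orthogonal_comp_def orthogonal_def using Zker by auto
    qed
    have "\<exists>h. Z h \<noteq> 0"
    proof (rule ccontr)
      assume "\<nexists>h. Z h \<noteq> 0"
      then have Z0: "Z h = 0" for h by auto
      have "u v = 0" if "v \<in> T2" for v
      proof -
        have "0 = x v \<bullet> Z (x v)" by (simp add: Z0)
        also have "\<dots> = (\<Sum>w\<in>T2. u w * (x v \<bullet> x w)\<^sup>2)"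
          unfolding Z_def inner_sum_right by (intro sum.cong) (auto simp: power2_eq_square inner_commute)
        finally have "\<forall>w\<in>T2. u w * (x v \<bullet> x w)\<^sup>2 = 0"
          using T T12 by (subst sum_nonneg_eq_0_iff[symmetric]) auto
        then show ?thesis using that x(1)[of v] T12 by (auto simp: norm_eq_1)
      qed
      moreover have "u v = 0" if "v \<in> T1" for v
      proof -
        have "(\<Sum>w\<in>T1. u w * (x w \<bullet> x v)\<^sup>2) = 0" using lyap[of "x v"] by (simp add: Z0 linear_0[OF F])
        then have "\<forall>w\<in>T1. u w * (x w \<bullet> x v)\<^sup>2 = 0"
          using T T12 by (subst sum_nonneg_eq_0_iff[symmetric]) auto
        then show ?thesis using that x(1)[of v] T12 by (auto simp: norm_eq_1)
      qed
      ultimately have "sum u T = 0" using T12 by (intro sum.neutral) auto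
      then show False using T by simp
    qed
    then obtain h0 where h0: "Z h0 \<in> range Z" "Z h0 \<noteq> 0" by auto
    obtain a c x y where ev: "x \<in> range Z" "y \<in> range Z" "x \<noteq> 0 \<or> y \<noteq> 0"
        "F x = a *\<^sub>R x - c *\<^sub>R y" "F y = c *\<^sub>R x + a *\<^sub>R y"
      by (rule invariant_subspace_eigenpair[OF F linear_subspace_image[OF Z subspace_UNIV] FrZ h0])
    then obtain h h' where h: "x = Z h" "y = Z h'" by auto
    \<comment> \<open>The terms with \<open>c\<close> cancel by symmetry of \<open>Z\<close>,
      leaving \<open>a\<close> times a nonnegative number. Since \<open>a < 0\<close>, that number
      is zero, which forces the eigenpair to vanish.\<close>
    have "0 \<le> h \<bullet> F (Z h) + h' \<bullet> F (Z h')" using lyap_pos by (intro add_nonneg_nonneg)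
    also have "\<dots> = a * (h \<bullet> Z h + h' \<bullet> Z h')"
      using ev(4,5) Zsym[of h h'] unfolding h
      by (simp only: inner_add_right inner_diff_right inner_scaleR_right inner_commute[of "Z h"] ring_distribs)
    finally have "0 \<le> a * (h \<bullet> Z h + h' \<bullet> Z h')" .
    moreover have "a < 0" using stable ev by blast
    ultimately have "h \<bullet> Z h + h' \<bullet> Z h' \<le> 0" by (simp add: zero_le_mult_iff)
    with Zpsd[of h] Zpsd[of h'] have z: "h \<bullet> Z h = 0" "h' \<bullet> Z h' = 0" by auto
    have bilZ: "bilinear (\<lambda>h h'. h \<bullet> Z h')"
      unfolding bilinear_def
      by (auto intro!: linearI simp: linear_rules[OF Z] inner_add_left inner_add_right)
    have "Z g = 0" if "g \<bullet> Z g = 0" for g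
    proof -
      have "g \<bullet> Z (Z g) = 0"
        by (rule psd_form_kernel[OF bilZ _ subspace_UNIV]) (use Zpsd Zsym that in \<open>auto simp: inner_commute\<close>)
      then show ?thesis using Zsym[of g "Z g"] by simp
    qed
    with z ev(3) h show False by auto
  qed
  then obtain M e where M: "0 < e" "\<forall>v\<in>convex hull (A \<union> B). M \<bullet> v > e"
    using separating_hyperplane_closed_0[of "convex hull (A \<union> B)"] A B
    by (metis compact_Un compact_convex_hull compact_imp_closed convex_convex_hull)
  define P where "P = M + transpose M"
  have P: "transpose P = P" by (simp add: P_def transpose_def vec_eq_iff)
  have Pxy: "x \<bullet> (P *v y) = x \<bullet> (M *v y) + y \<bullet> (M *v x)" for x y
    by (simp add: P_def matrix_vector_mult_add_rdistrib inner_add_right inner_transpose_mult del: transpose_matrix_vector)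
  have unit: "0 < x \<bullet> (P *v x) \<and> x \<bullet> (P *v F x) < 0" if "norm x = 1" for x
  proof -
    have "outer x x \<in> convex hull (A \<union> B)" "- so x \<in> convex hull (A \<union> B)"
      using that by (auto simp: A_def B_def intro!: hull_inc)
    then have "M \<bullet> outer x x > e" "M \<bullet> (- so x) > e" using M(2) by blast+
    then show ?thesis using M(1) by (simp add: Pxy inner_outer so_def inner_add_right inner_diff_right)
  qed
  have "0 < x \<bullet> (P *v x) \<and> x \<bullet> (P *v F x) < 0" if x: "x \<noteq> 0" for x
  proof -
    have "x = norm x *\<^sub>R sgn x" using x by (simp add: sgn_div_norm)
    then obtain t y where ty: "t > 0" "norm y = 1" "x = t *\<^sub>R y"
      using x by (metis norm_sgn zero_less_norm_iff)
    then show ?thesis using unit[of y]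
      by (simp add: linear_scale[OF F] matrix_vector_mult_scaleR zero_less_mult_iff mult_less_0_iff)
  qed
  then show ?thesis using P by blast
qed

section \<open>Storage functions\<close>

text \<open>Orthogonality with respect to \<open>P\<close>, not the Euclidean product, is what later
  lets the Lyapunov estimate ignore reachable components. The auxiliary \<open>q\<close> is the
  Euclidean projection of \<open>P x\<close> onto \<open>R\<close>; it is invertible on
  \<open>R\<close> by definiteness, and composing with the inverse gives \<pi>.\<close>

lemma orthogonal_projection_wrt_form:
  fixes P :: "real^'m^'m" and R :: "(real^'m) set"
  assumes R: "subspace R" and pos: "\<And>x. x \<noteq> 0 \<Longrightarrow> 0 < x \<bullet> (P *v x)"
  obtains \<pi> where "linear \<pi>" "\<And>x. \<pi> x \<in> R" "\<And>x. x \<in> R \<Longrightarrow> \<pi> x = x"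
    "\<And>x y. y \<in> R \<Longrightarrow> y \<bullet> (P *v (x - \<pi> x)) = 0"
proof -
  obtain T where T: "T \<subseteq> R" "pairwise orthogonal T" "\<And>u. u \<in> T \<Longrightarrow> norm u = 1"
      "independent T" "span T = R"
    using orthonormal_basis_subspace[OF R] by metis
  have fT: "finite T" using T(4) by (rule independent_imp_finite)
  define q where "q x = (\<Sum>u\<in>T. (u \<bullet> (P *v x)) *\<^sub>R u)" for x
  have q: "linear q"
    unfolding q_def
    by (auto intro!: linearI simp: matrix_vector_right_distrib inner_add_right scaleR_add_left sum.distrib
        matrix_vector_mult_scaleR scaleR_sum_right)
  have qR: "q x \<in> R" for x unfolding q_def using T(1) R by (auto intro!: subspace_sum subspace_scale)
  have yq: "y \<bullet> q x = y \<bullet> (P *v x)" if "y \<in> R" for x y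
  proof -
    have y: "(\<Sum>u\<in>T. (y \<bullet> u) *\<^sub>R u) = y"
      using orthonormal_basis_expand[OF T(2,3) _ fT, of y] that T(5) by simp
    have "y \<bullet> q x = (\<Sum>u\<in>T. (y \<bullet> u) *\<^sub>R u) \<bullet> (P *v x)"
      by (simp only: q_def inner_sum_right inner_sum_left) (simp add: mult_ac)
    then show ?thesis using y by simp
  qed
  have inj: "inj_on q R"
  proof (rule linear_inj_on_iff_eq_0[OF q R, THEN iffD2], safe)
    fix x assume "x \<in> R" "q x = 0"
    then have "x \<bullet> (P *v x) = 0" using yq[of x x] by simp
    then show "x = 0" using pos[of x] by force
  qed
  have "q ` R = R"
  proof (rule subspace_dim_equal)
    show "subspace (q ` R)" using q R by (rule linear_subspace_image)
    show "q ` R \<subseteq> R" using qR by auto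
    have "dim (q ` R) = dim R" using q inj R by (intro dim_image_eq) (metis span_eq_iff)+
    then show "dim (q ` R) \<ge> dim R" by simp
  qed (rule R)
  obtain g where g: "range g \<subseteq> R" "linear g" "\<forall>v\<in>R. g (q v) = v"
    using linear_exists_left_inverse_on[OF q R inj] by blast
  show ?thesis
  proof
    show "linear (g \<circ> q)" by (intro linear_compose q g)
    show "(g \<circ> q) x \<in> R" for x using g by auto
    show "(g \<circ> q) x = x" if "x \<in> R" for x using g that by auto
    show "y \<bullet> (P *v (x - (g \<circ> q) x)) = 0" if y: "y \<in> R" for x y
    proof -
      obtain x' where x': "x' \<in> R" "q x = q x'" using \<open>q ` R = R\<close> qR[of x] by (metis imageE)
      then have "q (x - (g \<circ> q) x) = 0" using g(3) by (simp add: linear_diff[OF q])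
      then show ?thesis using yq[OF y, of "x - (g \<circ> q) x"] by simp
    qed
  qed
qed

text \<open>Dynamically, \<open>q\<close> does not increase along \<open>x' = H x\<close> while
  solutions tend to \<open>0\<close>, so it cannot start negative. The proof needs no flow: it looks
  at a minimiser of the quotient of \<open>q\<close> by the form of \<open>P\<close>.\<close>

lemma lyapunov_form_nonneg:
  fixes q :: "real^'m \<Rightarrow> real^'m \<Rightarrow> real" and P :: "real^'m^'m"
  assumes q: "bilinear q" and sym: "\<And>x y. q x y = q y x" and R: "subspace R"
    and inv: "\<And>x. x \<in> R \<Longrightarrow> H x \<in> R" and dec: "\<And>x. x \<in> R \<Longrightarrow> q x (H x) \<le> 0"
    and Psym: "transpose P = P" and pos: "\<And>x. x \<noteq> 0 \<Longrightarrow> 0 < x \<bullet> (P *v x)"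
    and neg: "\<And>x. x \<noteq> 0 \<Longrightarrow> x \<bullet> (P *v H x) < 0"
    and x: "x \<in> R"
  shows "q x x \<ge> 0"
proof (rule ccontr)
  assume n: "\<not> q x x \<ge> 0"
  then have x0: "x \<noteq> 0" using bilinear_lzero[OF q, of 0] by auto
  define K where "K = sphere 0 1 \<inter> R"
  define h where "h y = q y y / (y \<bullet> (P *v y))" for y
  have K: "compact K" unfolding K_def by (intro compact_Int_closed compact_sphere closed_subspace R)
  have bq: "bounded_bilinear q" using q by (simp add: bilinear_conv_bounded_bilinear)
  have nz: "y \<bullet> (P *v y) \<noteq> 0" if "y \<in> K" for y
  proof -
    have "y \<noteq> 0" using that by (auto simp: K_def)
    then show ?thesis using pos[of y] by simp
  qed
  have "continuous_on K h"
    unfolding h_def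
    by (intro continuous_intros bounded_bilinear.continuous_on[OF bq] linear_continuous_on
        matrix_vector_mul_bounded_linear ballI nz)
  moreover have "(1 / norm x) *\<^sub>R x \<in> K" using x x0 R by (auto simp: K_def subspace_scale)
  ultimately obtain y where y: "y \<in> K" "\<forall>z\<in>K. h y \<le> h z"
    using continuous_attains_inf[OF K] by blast
  define \<tau> where "\<tau> = - h y"
  have hs: "h (t *\<^sub>R z) = h z" if "t \<noteq> 0" for t z
    using that by (simp add: h_def bilinear_lmul[OF q] bilinear_rmul[OF q] matrix_vector_mult_scaleR)
  have hz: "h y \<le> h z" if "z \<in> R" "z \<noteq> 0" for z
    using y(2)[rule_format, of "(1 / norm z) *\<^sub>R z"] hs[of "1 / norm z" z] that R
    by (auto simp: K_def subspace_scale)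
  have "h x < 0" using n pos[OF x0] by (simp add: h_def divide_neg_pos)
  then have \<tau>: "\<tau> > 0" using hz[OF x x0] by (simp add: \<tau>_def)
  \<comment> \<open>If the minimum is \<open>- \<tau> < 0\<close>, this form is semidefinite on
    \<open>R\<close> with the minimiser \<open>y\<close> in its kernel, so \<open>b y (H y)\<close>
    must vanish; yet both of its summands are nonpositive and the second is negative.\<close>
  define b where "b u v = q u v + \<tau> * (u \<bullet> (P *v v))" for u v
  have b: "bilinear b"
    unfolding b_def bilinear_def
    by (auto intro!: linearI simp: bilinear_rules[OF q]
        form_rules algebra_simps)
  have bsym: "b u v = b v u" for u v
    using sym[of u v] inner_transpose_mult[of u P v] Psym by (simp add: b_def)
  have bpos: "b z z \<ge> 0" if "z \<in> R" for z
  proof (cases "z = 0")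
    case True then show ?thesis using bilinear_lzero[OF b] by simp
  next
    case False
    have "- \<tau> \<le> q z z / (z \<bullet> (P *v z))" using hz[OF that False] by (simp add: h_def \<tau>_def)
    then show ?thesis using pos[OF False] by (simp add: b_def field_simps)
  qed
  have yR: "y \<in> R" and y0: "y \<noteq> 0" using y by (auto simp: K_def)
  have byy: "b y y = 0" using pos[OF y0] by (simp add: b_def \<tau>_def h_def)
  have "b y (H y) = 0"
    by (rule psd_form_kernel[OF b bsym R bpos yR byy inv[OF yR]])
  moreover have "b y (H y) < 0"
    using dec[OF yR] neg[OF y0] \<tau> by (simp add: b_def add_nonpos_neg mult_pos_neg)
  ultimately show False by simp
qed

section \<open>Supply rate and reachable subspace\<close>

locale popov_form =
  fixes F :: "real^'m \<Rightarrow> real^'m" and B :: "real^'n \<Rightarrow> real^'m" and C :: "real^'m \<Rightarrow> real^'n"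
    and \<sigma> \<theta> \<delta> \<rho> :: real
  assumes F: "linear F" and B: "linear B" and C: "linear C"
begin

definition \<Gamma> :: "real^'m \<Rightarrow> real^'n" where
  "\<Gamma> x = \<sigma> *\<^sub>R C (F x) + \<theta> *\<^sub>R C x"

text \<open>Popov's supply rate. With \<open>e = F x + B v\<close> it reads \<open>v \<bullet>
  (\<sigma> C e + \<theta> C x) - \<delta> |v|^2 + \<rho> |C x|^2\<close>; along trajectories
  \<open>e\<close> is the derivative of the state, so the \<sigma> term is the derivative of a
  potential when \<open>v\<close> is a gradient of \<open>C x\<close>.\<close>

definition G :: "real^'m \<Rightarrow> real^'n \<Rightarrow> real" where
  "G x v = v \<bullet> \<Gamma> x + \<sigma> * (v \<bullet> C (B v)) - \<delta> * (v \<bullet> v) + \<rho> * (C x \<bullet> C x)"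

text \<open>The symmetric polar form of \<open>G\<close> on state-input pairs.\<close>

definition g :: "real^'m \<Rightarrow> real^'n \<Rightarrow> real^'m \<Rightarrow> real^'n \<Rightarrow> real" where
  "g x v y u = (v \<bullet> \<Gamma> y + u \<bullet> \<Gamma> x) / 2 + \<sigma> * (v \<bullet> C (B u) + u \<bullet> C (B v)) / 2
     - \<delta> * (v \<bullet> u) + \<rho> * (C x \<bullet> C y)"

text \<open>The controllable subspace of \<open>(F, B)\<close>, defined as a least invariant
  subspace so that minimality serves as its induction principle.\<close>

definition reachable :: "(real^'m) set" where
  "reachable = \<Inter>{S. subspace S \<and> F ` S \<subseteq> S \<and> range B \<subseteq> S}"

lemma \<Gamma>_linear: "linear \<Gamma>"
  unfolding \<Gamma>_def
  by (auto intro!: linearI simp: linear_add[OF F] linear_add[OF C] linear_scale[OF F] linear_scale[OF C] algebra_simps)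

lemmas lin_simps = linear_add[OF F] linear_add[OF B] linear_add[OF C] linear_add[OF \<Gamma>_linear]
  linear_scale[OF F] linear_scale[OF B] linear_scale[OF C] linear_scale[OF \<Gamma>_linear]
  linear_0[OF F] linear_0[OF B] linear_0[OF C] linear_0[OF \<Gamma>_linear]

lemma g_diag: "g x v x v = G x v"
  by (simp add: g_def G_def)

lemma g_sym: "g x v y u = g y u x v"
  by (simp add: g_def inner_commute add.commute)

lemma subspace_reachable: "subspace reachable"
  unfolding reachable_def by (rule subspace_Inter) auto

lemma B_reachable: "B v \<in> reachable"
  unfolding reachable_def by auto

lemma F_reachable: "x \<in> reachable \<Longrightarrow> F x \<in> reachable"
  unfolding reachable_def by blast

lemma reachable_minimal:
  assumes "subspace S" "\<And>x. x \<in> S \<Longrightarrow> F x \<in> S" "\<And>v. B v \<in> S"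
  shows "reachable \<subseteq> S"
  unfolding reachable_def using assms by (intro Inter_lower) auto

end

text \<open>\<open>P0\<close> is a Lyapunov matrix for the loop closed with gain \<kappa>. The
  assumption \<open>freq\<close> is the frequency inequality without a regularity restriction on
  \<omega>, \<open>freq_inf\<close> its limit at infinite frequency, and
  \<open>nondegenerate\<close> the consequence of the nonvanishing of \<open>det \<Phi>\<close> that
  the energy argument uses.\<close>

locale popov_system = popov_form F B C \<sigma> \<theta> \<delta> \<rho>
  for F :: "real^'m \<Rightarrow> real^'m" and B :: "real^'n \<Rightarrow> real^'m" and C :: "real^'m \<Rightarrow> real^'n"
    and \<sigma> \<theta> \<delta> \<rho> :: real +
  fixes \<kappa> :: real and P0 :: "real^'m^'m"
  assumes \<sigma>: "\<sigma> \<ge> 0" and \<rho>: "\<rho> \<ge> 0" and \<rho>\<theta>: "\<rho> > 0 \<or> \<theta> > 0" and \<kappa>: "\<kappa> \<ge> 0"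
    and P0_sym: "transpose P0 = P0" and P0_pos: "\<And>x. x \<noteq> 0 \<Longrightarrow> 0 < x \<bullet> (P0 *v x)"
    and P0_lyap: "\<And>x. x \<noteq> 0 \<Longrightarrow> x \<bullet> (P0 *v (F x + \<kappa> *\<^sub>R B (C x))) < 0"
    and gain: "\<And>k. 0 < k \<Longrightarrow> k \<le> \<kappa> \<Longrightarrow> 0 < k * \<theta> - \<delta> * k\<^sup>2 + \<rho>"
    and freq: "\<And>\<omega> x y v u. F x + B v = - \<omega> *\<^sub>R y \<Longrightarrow> F y + B u = \<omega> *\<^sub>R x \<Longrightarrow> G x v + G y u \<le> 0"
    and freq_inf: "\<And>v. G 0 v \<le> 0"
    and nondegenerate: "\<And>N v. subspace N \<Longrightarrow> F ` N \<subseteq> N \<Longrightarrow> B v \<in> N \<Longrightarrow> (\<And>x. x \<in> N \<Longrightarrow> \<Gamma> x = 0) \<Longrightarrow>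
        (\<And>x. x \<in> N \<Longrightarrow> \<rho> *\<^sub>R C x = 0) \<Longrightarrow> (\<And>x. x \<in> reachable \<Longrightarrow> v \<bullet> \<Gamma> x = 0) \<Longrightarrow>
        (\<And>u. \<sigma> * (v \<bullet> C (B u) + u \<bullet> C (B v)) = 2 * \<delta> * (v \<bullet> u)) \<Longrightarrow> v = 0"
begin

text \<open>The Kalman-Yakubovich-Popov inequality is applied with the state restricted to
  \<open>reachable\<close>, since only there does the hypothesis \<open>reach\<close> hold. The
  projection \<pi> makes the state map defined on the whole space.\<close>

lemma storage_exists:
  assumes \<pi>: "linear \<pi>" and \<pi>R: "\<And>x. \<pi> x \<in> reachable" and \<pi>id: "\<And>x. x \<in> reachable \<Longrightarrow> \<pi> x = x"
  obtains P where "transpose P = P" "\<And>x. P *v \<pi> x = P *v x"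
    "\<And>x v. G (\<pi> x) v + 2 * (x \<bullet> (P *v (F (\<pi> x) + B v))) \<le> 0"
proof -
  have rX: "range (\<lambda>p :: (real^'m) \<times> (real^'n). \<pi> (fst p)) = reachable" (is "range ?X = _")
    using \<pi>R \<pi>id by (auto simp: image_iff) (metis fst_conv)
  let ?Y = "\<lambda>p :: (real^'m) \<times> (real^'n). F (\<pi> (fst p)) + B (snd p)"
  let ?b = "\<lambda>p q :: (real^'m) \<times> (real^'n). - g (\<pi> (fst p)) (snd p) (\<pi> (fst q)) (snd q)"
  have X: "linear ?X" by (auto intro!: linearI simp: linear_rules[OF \<pi>])
  have Y: "linear ?Y"
    by (auto intro!: linearI simp: linear_rules[OF \<pi>] lin_simps algebra_simps)
  have b: "bilinear ?b"
    unfolding bilinear_def g_def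
    by (auto intro!: linearI simp: linear_rules[OF \<pi>] lin_simps inner_add_left inner_add_right field_simps)
  have "\<exists>P. transpose P = P \<and> (\<forall>\<xi>. 2 * (?X \<xi> \<bullet> (P *v ?Y \<xi>)) \<le> ?b \<xi> \<xi>)"
  proof (rule kyp_inequality[OF X Y b])
    show "?b \<xi> \<xi> + ?b \<eta> \<eta> \<ge> 0" if "?Y \<xi> = - \<omega> *\<^sub>R ?X \<eta>" "?Y \<eta> = \<omega> *\<^sub>R ?X \<xi>" for \<omega> \<xi> \<eta>
      using freq[OF that] by (simp add: g_diag)
    show "?b \<xi> \<xi> \<ge> 0" if "?X \<xi> = 0" for \<xi>
      using freq_inf[of "snd \<xi>"] that by (simp add: g_diag)
    show "?Y \<xi> \<in> range ?X" for \<xi>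
      unfolding rX using subspace_reachable \<pi>R by (intro subspace_add F_reachable B_reachable)
  next
    fix P :: "real^'m^'m" and x y
    assume P: "transpose P = P" and pos: "\<And>\<xi>. 0 \<le> ?X \<xi> \<bullet> (P *v ?Y \<xi>)" and xy: "x \<in> range ?X" "y \<in> range ?X"
    have Psym: "u \<bullet> (P *v w) = w \<bullet> (P *v u)" for u w using inner_transpose_mult[of u P w] P by simp
    have pos': "0 \<le> u \<bullet> (P *v F u) + u \<bullet> (P *v B v)" if "u \<in> reachable" for u v
      using pos[of "(u, v)"] \<pi>id[OF that] by (simp add: matrix_vector_right_distrib inner_add_right)
    \<comment> \<open>The input enters linearly and is arbitrary, so its coefficient has to
      vanish.\<close>
    have PB: "u \<bullet> (P *v B v) = 0" if u: "u \<in> reachable" for u v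
    proof (rule ccontr)
      assume ne: "u \<bullet> (P *v B v) \<noteq> 0"
      define t where "t = - (u \<bullet> (P *v F u) + 1) / (u \<bullet> (P *v B v))"
      have "0 \<le> u \<bullet> (P *v F u) + u \<bullet> (P *v B (t *\<^sub>R v))" by (rule pos'[OF u])
      also have "\<dots> = - 1" using ne by (simp add: lin_simps matrix_vector_mult_scaleR t_def)
      finally show False by simp
    qed
    have PF: "0 \<le> u \<bullet> (P *v F u)" if "u \<in> reachable" for u
      using pos'[OF that, of 0] by (simp add: lin_simps)
    \<comment> \<open>The radical of \<open>P\<close> on \<open>reachable\<close>. It contains the
      range of \<open>B\<close>, and it is \<open>F\<close>-invariant because its elements lie in
      the kernel of the semidefinite form \<open>u \<bullet> (P *v F u)\<close>; by minimality it is
      all of \<open>reachable\<close>.\<close>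
    define M where "M = {y \<in> reachable. \<forall>x\<in>reachable. x \<bullet> (P *v y) = 0}"
    have "subspace M"
      unfolding M_def using subspace_reachable
      by (auto simp: subspace_def matrix_vector_right_distrib inner_add_right matrix_vector_mult_scaleR)
    moreover have "F u \<in> M" if u: "u \<in> M" for u
    proof -
      have uR: "u \<in> reachable" using u by (simp add: M_def)
      have kill: "w \<bullet> (P *v u) = 0" if "w \<in> reachable" for w using u that by (simp add: M_def)
      have bil: "bilinear (\<lambda>x y. x \<bullet> (P *v F y) + y \<bullet> (P *v F x))"
        unfolding bilinear_def
        by (auto intro!: linearI simp: lin_simps form_rules algebra_simps)
      have uPF: "u \<bullet> (P *v F w) = 0" if "w \<in> reachable" for w
        using kill[OF F_reachable[OF that]] Psym by simp
      have "u \<bullet> (P *v F x) + x \<bullet> (P *v F u) = 0" if "x \<in> reachable" for x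
        by (rule psd_form_kernel[OF bil _ subspace_reachable _ uR _ that]) (use PF uPF[OF uR] in auto)
      then show ?thesis using uPF uR F_reachable by (simp add: M_def)
    qed
    moreover have "B v \<in> M" for v using PB B_reachable by (simp add: M_def)
    ultimately have "reachable \<subseteq> M" by (rule reachable_minimal)
    then show "x \<bullet> (P *v y) = 0" using xy unfolding rX M_def by blast
  qed
  then obtain P where P: "transpose P = P" "\<And>\<xi>. 2 * (?X \<xi> \<bullet> (P *v ?Y \<xi>)) \<le> ?b \<xi> \<xi>" by blast
  \<comment> \<open>Replacing \<open>P\<close> by \<open>\<pi>^T P \<pi>\<close> keeps its values on
    \<open>reachable\<close> and makes it vanish on the kernel of \<pi>.\<close>
  define P' where "P' = transpose (matrix \<pi>) ** P ** matrix \<pi>"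
  have mp: "matrix \<pi> *v x = \<pi> x" for x using \<pi> by (simp add: matrix_works)
  have P': "x \<bullet> (P' *v y) = \<pi> x \<bullet> (P *v \<pi> y)" for x y
    unfolding P'_def by (simp add: matrix_vector_mul_assoc[symmetric] mp inner_transpose_mult inner_commute
        del: transpose_matrix_vector)
  have "transpose P' = P'" unfolding P'_def by (simp add: matrix_transpose_mul P(1) matrix_mul_assoc)
  moreover have "P' *v \<pi> x = P' *v x" for x
    using P'[of _ "\<pi> x"] P'[of _ x] \<pi>id[OF \<pi>R] by (metis vector_eq_ldot)
  moreover have "G (\<pi> x) v + 2 * (x \<bullet> (P' *v (F (\<pi> x) + B v))) \<le> 0" for x v
  proof -
    have "F (\<pi> x) + B v \<in> reachable"
      using subspace_reachable \<pi>R by (intro subspace_add F_reachable B_reachable)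
    then show ?thesis using P(2)[of "(x, v)"] by (simp add: P' \<pi>id g_diag)
  qed
  ultimately show ?thesis by (rule that)
qed

text \<open>Under \<open>v = k C x\<close> the \<sigma> term of the supply is the derivative of
  \<open>k * \<sigma> / 2 * |C x|^2\<close>; added to the storage, it gives a form
  \<open>q k\<close> that does not increase in the loop with gain \<open>k\<close>. Stability at
  \<kappa> makes \<open>q \<kappa>\<close> nonnegative, and the gain is then lowered continuously to
  \<open>0\<close>, where \<open>q\<close> is the storage itself.\<close>

lemma storage_nonneg:
  assumes \<pi>: "linear \<pi>" and \<pi>R: "\<And>x. \<pi> x \<in> reachable" and \<pi>id: "\<And>x. x \<in> reachable \<Longrightarrow> \<pi> x = x"
    and Psym: "transpose P = P" and P\<pi>: "\<And>x. P *v \<pi> x = P *v x"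
    and diss: "\<And>x v. G (\<pi> x) v + 2 * (x \<bullet> (P *v (F (\<pi> x) + B v))) \<le> 0"
  shows "x \<bullet> (P *v x) \<ge> 0"
proof -
  have sP: "u \<bullet> (P *v w) = w \<bullet> (P *v u)" for u w using inner_transpose_mult[of u P w] Psym by simp
  define q where "q k x y = x \<bullet> (P *v y) + k * \<sigma> / 2 * (C (\<pi> x) \<bullet> C (\<pi> y))" for k x y
  have bil: "bilinear (q k)" for k
    unfolding q_def bilinear_def
    by (auto intro!: linearI simp: linear_rules[OF \<pi>] lin_simps form_rules algebra_simps)
  have qsym: "q k x y = q k y x" for k x y by (simp add: q_def sP[of x y] inner_commute)
  have q\<pi>: "q k (\<pi> x) (\<pi> x) = q k x x" for k x
    using sP[of "\<pi> x" x] by (simp add: q_def P\<pi> \<pi>id[OF \<pi>R])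
  define H where "H k x = F x + k *\<^sub>R B (C x)" for k x
  have HR: "H k x \<in> reachable" if "x \<in> reachable" for k x
    unfolding H_def using that subspace_reachable
    by (intro subspace_add subspace_scale F_reachable B_reachable)
  have dec: "2 * q k x (H k x) \<le> - ((k * \<theta> - \<delta> * k\<^sup>2 + \<rho>) * (C x \<bullet> C x))" if x: "x \<in> reachable" for k x
  proof -
    have "G x (k *\<^sub>R C x) + 2 * (x \<bullet> (P *v H k x)) \<le> 0"
      using diss[of x "k *\<^sub>R C x"] \<pi>id[OF x] by (simp add: H_def lin_simps)
    then show ?thesis
      using \<pi>id[OF x] \<pi>id[OF HR[OF x]]
      by (simp add: q_def G_def \<Gamma>_def) (simp add: H_def lin_simps inner_add_right power2_eq_square algebra_simps)
  qed
  have q\<kappa>: "q \<kappa> x x \<ge> 0" for x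
  proof -
    have "q \<kappa> (\<pi> x) (\<pi> x) \<ge> 0"
    proof (rule lyapunov_form_nonneg[OF bil qsym subspace_reachable HR _ P0_sym P0_pos _ \<pi>R])
      show "q \<kappa> y (H \<kappa> y) \<le> 0" if "y \<in> reachable" for y
      proof -
        have "\<kappa> * \<theta> - \<delta> * \<kappa>\<^sup>2 + \<rho> \<ge> 0" using gain[of \<kappa>] \<kappa> \<rho> by (cases "\<kappa> = 0") auto
        then have "(\<kappa> * \<theta> - \<delta> * \<kappa>\<^sup>2 + \<rho>) * (C y \<bullet> C y) \<ge> 0" by (intro mult_nonneg_nonneg) auto
        then show ?thesis using dec[OF that, of \<kappa>] by simp
      qed
      show "y \<bullet> (P0 *v H \<kappa> y) < 0" if "y \<noteq> 0" for y using P0_lyap[OF that] by (simp add: H_def)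
    qed
    then show ?thesis by (simp add: q\<pi>)
  qed
  define K where "K = {k \<in> {0..\<kappa>}. \<forall>x. q k x x \<ge> 0}"
  have KI: "K = {0..\<kappa>} \<inter> (\<Inter>x. {k. 0 \<le> q k x x})" by (auto simp: K_def)
  have "closed K"
    unfolding KI q_def by (intro closed_Int closed_INT ballI closed_Collect_le continuous_intros) auto
  moreover have "\<kappa> \<in> K" using q\<kappa> \<kappa> by (simp add: K_def)
  moreover have bb: "bdd_below K" unfolding K_def by (auto intro!: bdd_belowI[of _ 0])
  ultimately have "Inf K \<in> K" by (intro closed_contains_Inf) auto
  define k where "k = Inf K"
  have k: "0 \<le> k" "k \<le> \<kappa>" "\<And>x. q k x x \<ge> 0" using \<open>Inf K \<in> K\<close> by (auto simp: K_def k_def)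
  \<comment> \<open>If the least admissible gain \<open>k\<close> were positive, the kernel of \<open>q k\<close> would lie in the kernel of \<open>C\<close>, and \<open>k\<close>
    could be lowered further.\<close>
  have "k = 0"
  proof (rule ccontr)
    assume "k \<noteq> 0"
    then have kpos: "k > 0" using k by simp
    have lC: "linear (\<lambda>x. C (\<pi> x))" using linear_compose[OF \<pi> C] by (simp add: o_def)
    have ker: "C (\<pi> x) = 0" if "q k x x = 0" for x
    proof -
      have "q k (\<pi> x) (H k (\<pi> x)) = 0"
        by (rule psd_form_kernel[OF bil qsym subspace_UNIV]) (use k that in \<open>auto simp: q\<pi>\<close>)
      then have "(k * \<theta> - \<delta> * k\<^sup>2 + \<rho>) * (C (\<pi> x) \<bullet> C (\<pi> x)) \<le> 0"
        using dec[OF \<pi>R, of k x] by simp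
      then have "C (\<pi> x) \<bullet> C (\<pi> x) \<le> 0" using gain[OF kpos k(2)] by (simp add: mult_le_0_iff)
      then show ?thesis by (metis antisym inner_eq_zero_iff inner_ge_zero)
    qed
    obtain c where c: "c > 0" "\<And>x. (norm (C (\<pi> x)))\<^sup>2 \<le> c * q k x x"
      using psd_form_dominates[OF bil qsym k(3) lC ker] by blast
    \<comment> \<open>Small enough that the removed term is at most \<open>q k x x\<close> and the
      gain stays nonnegative; \<open>\<sigma> + 1\<close> avoids division by zero when \<sigma>
      vanishes.\<close>
    define e where "e = min k (1 / (c * (\<sigma> + 1)))"
    have e: "0 < e" "e \<le> k" "e * \<sigma> * c \<le> 2"
    proof -
      show "0 < e" "e \<le> k" using kpos c \<sigma> by (auto simp: e_def)
      have "e * (\<sigma> * c) \<le> (1 / (c * (\<sigma> + 1))) * (\<sigma> * c)" using \<sigma> c by (intro mult_right_mono) (auto simp: e_def)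
      also have "\<dots> = \<sigma> / (\<sigma> + 1)" using c by simp
      also have "\<dots> \<le> 2" using \<sigma> by (simp add: divide_le_eq)
      finally show "e * \<sigma> * c \<le> 2" by (simp add: mult_ac)
    qed
    have "q (k - e) x x \<ge> 0" for x
    proof -
      have "e * \<sigma> / 2 * (norm (C (\<pi> x)))\<^sup>2 \<le> e * \<sigma> / 2 * (c * q k x x)"
        using c(2)[of x] e \<sigma> by (intro mult_left_mono) auto
      also have "\<dots> = (e * \<sigma> * c / 2) * q k x x" by simp
      also have "\<dots> \<le> 1 * q k x x" using e k(3) by (intro mult_right_mono) auto
      finally have "e * \<sigma> / 2 * (norm (C (\<pi> x)))\<^sup>2 \<le> q k x x" by simp
      moreover have "q (k - e) x x = q k x x - e * \<sigma> / 2 * (norm (C (\<pi> x)))\<^sup>2"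
        by (simp add: q_def power2_norm_eq_inner field_simps)
      ultimately show ?thesis by simp
    qed
    then have "k - e \<in> K" using e k by (auto simp: K_def)
    then have "k \<le> k - e" unfolding k_def by (rule cInf_lower[OF _ bb])
    then show False using e by simp
  qed
  then show ?thesis using k(3)[of x] by (simp add: q_def)
qed

end

section \<open>A scalar comparison principle\<close>

lemma nonincreasing_from_0:
  fixes f :: "real \<Rightarrow> real"
  assumes der: "\<And>t. t \<in> {0..T} \<Longrightarrow> (f has_real_derivative f' t) (at t within {0..T})"
    and le: "\<And>t. t \<in> {0..T} \<Longrightarrow> f' t \<le> 0" and t: "t \<in> {0..T}"
  shows "f t \<le> f 0"
proof -
  have "\<exists>x\<in>{0..t}. f t - f 0 = f' x * (t - 0)"
  proof (rule mvt_very_simple)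
    show "0 \<le> t" using t by simp
    fix x assume "0 \<le> x" "x \<le> t"
    then have "(f has_real_derivative f' x) (at x within {0..t})"
      using der[of x] t by (auto intro: DERIV_subset)
    then show "(f has_derivative (\<lambda>h. f' x * h)) (at x within {0..t})"
      by (simp add: has_field_derivative_def)
  qed
  then obtain x where x: "x \<in> {0..t}" "f t - f 0 = f' x * t" by auto
  have "f' x * t \<le> 0" using le[of x] x t by (intro mult_nonpos_nonneg) auto
  then show ?thesis using x by simp
qed

text \<open>\<open>W\<close> stands for a corrected storage that dominates \<open>V / 2\<close>, and
  \<open>Z\<close> for the energy of the state component that \<open>V\<close> and \<open>E\<close>
  do not control. The cross term is a geometric mean of \<open>V\<close> and \<open>E\<close>:
  linear in energies, but with a factor that decays with \<open>E\<close>.\<close>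

definition coupled_decay ::
  "real \<Rightarrow> real \<Rightarrow> real \<Rightarrow> real \<Rightarrow> (real \<Rightarrow> real) \<Rightarrow> (real \<Rightarrow> real) \<Rightarrow> (real \<Rightarrow> real) \<Rightarrow> (real \<Rightarrow> real) \<Rightarrow>
    (real \<Rightarrow> real) \<Rightarrow> (real \<Rightarrow> real) \<Rightarrow> (real \<Rightarrow> real) \<Rightarrow> (real \<Rightarrow> real) \<Rightarrow> bool" where
  "coupled_decay a c d T V D E W Z E' W' Z' \<longleftrightarrow>
      (\<forall>t\<in>{0..T}. (E has_real_derivative E' t) (at t within {0..T}) \<and>
        (W has_real_derivative W' t) (at t within {0..T}) \<and>
        (Z has_real_derivative Z' t) (at t within {0..T}) \<and>
        0 \<le> V t \<and> 0 \<le> D t \<and> 0 \<le> E t \<and> 0 \<le> Z t \<and> V t \<le> 2 * W t \<and>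
        E' t \<le> - 2 * a * E t \<and>
        W' t \<le> - D t / 2 + c * sqrt (V t) * sqrt (E t) \<and>
        Z' t \<le> - d * Z t + c * (V t + D t + E t))"

text \<open>\<open>E\<close> is the energy of the decaying unreachable part, \<open>V\<close> the stored and \<open>D\<close> the dissipated energy; the
  term \<open>D\<close> in the estimate of \<open>Z'\<close> is only integrable, so \<open>Z + 2 c W\<close> is what satisfies a linear differential
  inequality.\<close>

lemma coupled_decay_bound:
  fixes a c d :: real
  assumes a: "a > 0" and c: "c > 0" and d: "d > 0"
  shows "\<exists>M>0. \<forall>T V D E W Z E' W' Z'. 0 \<le> T \<longrightarrow> coupled_decay a c d T V D E W Z E' W' Z' \<longrightarrow>
      Z T + V T + E T \<le> M * (W 0 + Z 0 + E 0)"
proof -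
  \<comment> \<open>The largest growth factor of \<open>W t + e\<close>: the rate
    \<open>c * exp (- a * t)\<close> has integral \<open>c / a\<close> over the half-line.\<close>
  define m where "m = exp (c / a)"
  define M2 where "M2 = (2 * c * d + 3 * c + 2 * c * c) * m"
  define M where "M = M2 / d + 1 + 2 * c * m + 3 * m"
  have m: "m > 0" by (simp add: m_def)
  have M2: "M2 > 0" using a c d m by (auto simp: M2_def intro!: mult_pos_pos add_pos_pos)
  have M: "M > 0" using M2 a c d m by (auto simp: M_def intro!: add_pos_pos)
  show ?thesis
  proof (intro exI[of _ M] conjI M allI impI)
    fix T :: real and V D E W Z E' W' Z' :: "real \<Rightarrow> real"
    assume T: "0 \<le> T" and all: "coupled_decay a c d T V D E W Z E' W' Z'"
    have dE: "(E has_real_derivative E' t) (at t within {0..T})"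
      and dW: "(W has_real_derivative W' t) (at t within {0..T})"
      and dZ: "(Z has_real_derivative Z' t) (at t within {0..T})"
      and nn: "0 \<le> V t \<and> 0 \<le> D t \<and> 0 \<le> E t \<and> 0 \<le> Z t \<and> V t \<le> 2 * W t"
      and E': "E' t \<le> - 2 * a * E t"
      and W': "W' t \<le> - D t / 2 + c * sqrt (V t) * sqrt (E t)"
      and Z': "Z' t \<le> - d * Z t + c * (V t + D t + E t)" if "t \<in> {0..T}" for t
      using all that unfolding coupled_decay_def by blast+
    define e where "e = E 0"
    have e: "e \<ge> 0" using nn[of 0] T by (simp add: e_def)
    have Edec: "E t \<le> e * exp (- 2 * a * t)" if t: "t \<in> {0..T}" for t
    proof -
      have "E t * exp (2 * a * t) \<le> E 0 * exp (2 * a * 0)"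
      proof (rule nonincreasing_from_0[OF _ _ t, where f' = "\<lambda>t. (E' t + 2 * a * E t) * exp (2 * a * t)"])
        show "((\<lambda>t. E t * exp (2 * a * t)) has_real_derivative (E' t + 2 * a * E t) * exp (2 * a * t)) (at t within {0..T})"
          if "t \<in> {0..T}" for t
          by (rule derivative_eq_intros dE that refl | simp add: algebra_simps)+
        show "(E' t + 2 * a * E t) * exp (2 * a * t) \<le> 0" if "t \<in> {0..T}" for t
          using E'[OF that] by (intro mult_nonpos_nonneg) auto
      qed
      then have "E t * exp (2 * a * t) * exp (- 2 * a * t) \<le> e * exp (- 2 * a * t)"
        by (intro mult_right_mono) (auto simp: e_def)
      then show ?thesis by (simp add: mult.assoc flip: exp_add)
    qed
    have Ele: "E t \<le> e" if t: "t \<in> {0..T}" for t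
    proof -
      have "e * exp (- 2 * a * t) \<le> e * 1" using e a t by (intro mult_left_mono) auto
      then show ?thesis using Edec[OF t] by simp
    qed
    \<comment> \<open>The arithmetic-geometric mean inequality makes the cross term linear in
      \<open>W + e\<close>, with the integrable rate \<open>c * exp (- a * t)\<close>.\<close>
    have W'2: "W' t \<le> - D t / 2 + c * exp (- a * t) * (W t + e)" if t: "t \<in> {0..T}" for t
    proof -
      have "sqrt (E t) \<le> sqrt (e * exp (- 2 * a * t))" using Edec[OF t] by simp
      also have "exp (- 2 * a * t) = (exp (- a * t))\<^sup>2" by (simp add: exp_double[symmetric])
      also have "sqrt (e * (exp (- a * t))\<^sup>2) = sqrt e * exp (- a * t)" by (simp add: real_sqrt_mult)
      finally have "sqrt (V t) * sqrt (E t) \<le> sqrt (V t) * (sqrt e * exp (- a * t))"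
        using nn[OF t] by (intro mult_left_mono) auto
      also have "\<dots> = (sqrt (V t) * sqrt e) * exp (- a * t)" by simp
      also have "\<dots> \<le> (W t + e) * exp (- a * t)"
      proof (rule mult_right_mono)
        have "sqrt (V t) * sqrt e \<le> (V t + e) / 2"
          using arith_geo_mean_sqrt[of "V t" e] nn[OF t] e by (simp add: real_sqrt_mult)
        then show "sqrt (V t) * sqrt e \<le> W t + e" using nn[OF t] e by simp
      qed simp
      finally have "c * (sqrt (V t) * sqrt (E t)) \<le> c * ((W t + e) * exp (- a * t))"
        using c by (intro mult_left_mono) auto
      then show ?thesis using W'[OF t] by (simp add: mult_ac)
    qed
    define w where "w = (W 0 + e) * m"
    have Wle: "W t + e \<le> w" if t: "t \<in> {0..T}" for t
    proof -
      have "(W t + e) * exp (c / a * exp (- a * t)) \<le> (W 0 + e) * exp (c / a * exp (- a * 0))"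
      proof (rule nonincreasing_from_0[OF _ _ t, where
            f' = "\<lambda>t. (W' t - c * exp (- a * t) * (W t + e)) * exp (c / a * exp (- a * t))"])
        show "((\<lambda>t. (W t + e) * exp (c / a * exp (- a * t))) has_real_derivative
            (W' t - c * exp (- a * t) * (W t + e)) * exp (c / a * exp (- a * t))) (at t within {0..T})"
          if "t \<in> {0..T}" for t
          by (rule derivative_eq_intros dW that refl | use a in \<open>simp add: algebra_simps\<close>)+
        show "(W' t - c * exp (- a * t) * (W t + e)) * exp (c / a * exp (- a * t)) \<le> 0"
          if "t \<in> {0..T}" for t
          using W'2[OF that] nn[OF that] by (intro mult_nonpos_nonneg) auto
      qed
      moreover have "(W t + e) * 1 \<le> (W t + e) * exp (c / a * exp (- a * t))"
        using nn[OF t] e a c by (intro mult_left_mono) auto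
      ultimately show ?thesis by (simp add: w_def m_def)
    qed
    have w0: "W 0 \<ge> 0" using nn[of 0] T by simp
    have w: "w \<ge> 0" using w0 e m by (simp add: w_def)
    \<comment> \<open>The equilibrium of the linear inequality for
      \<open>\<Theta> = Z + 2 c W\<close>. In its derivative the \<open>D\<close> terms cancel;
      using \<open>V \<le> 2 w\<close>, \<open>E \<le> w\<close> and \<open>W \<le> w\<close>, the
      source is at most the displayed multiple of \<open>w\<close>.\<close>
    define z where "z = (2 * c * d + 3 * c + 2 * c * c) * w / d"
    define \<Theta> where "\<Theta> t = Z t + 2 * c * W t" for t
    have dz: "d * z = (2 * c * d + 3 * c + 2 * c * c) * w" using d by (simp add: z_def)
    have \<Theta>': "Z' t + 2 * c * W' t \<le> - d * \<Theta> t + d * z" if t: "t \<in> {0..T}" for t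
    proof -
      have "c * exp (- a * t) * (W t + e) \<le> c * 1 * w"
        using Wle[OF t] nn[OF t] e a c t w by (intro mult_mono) auto
      then have "W' t \<le> - D t / 2 + c * w" using W'2[OF t] by simp
      then have "2 * c * W' t \<le> 2 * c * (- D t / 2 + c * w)" using c by (intro mult_left_mono) auto
      moreover have "c * V t \<le> c * (2 * w)" "c * E t \<le> c * w" "2 * c * d * W t \<le> 2 * c * d * w"
        using Wle[OF t] nn[OF t] e a c d w Ele[OF t] by (auto intro!: mult_left_mono)
      ultimately show ?thesis using Z'[OF t] unfolding dz \<Theta>_def by (simp add: algebra_simps)
    qed
    have "(\<Theta> T - z) * exp (d * T) \<le> (\<Theta> 0 - z) * exp (d * 0)"
    proof (rule nonincreasing_from_0[where f' = "\<lambda>t. (Z' t + 2 * c * W' t + d * (\<Theta> t - z)) * exp (d * t)"])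
      show "((\<lambda>t. (\<Theta> t - z) * exp (d * t)) has_real_derivative
          (Z' t + 2 * c * W' t + d * (\<Theta> t - z)) * exp (d * t)) (at t within {0..T})"
        if "t \<in> {0..T}" for t
        unfolding \<Theta>_def by (rule derivative_eq_intros dW dZ that refl | simp add: algebra_simps)+
      show "(Z' t + 2 * c * W' t + d * (\<Theta> t - z)) * exp (d * t) \<le> 0" if "t \<in> {0..T}" for t
        using \<Theta>'[OF that] by (intro mult_nonpos_nonneg) (auto simp: algebra_simps)
      show "T \<in> {0..T}" using T by simp
    qed
    also have "\<dots> \<le> \<Theta> 0 * exp (d * T)"
    proof -
      have z0: "z \<ge> 0" using c d w by (simp add: z_def)
      have t0: "\<Theta> 0 \<ge> 0" using nn[of 0] T c w0 by (simp add: \<Theta>_def)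
      have "\<Theta> 0 * 1 \<le> \<Theta> 0 * exp (d * T)" using t0 d T by (intro mult_left_mono) auto
      then show ?thesis using z0 by simp
    qed
    finally have "\<Theta> T \<le> \<Theta> 0 + z" by simp
    then have "Z T \<le> Z 0 + 2 * c * W 0 + z"
      using nn[of T] T c by (simp add: \<Theta>_def) (smt (verit) mult_nonneg_nonneg)
    moreover have "2 * c * W 0 \<le> 2 * c * w"
      using Wle[of 0] e T c by (intro mult_left_mono) auto
    moreover have "V T + E T \<le> 3 * w" using Wle[of T] nn[of T] Ele[of T] T e by auto
    moreover have "z = M2 / d * (W 0 + e)" by (simp add: z_def M2_def w_def)
    moreover have "Z 0 \<ge> 0" using nn[of 0] T by simp
    ultimately have "Z T + V T + E T \<le> Z 0 + (2 * c * m + 3 * m + M2 / d) * (W 0 + e)"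
      by (simp add: w_def algebra_simps)
    also have "\<dots> \<le> M * Z 0 + M * (W 0 + e)"
    proof (rule add_mono)
      have "1 * Z 0 \<le> M * Z 0" using \<open>Z 0 \<ge> 0\<close> M2 d c m by (intro mult_right_mono) (auto simp: M_def)
      then show "Z 0 \<le> M * Z 0" by simp
      show "(2 * c * m + 3 * m + M2 / d) * (W 0 + e) \<le> M * (W 0 + e)"
        using w0 e by (intro mult_right_mono) (auto simp: M_def)
    qed
    finally show "Z T + V T + E T \<le> M * (W 0 + Z 0 + E 0)" by (simp add: e_def algebra_simps)
  qed
qed

section \<open>Energy estimates\<close>

lemma weighted_young:
  fixes a x y :: real
  assumes "a > 0"
  shows "x * y \<le> a * x\<^sup>2 / 4 + y\<^sup>2 / a"
proof -
  have "0 \<le> (a * x / 2 - y)\<^sup>2 / a" using assms by simp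
  also have "\<dots> = a * x\<^sup>2 / 4 + y\<^sup>2 / a - x * y" using assms by (simp add: power2_eq_square field_simps)
  finally show ?thesis by simp
qed

lemma positive_form_coercive:
  fixes b :: "'a::euclidean_space \<Rightarrow> 'a \<Rightarrow> real"
  assumes b: "bilinear b" and sym: "\<And>x y. b x y = b y x" and pos: "\<And>x. x \<noteq> 0 \<Longrightarrow> b x x > 0"
  obtains c where "c > 0" "\<And>x. c * (norm x)\<^sup>2 \<le> b x x"
proof -
  have nn: "b x x \<ge> 0" for x using pos[of x] bilinear_lzero[OF b, of 0] by (cases "x = 0") auto
  obtain k where k: "k > 0" "\<And>x. (norm (id x))\<^sup>2 \<le> k * b x x"
    using psd_form_dominates[OF b sym nn linear_id] pos by (metis id_apply less_irrefl)
  show ?thesis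
  proof (rule that[of "1 / k"])
    show "1 / k * (norm x)\<^sup>2 \<le> b x x" for x using k(2)[of x] k(1) by (simp add: field_simps)
  qed (use k in simp)
qed

lemma bilinear_abs_bound:
  fixes b :: "'a::euclidean_space \<Rightarrow> 'b::euclidean_space \<Rightarrow> real"
  assumes b: "bilinear b"
  obtains c where "c > 0" "\<And>x y. b x y \<le> c * norm x * norm y"
proof -
  obtain K where "K > 0" "\<And>x y. norm (b x y) \<le> norm x * norm y * K"
    using bounded_bilinear.pos_bounded[of b] b by (auto simp: bilinear_conv_bounded_bilinear)
  then show ?thesis by (intro that[of K]) (auto simp: mult_ac abs_le_iff)
qed

lemma bilinear_matrix_form: "bilinear (\<lambda>x y. x \<bullet> (M *v y))"
  for M :: "real^'m^'n"
  unfolding bilinear_def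
  by (auto intro!: linearI simp: form_rules)

lemma bilinear_form_derivative:
  fixes b :: "'a::euclidean_space \<Rightarrow> 'a \<Rightarrow> real" and l :: "'a \<Rightarrow> 'a"
  assumes b: "bilinear b" and l: "linear l" and y: "(y has_vector_derivative e) (at t within S)"
  shows "((\<lambda>t. b (l (y t)) (l (y t))) has_real_derivative b (l (y t)) (l e) + b (l e) (l (y t))) (at t within S)"
proof -
  have "bounded_linear l" using l by (rule linear_conv_bounded_linear[THEN iffD1])
  then have "((\<lambda>t. l (y t)) has_vector_derivative l e) (at t within S)"
    using y by (rule bounded_linear.has_vector_derivative)
  with b show ?thesis
    unfolding bilinear_conv_bounded_bilinear has_real_derivative_iff_has_vector_derivative
    by (intro bounded_bilinear.has_vector_derivative)
qed

locale popov_storage = popov_system F B C \<sigma> \<theta> \<delta> \<rho> \<kappa> P0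
  for F :: "real^'m \<Rightarrow> real^'m" and B :: "real^'n \<Rightarrow> real^'m" and C :: "real^'m \<Rightarrow> real^'n"
    and \<sigma> \<theta> \<delta> \<rho> \<kappa> :: real and P0 :: "real^'m^'m" +
  fixes \<pi> :: "real^'m \<Rightarrow> real^'m" and P :: "real^'m^'m"
  assumes \<pi>: "linear \<pi>" and \<pi>R: "\<And>x. \<pi> x \<in> reachable" and \<pi>id: "\<And>x. x \<in> reachable \<Longrightarrow> \<pi> x = x"
    and \<pi>_orth: "\<And>x y. y \<in> reachable \<Longrightarrow> y \<bullet> (P0 *v (x - \<pi> x)) = 0"
    and P_sym: "transpose P = P" and P\<pi>: "\<And>x. P *v \<pi> x = P *v x"
    and dissipation: "\<And>x v. G (\<pi> x) v + 2 * (x \<bullet> (P *v (F (\<pi> x) + B v))) \<le> 0"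
    and P_nonneg: "\<And>x. x \<bullet> (P *v x) \<ge> 0"
begin

section \<open>Null directions of the stored and dissipated energy\<close>

lemma P_comm: "x \<bullet> (P *v y) = y \<bullet> (P *v x)" and P0_comm: "x \<bullet> (P0 *v y) = y \<bullet> (P0 *v x)"
  using inner_transpose_mult[of x P y] inner_transpose_mult[of x P0 y] P_sym P0_sym by simp_all

text \<open>The polar form of the slack in \<open>dissipation\<close>. It depends on the states only
  through their projections, because \<open>P\<close> absorbs \<pi>.\<close>

definition D :: "(real^'m) \<times> (real^'n) \<Rightarrow> (real^'m) \<times> (real^'n) \<Rightarrow> real" where
  "D p q = - g (\<pi> (fst p)) (snd p) (\<pi> (fst q)) (snd q)
     - fst p \<bullet> (P *v (F (\<pi> (fst q)) + B (snd q))) - fst q \<bullet> (P *v (F (\<pi> (fst p)) + B (snd p)))"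

text \<open>Stored energy, dissipation and squared distance along \<pi> together. A linear quantity
  is under control exactly when it vanishes on the kernel of this form.\<close>

definition Q :: "(real^'m) \<times> (real^'n) \<Rightarrow> (real^'m) \<times> (real^'n) \<Rightarrow> real" where
  "Q p q = fst p \<bullet> (P *v fst q) + D p q + (fst p - \<pi> (fst p)) \<bullet> (fst q - \<pi> (fst q))"

lemmas all_lin_simps = lin_simps linear_rules[OF \<pi>] linear_0[OF \<pi>] linear_diff[OF \<pi>]
  form_rules inner_diff_left inner_diff_right

lemma D_bilinear: "bilinear D"
  unfolding bilinear_def D_def g_def
  by (auto intro!: linearI simp: all_lin_simps field_simps)

lemma D_sym: "D p q = D q p"
  by (simp add: D_def g_sym)

lemma D_nonneg: "D p p \<ge> 0"
  using dissipation[of "fst p" "snd p"] by (simp add: D_def g_diag)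

lemma Q_bilinear: "bilinear Q"
  unfolding bilinear_def
  by (intro conjI allI linearI)
    (simp_all add: Q_def bilinear_rules[OF D_bilinear] all_lin_simps algebra_simps)

lemma Q_sym: "Q p q = Q q p"
  by (simp add: Q_def D_sym[of p q] P_comm[of "fst p"] inner_commute)

lemma Q_nonneg: "Q p p \<ge> 0"
  unfolding Q_def by (intro add_nonneg_nonneg P_nonneg D_nonneg inner_ge_zero)

lemma P_kernel: "x \<bullet> (P *v x) = 0 \<Longrightarrow> P *v x = 0"
proof -
  assume x: "x \<bullet> (P *v x) = 0"
  have "(P *v x) \<bullet> (P *v x) = 0"
    using psd_form_kernel[OF bilinear_matrix_form P_comm subspace_UNIV P_nonneg UNIV_I x UNIV_I, of "P *v x"]
    by (simp add: P_comm[of x] inner_commute)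
  then show "P *v x = 0" by simp
qed

text \<open>For such \<open>x\<close> and zero input the slack is \<open>- \<rho> |C x|^2\<close>,
  yet it is nonnegative; so it vanishes and \<open>(x, 0)\<close> is in the kernel of
  \<open>D\<close>. Pairing with \<open>(y, 0)\<close> and \<open>(0, u)\<close> gives the remaining
  identities.\<close>

lemma null_space:
  assumes x: "x \<in> reachable" "P *v x = 0"
  shows "D (x, 0) q = 0" "\<rho> *\<^sub>R C x = 0" "P *v F x = 0" "\<Gamma> x = 0"
proof -
  have "D (x, 0) (x, 0) = - \<rho> * (C x \<bullet> C x)"
    using \<pi>id[OF x(1)] x(2) P_comm[of x] by (simp add: D_def g_def lin_simps)
  moreover have "\<rho> * (C x \<bullet> C x) \<ge> 0" using \<rho> by simp
  ultimately have D0: "D (x, 0) (x, 0) = 0" and r: "\<rho> * (C x \<bullet> C x) = 0"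
    using D_nonneg[of "(x, 0)"] by auto
  show Dq: "D (x, 0) q = 0" for q
    by (rule psd_form_kernel[OF D_bilinear D_sym subspace_UNIV D_nonneg UNIV_I D0 UNIV_I])
  show "\<rho> *\<^sub>R C x = 0" using r by auto
  then have rCi: "\<rho> * (C x \<bullet> w) = 0" for w by (metis inner_scaleR_left inner_zero_left)
  have "y \<bullet> (P *v F x) = 0" for y
    using Dq[of "(y, 0)"] \<pi>id[OF x(1)] x(2) P_comm[of x] rCi by (simp add: D_def g_def lin_simps)
  then show "P *v F x = 0" by (metis inner_eq_zero_iff)
  have "u \<bullet> \<Gamma> x = 0" for u
    using Dq[of "(0, u)"] \<pi>id[OF x(1)] x(2) P_comm[of x] rCi by (simp add: D_def g_def lin_simps linear_0[OF \<pi>])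
  then show "\<Gamma> x = 0" by (metis inner_eq_zero_iff)
qed

lemma Q_kernel:
  assumes "Q (x, v) (x, v) = 0"
  shows "x \<in> reachable" "P *v x = 0" "D (0, v) (0, v) = 0"
proof -
  have z: "x \<bullet> (P *v x) = 0" "D (x, v) (x, v) = 0" "(x - \<pi> x) \<bullet> (x - \<pi> x) = 0"
    using assms[unfolded Q_def fst_conv snd_conv] P_nonneg[of x] D_nonneg[of "(x, v)"] inner_ge_zero[of "x - \<pi> x"]
    by linarith+
  show x: "x \<in> reachable" using z(3) \<pi>R[of x] by simp
  show Px: "P *v x = 0" using P_kernel z by simp
  have "(x, v) = (x, 0) + (0, v)" by simp
  then have "D (x, v) (x, v) = D ((x, 0) + (0, v)) ((x, 0) + (0, v))" by simp
  also have "\<dots> = D (0, v) (0, v)"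
    using null_space(1)[OF x Px] D_sym[of "(0, v)" "(x, 0)"]
    by (simp only: bilinear_ladd[OF D_bilinear] bilinear_radd[OF D_bilinear] add_0_left add_0_right)
  finally show "D (0, v) (0, v) = 0" using z by simp
qed

text \<open>Inputs without dissipation form a subspace, and on it \<open>P B\<close> is injective:
  if \<open>P B v = 0\<close>, then \<open>v\<close> satisfies \<open>nondegenerate\<close> with
  \<open>N\<close> the reachable part of the kernel of \<open>P\<close>. The map \<beta> is a left
  inverse.\<close>

lemma input_recovery:
  obtains \<beta> where "linear \<beta>" "\<And>v. D (0, v) (0, v) = 0 \<Longrightarrow> \<beta> (P *v B v) = v"
proof -
  define U where "U = {v. D (0, v) (0, v) = 0}"
  have ker: "D (0, v) q = 0" if "v \<in> U" for v q
    using psd_form_kernel[OF D_bilinear D_sym subspace_UNIV D_nonneg UNIV_I _ UNIV_I] that by (auto simp: U_def)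
  have U: "subspace U"
  proof (rule subspaceI)
    show "0 \<in> U" using bilinear_lzero[OF D_bilinear] by (simp add: U_def zero_prod_def)
    show "v + u \<in> U" if "v \<in> U" "u \<in> U" for v u
    proof -
      have "D ((0, v) + (0, u)) ((0, v) + (0, u)) = 0"
        by (simp only: bilinear_ladd[OF D_bilinear] ker[OF that(1)] ker[OF that(2)] add_0_left)
      then show ?thesis by (simp add: U_def)
    qed
    show "c *\<^sub>R v \<in> U" if "v \<in> U" for c v
    proof -
      have "D (c *\<^sub>R (0, v)) (c *\<^sub>R (0, v)) = 0"
        by (simp only: bilinear_lmul[OF D_bilinear] ker[OF that] scaleR_zero_right)
      then show ?thesis by (simp add: U_def)
    qed
  qed
  have lPB: "linear (\<lambda>v. P *v B v)"
    by (auto intro!: linearI simp: lin_simps matrix_vector_right_distrib matrix_vector_mult_scaleR)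
  have "inj_on (\<lambda>v. P *v B v) U"
  proof (rule linear_inj_on_iff_eq_0[OF lPB U, THEN iffD2], safe)
    fix v assume v: "v \<in> U" "P *v B v = 0"
    define N where "N = {x \<in> reachable. P *v x = 0}"
    have N: "subspace N"
      unfolding N_def using subspace_reachable
      by (auto simp: subspace_def matrix_vector_right_distrib matrix_vector_mult_scaleR)
    show "v = 0"
    proof (rule nondegenerate[OF N])
      show "F ` N \<subseteq> N" using null_space(3) F_reachable by (auto simp: N_def)
      show "B v \<in> N" using B_reachable v by (simp add: N_def)
      show "\<Gamma> x = 0" "\<rho> *\<^sub>R C x = 0" if "x \<in> N" for x using null_space that by (auto simp: N_def)
      show "v \<bullet> \<Gamma> x = 0" if "x \<in> reachable" for x
        using ker[OF v(1), of "(x, 0)"] \<pi>id[OF that] v(2) by (simp add: D_def g_def lin_simps linear_0[OF \<pi>])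
      show "\<sigma> * (v \<bullet> C (B u) + u \<bullet> C (B v)) = 2 * \<delta> * (v \<bullet> u)" for u
        using ker[OF v(1), of "(0, u)"] by (simp add: D_def g_def lin_simps linear_0[OF \<pi>])
    qed
  qed
  then obtain \<beta> where "linear \<beta>" "\<forall>v\<in>U. \<beta> (P *v B v) = v"
    using linear_exists_left_inverse_on[OF lPB U] by blast
  then show ?thesis by (intro that) (auto simp: U_def)
qed

text \<open>On the invisible states either the output vanishes (\<open>\<rho> > 0\<close>, or
  \<open>\<sigma> = 0\<close> and hence \<open>\<theta> > 0\<close>), or the identity
  \<open>\<Gamma> x = 0\<close> is itself the law with \<open>c = \<theta> / \<sigma>\<close>. So
  the output there is exponentially stable in every case.\<close>

lemma CF_on_null_space:
  obtains c where "c > 0" "\<And>x. x \<in> reachable \<Longrightarrow> P *v x = 0 \<Longrightarrow> C (F x) + c *\<^sub>R C x = 0"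
proof (cases "\<rho> > 0 \<or> \<sigma> = 0")
  case True
  have "C x = 0" if "x \<in> reachable" "P *v x = 0" for x
    using True null_space[OF that] \<rho>\<theta> by (auto simp: \<Gamma>_def)
  then have "C (F x) + 1 *\<^sub>R C x = 0" if "x \<in> reachable" "P *v x = 0" for x
    using F_reachable null_space(3) that by simp
  then show ?thesis by (intro that[of 1]) auto
next
  case False
  then have s: "\<sigma> > 0" "\<theta> > 0" using \<sigma> \<rho>\<theta> by auto
  have "C (F x) + (\<theta> / \<sigma>) *\<^sub>R C x = 0" if "x \<in> reachable" "P *v x = 0" for x
  proof -
    have "(1 / \<sigma>) *\<^sub>R \<Gamma> x = 0" using null_space(4)[OF that] by simp
    then show ?thesis using s by (simp add: \<Gamma>_def scaleR_add_right)
  qed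
  then show ?thesis using s by (intro that[of "\<theta> / \<sigma>"]) auto
qed

section \<open>Splitting off the unreachable part\<close>

abbreviation \<tau> :: "real^'m \<Rightarrow> real^'m" where "\<tau> x \<equiv> x - \<pi> x"

lemma \<tau>_dynamics: "\<tau> (F x + B v) = \<tau> (F (\<tau> x))"
proof -
  have "F (\<pi> x) + B v \<in> reachable"
    using subspace_reachable \<pi>R by (intro subspace_add F_reachable B_reachable)
  then have "\<tau> (F (\<pi> x) + B v) = 0" using \<pi>id by simp
  moreover have "F x + B v = (F (\<pi> x) + B v) + F (\<tau> x)" by (simp add: linear_diff[OF F])
  moreover have "\<tau> (u + w) = \<tau> u + \<tau> w" for u w by (simp add: linear_add[OF \<pi>])
  ultimately show ?thesis by (metis add.left_neutral)
qed

text \<open>Modulo \<open>reachable\<close> the dynamics sees neither the input nor the feedback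
  \<open>\<kappa> B C\<close>, so the open and the closed loop agree there. The reachable correction
  is orthogonal to \<open>\<tau> x\<close> with respect to \<open>P0\<close>, and the closed-loop
  Lyapunov inequality applies to \<open>\<tau> x\<close>.\<close>

lemma transversal_decay:
  obtains a where "a > 0" "\<And>x v. \<tau> x \<bullet> (P0 *v \<tau> (F x + B v)) \<le> - a * (norm (\<tau> x))\<^sup>2"
    "\<And>x. x \<bullet> (P0 *v (F x + \<kappa> *\<^sub>R B (C x))) \<le> - a * (norm x)\<^sup>2"
proof -
  define H where "H x = F x + \<kappa> *\<^sub>R B (C x)" for x
  have H: "linear H" unfolding H_def by (auto intro!: linearI simp: lin_simps algebra_simps)
  have bil: "bilinear (\<lambda>x y. - (x \<bullet> (P0 *v H y) + y \<bullet> (P0 *v H x)))"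
    unfolding bilinear_def
    by (auto intro!: linearI simp: linear_rules[OF H] all_lin_simps algebra_simps)
  have Hneg: "x \<bullet> (P0 *v H x) < 0" if "x \<noteq> 0" for x using P0_lyap[OF that] by (simp add: H_def)
  obtain c where c: "c > 0" "\<And>x. c * (norm x)\<^sup>2 \<le> - (x \<bullet> (P0 *v H x) + x \<bullet> (P0 *v H x))"
    by (rule positive_form_coercive[OF bil]) (use Hneg in \<open>auto simp: add.commute intro: add_neg_neg\<close>)
  have rate: "x \<bullet> (P0 *v H x) \<le> - (c / 2) * (norm x)\<^sup>2" for x using c(2)[of x] by simp
  show ?thesis
  proof (rule that[of "c / 2"])
    fix x v
    define r where "r = \<pi> (F (\<tau> x)) + \<kappa> *\<^sub>R B (C (\<tau> x))"
    have "r \<in> reachable"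
      unfolding r_def using subspace_reachable by (intro subspace_add subspace_scale \<pi>R B_reachable)
    then have "\<tau> x \<bullet> (P0 *v r) = 0" using \<pi>_orth[of r x] P0_comm[of r] by simp
    moreover have "\<tau> (F (\<tau> x)) = H (\<tau> x) - r" by (simp add: H_def r_def)
    ultimately have "\<tau> x \<bullet> (P0 *v \<tau> (F x + B v)) = \<tau> x \<bullet> (P0 *v H (\<tau> x))"
      unfolding \<tau>_dynamics by (simp add: matrix_vector_mult_diff_distrib inner_diff_right)
    then show "\<tau> x \<bullet> (P0 *v \<tau> (F x + B v)) \<le> - (c / 2) * (norm (\<tau> x))\<^sup>2" using rate[of "\<tau> x"] by simp
  qed (use c rate in \<open>auto simp: H_def\<close>)
qed

lemma Q_dominates:
  fixes l :: "(real^'m) \<times> (real^'n) \<Rightarrow> 'c::euclidean_space"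
  assumes l: "linear l"
    and ker: "\<And>x v. x \<in> reachable \<Longrightarrow> P *v x = 0 \<Longrightarrow> D (0, v) (0, v) = 0 \<Longrightarrow> l (x, v) = 0"
  obtains c where "c > 0" "\<And>x v. norm (l (x, v)) \<le> c * sqrt (Q (x, v) (x, v))"
proof -
  have "l p = 0" if "Q p p = 0" for p using ker[of "fst p" "snd p"] Q_kernel[of "fst p" "snd p"] that by simp
  then obtain c where c: "c > 0" "\<And>p. (norm (l p))\<^sup>2 \<le> c * Q p p"
    using psd_form_dominates[OF Q_bilinear Q_sym Q_nonneg l] by blast
  have "norm (l p) \<le> sqrt c * sqrt (Q p p)" for p
    using c(2)[of p] by (simp add: real_le_rsqrt flip: real_sqrt_mult)
  then show ?thesis using c by (intro that[of "sqrt c"]) auto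
qed

text \<open>The input need not be controlled by the energy, but \<open>v - \<beta> (P (F x + B v))\<close> is. The correction
  \<open>\<beta> (P x) \<bullet> \<Gamma> (\<tau> x)\<close> of the storage function is an integration by parts that trades the cross term
  \<open>v \<bullet> \<Gamma> (\<tau> x)\<close> for controlled terms.\<close>

lemma storage_rate:
  assumes \<beta>: "linear \<beta>" and \<beta>U: "\<And>v. D (0, v) (0, v) = 0 \<Longrightarrow> \<beta> (P *v B v) = v"
  obtains c where "c > 0"
    "\<And>x v. 2 * (x \<bullet> (P *v (F x + B v)))
        - (\<beta> (P *v (F x + B v)) \<bullet> \<Gamma> (\<tau> x) + \<beta> (P *v x) \<bullet> \<Gamma> (\<tau> (F x + B v)))
      \<le> - G x v - D (x, v) (x, v) + c * sqrt (Q (x, v) (x, v)) * norm (\<tau> x)"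
proof -
  have l1: "linear (\<lambda>p. snd p - \<beta> (P *v (F (fst p) + B (snd p))))"
    by (auto intro!: linearI simp: all_lin_simps linear_rules[OF \<beta>] algebra_simps)
  \<comment> \<open>The factor \<rho> is kept: on the null space only \<open>\<rho> C x\<close> is
    known to vanish, not \<open>C x\<close>.\<close>
  have l2: "linear (\<lambda>p :: (real^'m) \<times> (real^'n). \<rho> *\<^sub>R C (fst p))"
    by (auto intro!: linearI simp: all_lin_simps algebra_simps)
  have l3: "linear (\<lambda>p :: (real^'m) \<times> (real^'n). P *v (fst p))"
    by (auto intro!: linearI simp: all_lin_simps algebra_simps)
  have l4: "linear (\<lambda>p :: (real^'m) \<times> (real^'n). \<beta> (P *v (fst p)))"
    by (auto intro!: linearI simp: all_lin_simps linear_rules[OF \<beta>] algebra_simps)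
  obtain c1 where c1: "c1 > 0" "\<And>x v. norm (v - \<beta> (P *v (F x + B v))) \<le> c1 * sqrt (Q (x, v) (x, v))"
    by (rule Q_dominates[OF l1]) (use \<beta>U null_space(3) in \<open>auto simp: matrix_vector_right_distrib\<close>)
  obtain c2 where c2: "c2 > 0" "\<And>x v. norm (\<rho> *\<^sub>R C x) \<le> c2 * sqrt (Q (x, v) (x, v))"
    by (rule Q_dominates[OF l2]) (use null_space(2) in auto)
  obtain c3 where c3: "c3 > 0" "\<And>x v. norm (P *v x) \<le> c3 * sqrt (Q (x, v) (x, v))"
    by (rule Q_dominates[OF l3]) auto
  obtain c4 where c4: "c4 > 0" "\<And>x v. norm (\<beta> (P *v x)) \<le> c4 * sqrt (Q (x, v) (x, v))"
    by (rule Q_dominates[OF l4]) (use linear_0[OF \<beta>] in auto)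
  obtain k1 where k1: "k1 > 0" "\<And>x. norm (\<Gamma> x) \<le> k1 * norm x" using linear_bounded_pos[OF \<Gamma>_linear] by blast
  obtain k2 where k2: "k2 > 0" "\<And>x. norm (C x) \<le> k2 * norm x" using linear_bounded_pos[OF C] by blast
  obtain k3 where k3: "k3 > 0" "\<And>x. norm (F x) \<le> k3 * norm x" using linear_bounded_pos[OF F] by blast
  have "linear (\<lambda>x. - \<Gamma> (\<tau> (F x)))"
    by (auto intro!: linearI simp: all_lin_simps linear_diff[OF \<Gamma>_linear] algebra_simps)
  then obtain k4 where k4: "k4 > 0" "\<And>x. norm (- \<Gamma> (\<tau> (F x))) \<le> k4 * norm x" using linear_bounded_pos by blast
  have prod: "u \<bullet> w \<le> c * k * (q * s)" if "norm u \<le> c * q" "norm w \<le> k * s" "c > 0" "q \<ge> 0"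
    for u w :: "'c::real_inner" and c k q s
  proof -
    have "u \<bullet> w \<le> norm u * norm w" by (rule norm_cauchy_schwarz)
    also have "\<dots> \<le> (c * q) * (k * s)" using that by (intro mult_mono) auto
    finally show ?thesis by (simp add: mult_ac)
  qed
  define c where "c = c1 * k1 + 2 * (c2 * k2) + 2 * (c3 * k3) + c4 * k4"
  show ?thesis
  proof (rule that[of c])
    show "c > 0" using c1 c2 c3 c4 k1 k2 k3 k4 by (auto simp: c_def intro!: add_pos_pos)
    fix x v
    define e where "e = F x + B v"
    define y where "y = \<tau> x"
    define q where "q = sqrt (Q (x, v) (x, v))"
    have q0: "q \<ge> 0" by (simp add: q_def Q_nonneg)
    have "2 * (x \<bullet> (P *v e)) = - D (x, v) (x, v) - G (\<pi> x) v + 2 * (x \<bullet> (P *v F y))"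
      by (simp add: D_def g_diag e_def y_def linear_diff[OF F] matrix_vector_mult_diff_distrib
          matrix_vector_right_distrib inner_add_right inner_diff_right)
    \<comment> \<open>The dissipation inequality concerns \<open>\<pi> x = x - y\<close>, while the
      supply along the trajectory is taken at \<open>x\<close>. The difference consists of cross
      terms with \<open>y\<close> and a \<rho> term whose sign allows it to be dropped.\<close>
    also have "G (\<pi> x) v = G x v - v \<bullet> \<Gamma> y - 2 * (\<rho> *\<^sub>R C x \<bullet> C y) + \<rho> * (C y \<bullet> C y)"
      by (simp add: G_def y_def linear_diff[OF C] linear_diff[OF \<Gamma>_linear] inner_diff_left inner_diff_right
          inner_commute algebra_simps)
    finally have V: "2 * (x \<bullet> (P *v e)) \<le> - D (x, v) (x, v) - G x v + v \<bullet> \<Gamma> y + 2 * (\<rho> *\<^sub>R C x \<bullet> C y)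
        + 2 * ((P *v x) \<bullet> F y)"
      using \<rho> P_comm[of x "F y"] by (simp add: inner_commute[of "P *v x"])
    have \<tau>e: "\<tau> e = \<tau> (F y)" unfolding e_def y_def by (rule \<tau>_dynamics)
    have "2 * (x \<bullet> (P *v e)) - (\<beta> (P *v e) \<bullet> \<Gamma> y + \<beta> (P *v x) \<bullet> \<Gamma> (\<tau> e))
        \<le> - D (x, v) (x, v) - G x v + (v - \<beta> (P *v e)) \<bullet> \<Gamma> y + 2 * (\<rho> *\<^sub>R C x \<bullet> C y)
          + 2 * ((P *v x) \<bullet> F y) + \<beta> (P *v x) \<bullet> (- \<Gamma> (\<tau> (F y)))"
      using V unfolding \<tau>e by (simp add: inner_diff_left)
    moreover have "(v - \<beta> (P *v e)) \<bullet> \<Gamma> y \<le> c1 * k1 * (q * norm y)"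
      using prod[OF c1(2)[of v x] k1(2)[of y] c1(1)] q0 by (simp add: e_def q_def)
    moreover have "\<rho> *\<^sub>R C x \<bullet> C y \<le> c2 * k2 * (q * norm y)"
      using prod[OF c2(2)[of x v] k2(2)[of y] c2(1)] q0 by (simp add: q_def)
    moreover have "(P *v x) \<bullet> F y \<le> c3 * k3 * (q * norm y)"
      using prod[OF c3(2)[of x v] k3(2)[of y] c3(1)] q0 by (simp add: q_def)
    moreover have "\<beta> (P *v x) \<bullet> (- \<Gamma> (\<tau> (F y))) \<le> c4 * k4 * (q * norm y)"
      using prod[OF c4(2)[of x v] k4(2)[of y] c4(1)] q0 by (simp add: q_def)
    moreover have "c * q * norm y = c1 * k1 * (q * norm y) + 2 * (c2 * k2 * (q * norm y))
        + 2 * (c3 * k3 * (q * norm y)) + c4 * k4 * (q * norm y)"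
      by (simp add: c_def algebra_simps)
    ultimately show "2 * (x \<bullet> (P *v (F x + B v)))
        - (\<beta> (P *v (F x + B v)) \<bullet> \<Gamma> (\<tau> x) + \<beta> (P *v x) \<bullet> \<Gamma> (\<tau> (F x + B v)))
      \<le> - G x v - D (x, v) (x, v) + c * sqrt (Q (x, v) (x, v)) * norm (\<tau> x)"
      unfolding e_def[symmetric] y_def[symmetric] q_def[symmetric] by linarith
  qed
qed

text \<open>Subtracting \<open>B (\<beta> (P x))\<close> from the state removes the uncontrolled part of the input from the dynamics.\<close>

lemma state_rate:
  assumes \<beta>: "linear \<beta>" and \<beta>U: "\<And>v. D (0, v) (0, v) = 0 \<Longrightarrow> \<beta> (P *v B v) = v"
  obtains z a c where "bilinear z" "\<And>x y. z x y = z y x" "\<And>x. x \<noteq> 0 \<Longrightarrow> z x x > 0" "a > 0" "c > 0"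
    "\<And>x v. 2 * z (x - B (\<beta> (P *v x))) ((F x + B v) - B (\<beta> (P *v (F x + B v))))
      \<le> - a * (norm (x - B (\<beta> (P *v x))))\<^sup>2 + c * Q (x, v) (x, v)"
proof -
  define X where "X x = x - B (\<beta> (P *v x))" for x
  have X: "linear X"
    unfolding X_def by (auto intro!: linearI simp: all_lin_simps linear_rules[OF \<beta>] algebra_simps)
  have Xnull: "X x = x" if "P *v x = 0" for x
    using that by (simp add: X_def linear_0[OF \<beta>] linear_0[OF B])
  obtain c0 where c0: "c0 > 0" "\<And>x. x \<in> reachable \<Longrightarrow> P *v x = 0 \<Longrightarrow> C (F x) + c0 *\<^sub>R C x = 0"
    by (rule CF_on_null_space) blast
  \<comment> \<open>Two defects that vanish on the kernel of \<open>Q\<close>: \<open>w\<close>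
    measures the failure of \<open>X\<close> to follow the uncontrolled dynamics \<open>F\<close>,
    and \<open>l\<close> the failure of the output law \<open>C F = - c0 C\<close>.\<close>
  define w where "w p = X (F (fst p) + B (snd p)) - F (X (fst p))" for p
  define l where "l p = C (F (X (fst p))) + c0 *\<^sub>R C (X (fst p))" for p :: "(real^'m) \<times> (real^'n)"
  have w: "linear w"
    unfolding w_def by (auto intro!: linearI simp: lin_simps linear_rules[OF X] algebra_simps)
  have l: "linear l"
    unfolding l_def by (auto intro!: linearI simp: lin_simps linear_rules[OF X] algebra_simps)
  obtain cw where cw: "cw > 0" "\<And>x v. norm (w (x, v)) \<le> cw * sqrt (Q (x, v) (x, v))"
  proof (rule Q_dominates[OF w])
    fix x v assume x: "x \<in> reachable" "P *v x = 0" and v: "D (0, v) (0, v) = 0"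
    have "X (F x) = F x" by (rule Xnull[OF null_space(3)[OF x]])
    moreover have "X (B v) = 0" using \<beta>U[OF v] by (simp add: X_def)
    ultimately show "w (x, v) = 0" using Xnull[OF x(2)] by (simp add: w_def linear_add[OF X])
  qed blast
  obtain cl where cl: "cl > 0" "\<And>x v. norm (l (x, v)) \<le> cl * sqrt (Q (x, v) (x, v))"
    by (rule Q_dominates[OF l]) (use c0 Xnull in \<open>auto simp: l_def\<close>)
  obtain a where a: "a > 0" "\<And>x. x \<bullet> (P0 *v (F x + \<kappa> *\<^sub>R B (C x))) \<le> - a * (norm x)\<^sup>2"
    by (rule transversal_decay) blast
  have bB: "bilinear (\<lambda>x y. - \<kappa> * (x \<bullet> (P0 *v B y)))"
    unfolding bilinear_def by (auto intro!: linearI simp: all_lin_simps algebra_simps)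
  obtain m where m: "m > 0" "\<And>x y. - \<kappa> * (x \<bullet> (P0 *v B y)) \<le> m * norm x * norm y"
    by (rule bilinear_abs_bound[OF bB]) blast
  \<comment> \<open>\<open>P0\<close> decreases only for the closed loop, so the missing feedback
    leaves a cross term \<open>m * n * s\<close> with \<open>s\<close> the size of the output.
    Weighting the output energy by \<open>K\<close> gives the decay
    \<open>K * c0 / 2 = m\<^sup>2 / a\<close>, exactly what Young's inequality needs to absorb
    it.\<close>
  define K where "K = 2 * m\<^sup>2 / (a * c0)"
  have K: "K > 0" using m a c0 by (simp add: K_def)
  define z where "z x y = x \<bullet> (P0 *v y) + K * (C x \<bullet> C y)" for x y
  have z: "bilinear z"
    unfolding z_def bilinear_def by (auto intro!: linearI simp: all_lin_simps algebra_simps)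
  obtain M where M: "M > 0" "\<And>x y. z x y \<le> M * norm x * norm y"
    by (rule bilinear_abs_bound[OF z]) blast
  define c where "c = 2 * (M\<^sup>2 / a * cw\<^sup>2 + K / (2 * c0) * cl\<^sup>2)"
  have "2 * z (X x) (X (F x + B v)) \<le> - a * (norm (X x))\<^sup>2 + c * Q (x, v) (x, v)" for x v
  proof -
    define n s where "n = norm (X x)" and "s = norm (C (X x))"
    define q where "q = Q (x, v) (x, v)"
    have q0: "q \<ge> 0" by (simp add: q_def Q_nonneg)
    have lin: "z (X x) (X (F x + B v)) = z (X x) (F (X x)) + z (X x) (w (x, v))"
      by (simp add: w_def flip: bilinear_radd[OF z])
    have "X x \<bullet> (P0 *v F (X x)) = X x \<bullet> (P0 *v (F (X x) + \<kappa> *\<^sub>R B (C (X x)))) - \<kappa> * (X x \<bullet> (P0 *v B (C (X x))))"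
      by (simp add: matrix_vector_right_distrib matrix_vector_mult_scaleR inner_add_right)
    also have "\<dots> \<le> - a * n\<^sup>2 + m * n * s" using a(2)[of "X x"] m(2)[of "X x" "C (X x)"] by (simp add: n_def s_def)
    finally have 1: "X x \<bullet> (P0 *v F (X x)) \<le> - a * n\<^sup>2 + n * (m * s)" by (simp add: mult_ac)
    have "C (X x) \<bullet> C (F (X x)) = C (X x) \<bullet> l (x, v) - c0 * s\<^sup>2"
      by (simp add: l_def inner_add_right s_def power2_norm_eq_inner)
    also have "\<dots> \<le> s * norm (l (x, v)) - c0 * s\<^sup>2" using norm_cauchy_schwarz[of "C (X x)" "l (x, v)"] by (simp add: s_def)
    finally have "K * (C (X x) \<bullet> C (F (X x))) \<le> K * (s * norm (l (x, v)) - c0 * s\<^sup>2)"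
      using K by (intro mult_left_mono) auto
    also have "\<dots> = K * (s * norm (l (x, v))) - K * (c0 * s\<^sup>2)" by (simp add: algebra_simps)
    also have "s * norm (l (x, v)) \<le> (2 * c0) * s\<^sup>2 / 4 + (norm (l (x, v)))\<^sup>2 / (2 * c0)"
      using weighted_young[of "2 * c0"] c0 by simp
    finally have "K * (C (X x) \<bullet> C (F (X x)))
        \<le> K * ((2 * c0) * s\<^sup>2 / 4 + (norm (l (x, v)))\<^sup>2 / (2 * c0)) - K * (c0 * s\<^sup>2)"
      using K by simp
    also have "\<dots> = K / (2 * c0) * (norm (l (x, v)))\<^sup>2 - K * c0 / 2 * s\<^sup>2" using c0 by (simp add: field_simps)
    finally have 2: "K * (C (X x) \<bullet> C (F (X x))) \<le> K / (2 * c0) * (norm (l (x, v)))\<^sup>2 - m\<^sup>2 / a * s\<^sup>2"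
      using c0 by (simp add: K_def)
    have 3: "n * (m * s) \<le> a * n\<^sup>2 / 4 + m\<^sup>2 / a * s\<^sup>2"
      using weighted_young[OF a(1), of n "m * s"] by (simp add: power_mult_distrib)
    have 4: "z (X x) (w (x, v)) \<le> a * n\<^sup>2 / 4 + M\<^sup>2 / a * (norm (w (x, v)))\<^sup>2"
      using M(2)[of "X x" "w (x, v)"] weighted_young[OF a(1), of n "M * norm (w (x, v))"]
      by (simp add: power_mult_distrib n_def mult_ac)
    have sq: "(norm (u::real^'k))\<^sup>2 \<le> k\<^sup>2 * q" if "norm u \<le> k * sqrt q" for u k
      using power_mono[OF that, of 2] q0 by (simp add: power_mult_distrib)
    have 5: "M\<^sup>2 / a * (norm (w (x, v)))\<^sup>2 \<le> M\<^sup>2 / a * (cw\<^sup>2 * q)"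
      using sq[OF cw(2)[of x v, folded q_def]] a by (intro mult_left_mono) auto
    have "(norm (l (x, v)))\<^sup>2 \<le> cl\<^sup>2 * q"
      using power_mono[OF cl(2)[of x v, folded q_def], of 2] q0 by (simp add: power_mult_distrib)
    then have 6: "K / (2 * c0) * (norm (l (x, v)))\<^sup>2 \<le> K / (2 * c0) * (cl\<^sup>2 * q)"
      using K c0 by (intro mult_left_mono) auto
    define n' s' w1 w2 l1 l2 where "n' = a * n\<^sup>2" and "s' = m\<^sup>2 / a * s\<^sup>2"
      and "w1 = M\<^sup>2 / a * (norm (w (x, v)))\<^sup>2" and "w2 = M\<^sup>2 / a * (cw\<^sup>2 * q)"
      and "l1 = K / (2 * c0) * (norm (l (x, v)))\<^sup>2" and "l2 = K / (2 * c0) * (cl\<^sup>2 * q)"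
    note abbr = n'_def[symmetric] s'_def[symmetric] w1_def[symmetric] w2_def[symmetric] l1_def[symmetric] l2_def[symmetric]
    have "c * q = 2 * w2 + 2 * l2" by (simp add: c_def w2_def l2_def algebra_simps)
    moreover have "z (X x) (F (X x)) = X x \<bullet> (P0 *v F (X x)) + K * (C (X x) \<bullet> C (F (X x)))"
      by (simp add: z_def)
    moreover have "2 * (zf + zw) \<le> - n' + cq"
      if "cq = 2 * w2 + 2 * l2" "zf = t1 + t2" "t1 \<le> - n' + t3" "t2 \<le> l1 - s'" "t3 \<le> n' / 4 + s'"
        "zw \<le> n' / 4 + w1" "w1 \<le> w2" "l1 \<le> l2" for zf zw cq t1 t2 t3 :: real
      using that by (simp add: field_simps)
    ultimately have "2 * (z (X x) (F (X x)) + z (X x) (w (x, v))) \<le> - n' + c * q"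
      using 1[unfolded mult_minus_left abbr] 2[unfolded abbr] 3[unfolded abbr] 4[unfolded abbr] 5[unfolded abbr] 6[unfolded abbr]
      by blast
    then show ?thesis unfolding lin n_def[symmetric] q_def[symmetric] n'_def by simp
  qed
  moreover have "z x y = z y x" for x y by (simp add: z_def P0_comm[of x] inner_commute)
  moreover have "z x x > 0" if "x \<noteq> 0" for x
    using P0_pos[OF that] K by (simp add: z_def add_pos_nonneg)
  moreover have "c > 0" using a K c0 M cw cl by (auto simp: c_def intro!: add_pos_pos)
  ultimately show ?thesis using that[of z a c] z a(1) unfolding X_def by blast
qed

end

section \<open>The combined energy estimate\<close>

context popov_storage
begin

text \<open>The nonlinearity enters only through a function \<open>h\<close> whose derivative is
  bounded by the supply. \<open>K\<close> does not depend on \<open>T\<close>, and nothing is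
  required of \<open>v\<close> beyond the differential relations; so the bound serves every solution
  on any interval. The comparison principle is applied with \<open>W = w + h\<close> and
  \<open>Z\<close> the form \<open>z\<close> of \<open>X y\<close>.\<close>

theorem storage_bounded_response:
  "\<exists>K>0. \<forall>T y v h h'. 0 \<le> T \<longrightarrow>
      (\<forall>t\<in>{0..T}. (y has_vector_derivative F (y t) + B (v t)) (at t within {0..T}) \<and>
        (h has_real_derivative h' t) (at t within {0..T}) \<and> 0 \<le> h t \<and> h' t \<le> G (y t) (v t)) \<longrightarrow>
      (norm (y T))\<^sup>2 \<le> K * ((norm (y 0))\<^sup>2 + h 0)"
proof -
  obtain \<beta> where \<beta>: "linear \<beta>" and \<beta>U: "\<And>v. D (0, v) (0, v) = 0 \<Longrightarrow> \<beta> (P *v B v) = v"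
    by (rule input_recovery) blast
  define X where "X x = x - B (\<beta> (P *v x))" for x
  define \<psi> where "\<psi> x y = \<beta> (P *v x) \<bullet> \<Gamma> (\<tau> y)" for x y
  have X: "linear X"
    unfolding X_def by (auto intro!: linearI simp: all_lin_simps linear_rules[OF \<beta>] algebra_simps)
  have \<tau>: "linear \<tau>" by (auto intro!: linearI simp: all_lin_simps algebra_simps)
  have \<psi>: "bilinear \<psi>"
    unfolding bilinear_def \<psi>_def
    by (auto intro!: linearI simp: all_lin_simps linear_rules[OF \<beta>] linear_diff[OF \<Gamma>_linear] algebra_simps)
  have \<beta>P: "linear (\<lambda>x. \<beta> (P *v x))" and B\<beta>P: "linear (\<lambda>x. B (\<beta> (P *v x)))"
    by (auto intro!: linearI simp: all_lin_simps linear_rules[OF \<beta>])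
  obtain c1 where c1: "c1 > 0"
    "\<And>x v. 2 * (x \<bullet> (P *v (F x + B v))) - (\<psi> (F x + B v) x + \<psi> x (F x + B v))
      \<le> - G x v - D (x, v) (x, v) + c1 * sqrt (Q (x, v) (x, v)) * norm (\<tau> x)"
    by (rule storage_rate[OF \<beta> \<beta>U, folded \<psi>_def], assumption) (rule that; assumption)
  obtain z a2 c2 where z: "bilinear z" "\<And>x y. z x y = z y x" "\<And>x. x \<noteq> 0 \<Longrightarrow> z x x > 0"
    and a2: "a2 > 0" and c2: "c2 > 0"
      "\<And>x v. 2 * z (X x) (X (F x + B v)) \<le> - a2 * (norm (X x))\<^sup>2 + c2 * Q (x, v) (x, v)"
    by (rule state_rate[OF \<beta> \<beta>U, folded X_def], assumption) (rule that; assumption)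
  obtain a1 where a1: "a1 > 0" "\<And>x v. \<tau> x \<bullet> (P0 *v \<tau> (F x + B v)) \<le> - a1 * (norm (\<tau> x))\<^sup>2"
    by (rule transversal_decay) blast
  obtain p1 where p1: "p1 > 0" "\<And>x. p1 * (norm x)\<^sup>2 \<le> x \<bullet> (P0 *v x)"
    by (rule positive_form_coercive[OF bilinear_matrix_form P0_comm P0_pos]) blast+
  obtain p2 where p2: "p2 > 0" "\<And>x y. x \<bullet> (P0 *v y) \<le> p2 * norm x * norm y"
    by (rule bilinear_abs_bound[OF bilinear_matrix_form]) blast
  obtain z1 where z1: "z1 > 0" "\<And>x. z1 * (norm x)\<^sup>2 \<le> z x x"
    by (rule positive_form_coercive[OF z]) blast+
  obtain z2 where z2: "z2 > 0" "\<And>x y. z x y \<le> z2 * norm x * norm y"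
    by (rule bilinear_abs_bound[OF z(1)]) blast
  obtain c3 where c3: "c3 > 0" "\<And>x. (norm (\<beta> (P *v x)))\<^sup>2 \<le> c3 * (x \<bullet> (P *v x))"
    by (rule psd_form_dominates[OF bilinear_matrix_form P_comm P_nonneg \<beta>P])
      (metis P_kernel linear_0[OF \<beta>], rule that)
  obtain c5 where c5: "c5 > 0" "\<And>x. (norm (B (\<beta> (P *v x))))\<^sup>2 \<le> c5 * (x \<bullet> (P *v x))"
    by (rule psd_form_dominates[OF bilinear_matrix_form P_comm P_nonneg B\<beta>P])
      (metis P_kernel linear_0[OF \<beta>] linear_0[OF B], rule that)
  obtain k where k: "k > 0" "\<And>x. norm (\<Gamma> x) \<le> k * norm x" using linear_bounded_pos[OF \<Gamma>_linear] by blast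
  define E where "E x y = \<tau> x \<bullet> (P0 *v \<tau> y)" for x y
  have E: "bilinear E"
    unfolding bilinear_def E_def by (auto intro!: linearI simp: all_lin_simps algebra_simps)
  have s2: "(norm (\<tau> x))\<^sup>2 \<le> E x x / p1" for x using p1 by (simp add: E_def field_simps)
  have Enn: "E x x \<ge> 0" for x
    using order_trans[OF _ p1(2)[of "\<tau> x"]] p1(1) by (simp add: E_def)
  \<comment> \<open>The first summand offsets the correction \<psi>, so that \<open>w\<close>
    dominates half the stored energy. The second lets the decay of \<open>E\<close> absorb the part
    of \<open>c1 * sqrt Q * norm (\<tau> x)\<close> that remains after giving up half of
    \<open>D\<close>.\<close>
  define K1 where "K1 = c3 * k\<^sup>2 / (2 * p1) + (c1\<^sup>2 / 2 + c1) / (2 * a1)"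
  define w where "w x y = x \<bullet> (P *v y) - \<psi> x y + K1 * E x y" for x y
  have w: "bilinear w"
    unfolding w_def bilinear_def
    by (auto intro!: linearI simp: all_lin_simps bilinear_rules[OF \<psi>] bilinear_rules[OF E] algebra_simps)
  have w_lower: "x \<bullet> (P *v x) \<le> 2 * w x x" for x
  proof -
    have "\<psi> x x \<le> norm (\<beta> (P *v x)) * norm (\<Gamma> (\<tau> x))" unfolding \<psi>_def by (rule norm_cauchy_schwarz)
    also have "\<dots> = norm (\<Gamma> (\<tau> x)) * norm (\<beta> (P *v x))" by simp
    also have "\<dots> \<le> (2 * c3) * (norm (\<Gamma> (\<tau> x)))\<^sup>2 / 4 + (norm (\<beta> (P *v x)))\<^sup>2 / (2 * c3)"
      using c3 by (intro weighted_young) auto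
    also have "(norm (\<beta> (P *v x)))\<^sup>2 / (2 * c3) \<le> (x \<bullet> (P *v x)) / 2" using c3 by (simp add: field_simps)
    also have "(2 * c3) * (norm (\<Gamma> (\<tau> x)))\<^sup>2 / 4 \<le> (2 * c3) * (k\<^sup>2 * (E x x / p1)) / 4"
    proof -
      have "(norm (\<Gamma> (\<tau> x)))\<^sup>2 \<le> (k * norm (\<tau> x))\<^sup>2" by (intro power_mono k) simp
      also have "\<dots> \<le> k\<^sup>2 * (E x x / p1)"
        unfolding power_mult_distrib by (intro mult_left_mono s2) simp
      finally have "(2 * c3) * (norm (\<Gamma> (\<tau> x)))\<^sup>2 \<le> (2 * c3) * (k\<^sup>2 * (E x x / p1))"
        using c3 by (intro mult_left_mono) auto
      then show ?thesis by (rule divide_right_mono) simp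
    qed
    also have "(2 * c3) * (k\<^sup>2 * (E x x / p1)) / 4 = c3 * k\<^sup>2 / (2 * p1) * E x x" by simp
    finally have "\<psi> x x \<le> c3 * k\<^sup>2 / (2 * p1) * E x x + (x \<bullet> (P *v x)) / 2" by simp
    moreover have "c3 * k\<^sup>2 / (2 * p1) * E x x \<le> K1 * E x x"
      using Enn a1 c1 by (intro mult_right_mono) (auto simp: K1_def)
    ultimately show ?thesis by (simp add: w_def)
  qed
  define a where "a = a1 / p2"
  define d where "d = a2 / z2"
  define c where "c = c1 / sqrt p1 + c2 + c2 / p1"
  have pos: "a > 0" "c > 0" "d > 0"
    using a1 a2 c1 c2 p1 p2 z2 by (auto simp: a_def d_def c_def intro!: add_pos_pos)
  have E_rate: "2 * E x (F x + B v) \<le> - 2 * a * E x x" for x v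
  proof -
    have "E x x \<le> p2 * (norm (\<tau> x))\<^sup>2" using p2(2)[of "\<tau> x" "\<tau> x"] by (simp add: E_def power2_eq_square)
    then have "a * E x x \<le> a * (p2 * (norm (\<tau> x))\<^sup>2)" using pos by (intro mult_left_mono) auto
    then show ?thesis using a1(2)[of x v] p2 by (simp add: E_def a_def)
  qed
  have w_rate: "w x (F x + B v) + w (F x + B v) x + G x v
      \<le> - D (x, v) (x, v) / 2 + c * sqrt (x \<bullet> (P *v x)) * sqrt (E x x)" for x v
  proof -
    define s where "s = norm (\<tau> x)"
    define V where "V = x \<bullet> (P *v x)"
    define d where "d = D (x, v) (x, v)"
    have nn: "s \<ge> 0" "V \<ge> 0" "d \<ge> 0" using P_nonneg D_nonneg by (auto simp: s_def V_def d_def)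
    have "Q (x, v) (x, v) = V + d + s\<^sup>2" by (simp add: Q_def V_def d_def s_def power2_norm_eq_inner)
    then have "sqrt (Q (x, v) (x, v)) \<le> sqrt V + sqrt d + s"
      using sqrt_add_le_add_sqrt[of "V + d" "s\<^sup>2"] sqrt_add_le_add_sqrt[of V d] nn by simp
    then have "c1 * sqrt (Q (x, v) (x, v)) * s \<le> c1 * (sqrt V + sqrt d + s) * s"
      using c1 nn by (intro mult_right_mono mult_left_mono) auto
    also have "\<dots> = c1 * sqrt V * s + (c1 * s) * sqrt d + c1 * s\<^sup>2" by (simp add: algebra_simps power2_eq_square)
    also have "(c1 * s) * sqrt d \<le> 2 * (c1 * s)\<^sup>2 / 4 + (sqrt d)\<^sup>2 / 2" by (rule weighted_young) simp
    finally have Q1: "c1 * sqrt (Q (x, v) (x, v)) * s \<le> c1 * sqrt V * s + d / 2 + (c1\<^sup>2 / 2 + c1) * s\<^sup>2"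
      using nn by (simp add: power_mult_distrib algebra_simps)
    have K1: "(c1\<^sup>2 / 2 + c1) \<le> 2 * K1 * a1"
    proof -
      have "(c1\<^sup>2 / 2 + c1) = 2 * ((c1\<^sup>2 / 2 + c1) / (2 * a1)) * a1" using a1 by simp
      also have "\<dots> \<le> 2 * K1 * a1" using a1 c3 p1 by (intro mult_right_mono) (auto simp: K1_def)
      finally show ?thesis .
    qed
    have K10: "K1 \<ge> 0" using a1 c1 c3 p1 by (simp add: K1_def)
    have "E x (F x + B v) + E (F x + B v) x = 2 * (\<tau> x \<bullet> (P0 *v \<tau> (F x + B v)))"
      using P0_comm[of "\<tau> x" "\<tau> (F x + B v)"] by (simp add: E_def)
    then have "E x (F x + B v) + E (F x + B v) x \<le> 2 * (- a1 * s\<^sup>2)"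
      using a1(2)[of x v] by (simp add: s_def)
    then have "K1 * (E x (F x + B v) + E (F x + B v) x) \<le> K1 * (2 * (- a1 * s\<^sup>2))"
      using K10 by (intro mult_left_mono) auto
    also have "\<dots> = - (2 * K1 * a1) * s\<^sup>2" by simp
    also have "\<dots> \<le> - (c1\<^sup>2 / 2 + c1) * s\<^sup>2" using K1 by (intro mult_right_mono) auto
    finally have E1: "K1 * E x (F x + B v) + K1 * E (F x + B v) x \<le> - (c1\<^sup>2 / 2 + c1) * s\<^sup>2"
      by (simp add: distrib_left)
    have "s \<le> sqrt (E x x / p1)" using s2[of x] nn by (simp add: s_def real_le_rsqrt)
    then have "c1 * sqrt V * s \<le> c1 * sqrt V * sqrt (E x x / p1)"
      using c1 nn by (intro mult_left_mono) auto
    also have "\<dots> = c1 / sqrt p1 * (sqrt V * sqrt (E x x))" by (simp add: real_sqrt_divide)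
    also have "\<dots> \<le> c * (sqrt V * sqrt (E x x))"
      using c2 p1 nn Enn[of x] by (intro mult_right_mono) (auto simp: c_def)
    finally have S1: "c1 * sqrt V * s \<le> c * sqrt V * sqrt (E x x)" by (simp add: mult.assoc)
    have "w x (F x + B v) + w (F x + B v) x = 2 * (x \<bullet> (P *v (F x + B v)))
        - (\<psi> (F x + B v) x + \<psi> x (F x + B v)) + (K1 * E x (F x + B v) + K1 * E (F x + B v) x)"
      using P_comm[of x "F x + B v"] by (simp add: w_def)
    then show ?thesis using c1(2)[of x v] Q1 E1 S1
      unfolding s_def[symmetric] V_def[symmetric] d_def[symmetric] by (simp add: algebra_simps)
  qed
  have z_rate: "2 * z (X x) (X (F x + B v)) \<le> - d * z (X x) (X x) + c * (x \<bullet> (P *v x) + D (x, v) (x, v) + E x x)" for x v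
  proof -
    have "z (X x) (X x) \<le> z2 * (norm (X x))\<^sup>2" using z2(2)[of "X x" "X x"] by (simp add: power2_eq_square)
    then have "d * z (X x) (X x) \<le> d * (z2 * (norm (X x))\<^sup>2)" using pos by (intro mult_left_mono) auto
    also have "\<dots> = a2 * (norm (X x))\<^sup>2" using z2 by (simp add: d_def)
    finally have 1: "- a2 * (norm (X x))\<^sup>2 \<le> - d * z (X x) (X x)" by simp
    have "c2 * Q (x, v) (x, v) \<le> c2 * (x \<bullet> (P *v x) + D (x, v) (x, v)) + c2 * (E x x / p1)"
    proof -
      have "c2 * (norm (\<tau> x))\<^sup>2 \<le> c2 * (E x x / p1)" using s2[of x] c2(1) by (intro mult_left_mono) auto
      then show ?thesis by (simp add: Q_def power2_norm_eq_inner distrib_left)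
    qed
    also have "c2 * (E x x / p1) = (c2 / p1) * E x x" by simp
    also have "(c2 / p1) * E x x \<le> c * E x x"
      using c1 c2 p1 Enn[of x] by (intro mult_right_mono) (auto simp: c_def)
    also have "c2 * (x \<bullet> (P *v x) + D (x, v) (x, v)) \<le> c * (x \<bullet> (P *v x) + D (x, v) (x, v))"
      using c1 c2 p1 P_nonneg[of x] D_nonneg[of "(x, v)"] by (intro mult_right_mono) (auto simp: c_def)
    finally have "c2 * Q (x, v) (x, v) \<le> c * (x \<bullet> (P *v x) + D (x, v) (x, v) + E x x)" by (simp add: distrib_left)
    then show ?thesis using c2(2)[of x v] 1 by linarith
  qed
  define u where "u x y = w x y + z (X x) (X y) + E x y" for x y
  have u: "bilinear u"
    unfolding u_def bilinear_def
    by (auto intro!: linearI simp: linear_rules[OF X] bilinear_rules[OF w] bilinear_rules[OF E]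
        bilinear_rules[OF z(1)] algebra_simps)
  obtain b where b: "b > 0" "\<And>x y. u x y \<le> b * norm x * norm y"
    by (rule bilinear_abs_bound[OF u]) blast
  obtain M where M: "M > 0"
    "\<And>T V D E W Z E' W' Z'. 0 \<le> T \<Longrightarrow> coupled_decay a c d T V D E W Z E' W' Z' \<Longrightarrow>
      Z T + V T + E T \<le> M * (W 0 + Z 0 + E 0)"
    using coupled_decay_bound[OF pos] by blast
  define K where "K = (2 / z1 + 2 * c5) * M * (b + 1)"
  show ?thesis
  proof (intro exI[of _ K] conjI allI impI)
    show "K > 0" using z1 c5 M b by (auto simp: K_def intro!: mult_pos_pos add_pos_pos)
    fix T :: real and y :: "real \<Rightarrow> real^'m" and v :: "real \<Rightarrow> real^'n" and h h' :: "real \<Rightarrow> real"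
    assume T: "0 \<le> T"
      and all: "\<forall>t\<in>{0..T}. (y has_vector_derivative F (y t) + B (v t)) (at t within {0..T}) \<and>
        (h has_real_derivative h' t) (at t within {0..T}) \<and> 0 \<le> h t \<and> h' t \<le> G (y t) (v t)"
    have dy: "(y has_vector_derivative F (y t) + B (v t)) (at t within {0..T})"
      and dh: "(h has_real_derivative h' t) (at t within {0..T})"
      and h0: "0 \<le> h t" and h': "h' t \<le> G (y t) (v t)" if "t \<in> {0..T}" for t
      using all that by blast+
    define e where "e t = F (y t) + B (v t)" for t
    note dform = bilinear_form_derivative[OF _ _ dy, folded e_def]
    have "z (X (y T)) (X (y T)) + y T \<bullet> (P *v y T) + E (y T) (y T)
        \<le> M * ((w (y 0) (y 0) + h 0) + z (X (y 0)) (X (y 0)) + E (y 0) (y 0))"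
    proof (rule M(2)[OF T, of "\<lambda>t. y t \<bullet> (P *v y t)" "\<lambda>t. D (y t, v t) (y t, v t)" "\<lambda>t. E (y t) (y t)"
          "\<lambda>t. w (y t) (y t) + h t" "\<lambda>t. z (X (y t)) (X (y t))" "\<lambda>t. E (y t) (e t) + E (e t) (y t)"
          "\<lambda>t. w (y t) (e t) + w (e t) (y t) + h' t" "\<lambda>t. z (X (y t)) (X (e t)) + z (X (e t)) (X (y t))"],
        unfold coupled_decay_def, intro ballI conjI)
      fix t assume t: "t \<in> {0..T}"
      show "((\<lambda>t. E (y t) (y t)) has_real_derivative E (y t) (e t) + E (e t) (y t)) (at t within {0..T})"
        by (rule dform[OF E linear_id t, simplified])
      show "((\<lambda>t. w (y t) (y t) + h t) has_real_derivative w (y t) (e t) + w (e t) (y t) + h' t) (at t within {0..T})"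
        by (rule DERIV_add[OF dform[OF w linear_id t, simplified] dh[OF t]])
      show "((\<lambda>t. z (X (y t)) (X (y t))) has_real_derivative z (X (y t)) (X (e t)) + z (X (e t)) (X (y t))) (at t within {0..T})"
        by (rule dform[OF z(1) X t])
      have "z (X (y t)) (X (y t)) \<ge> 0"
        using z(3)[of "X (y t)"] bilinear_lzero[OF z(1), of 0] by (cases "X (y t) = 0") auto
      then show "0 \<le> z (X (y t)) (X (y t))" .
      show "0 \<le> y t \<bullet> (P *v y t)" "0 \<le> D (y t, v t) (y t, v t)" "0 \<le> E (y t) (y t)"
        by (rule P_nonneg D_nonneg Enn)+
      show "y t \<bullet> (P *v y t) \<le> 2 * (w (y t) (y t) + h t)" using w_lower[of "y t"] h0[OF t] by simp
      have "E (e t) (y t) = E (y t) (e t)" using P0_comm by (simp add: E_def)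
      then show "E (y t) (e t) + E (e t) (y t) \<le> - 2 * a * E (y t) (y t)"
        using E_rate[of "y t" "v t"] by (simp add: e_def)
      show "w (y t) (e t) + w (e t) (y t) + h' t
          \<le> - D (y t, v t) (y t, v t) / 2 + c * sqrt (y t \<bullet> (P *v y t)) * sqrt (E (y t) (y t))"
        using w_rate[of "y t" "v t"] h'[OF t] by (simp add: e_def)
      show "z (X (y t)) (X (e t)) + z (X (e t)) (X (y t)) \<le> - d * z (X (y t)) (X (y t))
          + c * (y t \<bullet> (P *v y t) + D (y t, v t) (y t, v t) + E (y t) (y t))"
        using z_rate[of "y t" "v t"] z(2)[of "X (e t)"] by (simp add: e_def)
    qed
    also have "(w (y 0) (y 0) + h 0) + z (X (y 0)) (X (y 0)) + E (y 0) (y 0) = u (y 0) (y 0) + h 0"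
      by (simp add: u_def)
    also have "M * (u (y 0) (y 0) + h 0) \<le> M * ((b + 1) * ((norm (y 0))\<^sup>2 + h 0))"
    proof (rule mult_left_mono)
      have "u (y 0) (y 0) \<le> b * (norm (y 0))\<^sup>2" using b(2)[of "y 0" "y 0"] by (simp add: power2_eq_square)
      moreover have "0 \<le> b * h 0" using b h0[of 0] T by simp
      moreover have "0 \<le> (norm (y 0))\<^sup>2" by simp
      ultimately have "u (y 0) (y 0) + h 0 \<le> b * (norm (y 0))\<^sup>2 + h 0 + (norm (y 0))\<^sup>2 + b * h 0"
        by linarith
      then show "u (y 0) (y 0) + h 0 \<le> (b + 1) * ((norm (y 0))\<^sup>2 + h 0)" by (simp add: algebra_simps)
    qed (use M in simp)
    finally have S: "z (X (y T)) (X (y T)) + y T \<bullet> (P *v y T) + E (y T) (y T)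
        \<le> M * ((b + 1) * ((norm (y 0))\<^sup>2 + h 0))" (is "?S \<le> _") .
    have "(norm (y T))\<^sup>2 \<le> 2 * (norm (X (y T)))\<^sup>2 + 2 * (norm (B (\<beta> (P *v y T))))\<^sup>2"
    proof -
      \<comment> \<open>The state is \<open>X y\<close> plus the correction
        \<open>B (\<beta> (P y))\<close>; the former is bounded through \<open>z\<close>, the latter
        by the stored energy, since it vanishes on the kernel of \<open>P\<close>.\<close>
      have "y T = X (y T) + B (\<beta> (P *v y T))" by (simp add: X_def)
      then have "norm (y T) \<le> norm (X (y T)) + norm (B (\<beta> (P *v y T)))" by (metis norm_triangle_ineq)
      then have "(norm (y T))\<^sup>2 \<le> (norm (X (y T)) + norm (B (\<beta> (P *v y T))))\<^sup>2" by (intro power_mono) auto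
      also have "\<dots> \<le> 2 * (norm (X (y T)))\<^sup>2 + 2 * (norm (B (\<beta> (P *v y T))))\<^sup>2"
        using sum_squares_bound[of "norm (X (y T))" "norm (B (\<beta> (P *v y T)))"] by (simp add: power2_sum)
      finally show ?thesis .
    qed
    also have "\<dots> \<le> 2 / z1 * z (X (y T)) (X (y T)) + 2 * c5 * (y T \<bullet> (P *v y T))"
      using z1(1) z1(2)[of "X (y T)"] c5(2)[of "y T"] by (intro add_mono) (auto simp: field_simps)
    also have "\<dots> \<le> (2 / z1 + 2 * c5) * ?S"
    proof -
      have n: "z (X (y T)) (X (y T)) \<ge> 0"
        using z1(1) order_trans[OF _ z1(2)[of "X (y T)"]] by simp
      have "2 / z1 * z (X (y T)) (X (y T)) \<le> 2 / z1 * ?S"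
        using z1 P_nonneg[of "y T"] Enn[of "y T"] by (intro mult_left_mono) auto
      moreover have "2 * c5 * (y T \<bullet> (P *v y T)) \<le> 2 * c5 * ?S"
        using c5 n Enn[of "y T"] by (intro mult_left_mono) auto
      ultimately show ?thesis by (simp add: distrib_right)
    qed
    also have "\<dots> \<le> (2 / z1 + 2 * c5) * (M * ((b + 1) * ((norm (y 0))\<^sup>2 + h 0)))"
      using S z1 c5 by (intro mult_left_mono) auto
    finally show "(norm (y T))\<^sup>2 \<le> K * ((norm (y 0))\<^sup>2 + h 0)" by (simp add: K_def mult.assoc)
  qed
qed

end

theorem (in popov_system) bounded_response:
  "\<exists>K>0. \<forall>T y v h h'. 0 \<le> T \<longrightarrow>
      (\<forall>t\<in>{0..T}. (y has_vector_derivative F (y t) + B (v t)) (at t within {0..T}) \<and>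
        (h has_real_derivative h' t) (at t within {0..T}) \<and> 0 \<le> h t \<and> h' t \<le> G (y t) (v t)) \<longrightarrow>
      (norm (y T))\<^sup>2 \<le> K * ((norm (y 0))\<^sup>2 + h 0)"
proof -
  obtain \<pi> where \<pi>: "linear \<pi>" "\<And>x. \<pi> x \<in> reachable" "\<And>x. x \<in> reachable \<Longrightarrow> \<pi> x = x"
    "\<And>x y. y \<in> reachable \<Longrightarrow> y \<bullet> (P0 *v (x - \<pi> x)) = 0"
    by (rule orthogonal_projection_wrt_form[OF subspace_reachable P0_pos]) blast+
  obtain P where P: "transpose P = P" "\<And>x. P *v \<pi> x = P *v x"
    "\<And>x v. G (\<pi> x) v + 2 * (x \<bullet> (P *v (F (\<pi> x) + B v))) \<le> 0"
    by (rule storage_exists[OF \<pi>(1,2,3)]) blast+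
  interpret popov_storage F B C \<sigma> \<theta> \<delta> \<rho> \<kappa> P0 \<pi> P
    by (rule popov_storage.intro[OF popov_system_axioms
          popov_storage_axioms.intro[OF \<pi> P storage_nonneg[OF \<pi>(1,2,3) P]]])
  show ?thesis by (rule storage_bounded_response)
qed

section \<open>Complex matrices and transfer functions\<close>

definition cvec :: "real^'n \<Rightarrow> real^'n \<Rightarrow> complex^'n" where
  "cvec x y = (\<chi> i. Complex (x $ i) (y $ i))"

definition cdot :: "complex^'n \<Rightarrow> complex^'n \<Rightarrow> complex" where
  "cdot a b = (\<Sum>i\<in>UNIV. cnj (a $ i) * b $ i)"

lemma cvec_cases:
  obtains x y where "a = cvec x y"
  by (rule that[of "\<chi> i. Re (a $ i)" "\<chi> i. Im (a $ i)"]) (simp add: cvec_def vec_eq_iff)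

lemma cvec_eq_iff: "cvec x y = cvec x' y' \<longleftrightarrow> x = x' \<and> y = y'"
  by (auto simp: cvec_def vec_eq_iff)

lemma cvec_eq_0_iff: "cvec x y = 0 \<longleftrightarrow> x = 0 \<and> y = 0"
  by (auto simp: cvec_def vec_eq_iff complex_eq_iff)

lemma cvec_add: "cvec x y + cvec x' y' = cvec (x + x') (y + y')"
  by (simp add: cvec_def vec_eq_iff complex_eq_iff)

lemma cvec_scale: "s *s cvec x y = cvec (Re s *\<^sub>R x - Im s *\<^sub>R y) (Im s *\<^sub>R x + Re s *\<^sub>R y)"
  by (simp add: cvec_def vec_eq_iff complex_eq_iff)

lemma complexify_mult_cvec: "complexify M *v cvec x y = cvec (M *v x) (M *v y)"
  by (simp add: cvec_def vec_eq_iff matrix_vector_mult_def complex_eq_iff)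

lemma cdot_cvec: "cdot (cvec x y) (cvec x' y') = Complex (x \<bullet> x' + y \<bullet> y') (x \<bullet> y' - y \<bullet> x')"
  by (simp add: cdot_def cvec_def complex_eq_iff inner_vec_def sum.distrib sum_subtractf)

lemma cdot_simps:
  "cdot a (b + c) = cdot a b + cdot a c" "cdot a (b - c) = cdot a b - cdot a c" "cdot a (s *s b) = s * cdot a b"
  by (simp_all add: cdot_def algebra_simps sum.distrib sum_subtractf sum_distrib_left)

lemma cnj_cdot: "cnj (cdot a b) = cdot b a"
  by (simp add: cdot_def mult.commute)

lemma cdot_conj_transpose: "cdot a (conj_transpose M *v b) = cdot (M *v a) b"
  by (simp add: cdot_def conj_transpose_def matrix_vector_mult_def transpose_def sum_distrib_left
      sum_distrib_right mult_ac) (rule sum.swap)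

lemma hform_cdot: "hform M v = cdot v (M *v v)"
  by (simp add: hform_def cdot_def matrix_vector_mult_def sum_distrib_left mult_ac)

lemma cscale_mult_vec: "(s *\<^sub>C M) *v v = s *s (M *v v)"
  by (simp add: cscale_def matrix_vector_mult_def vec_eq_iff sum_distrib_left mult_ac)

lemma mat_mult_vec: "mat s *v v = s *s v" for v :: "complex^'n"
  by (simp add: mat_def matrix_vector_mult_def vec_eq_iff if_distrib[of "\<lambda>x. x * _"] cong: if_cong)

lemma hform_re_part: "Re (hform (re_part N) v) = Re (cdot v (N *v v))"
proof -
  have "cdot v (conj_transpose N *v v) = cnj (cdot v (N *v v))"
    by (simp add: cdot_conj_transpose cnj_cdot)
  then show ?thesis
    by (simp add: hform_cdot re_part_def cscale_mult_vec matrix_vector_mult_add_rdistrib cdot_simps)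
qed

section \<open>Resolvents and transfer functions\<close>

lemma eigenvalue_iff_det: "is_eigenvalue M s \<longleftrightarrow> det (M - mat s) = 0"
proof -
  have "is_eigenvalue M s \<longleftrightarrow> (\<exists>v. v \<noteq> 0 \<and> (M - mat s) *v v = 0)"
    by (simp add: is_eigenvalue_def matrix_vector_mult_diff_rdistrib mat_mult_vec)
  also have "\<dots> \<longleftrightarrow> \<not> invertible (M - mat s)"
    by (auto simp: invertible_left_inverse matrix_left_invertible_ker)
  finally show ?thesis by (simp add: invertible_det_nz)
qed

lemma resolvent_invertible:
  assumes "det (M - mat s) \<noteq> 0"
  shows "invertible (mat s - M :: complex^'m^'m)"
proof -
  have "v = 0" if "(mat s - M) *v v = 0" for v
  proof -
    have "(M - mat s) *v v = 0" using that by (simp add: matrix_vector_mult_diff_rdistrib)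
    moreover have "invertible (M - mat s)" using assms by (simp add: invertible_det_nz)
    ultimately show ?thesis by (metis invertible_left_inverse matrix_left_invertible_ker)
  qed
  then show ?thesis by (auto simp: invertible_left_inverse matrix_left_invertible_ker)
qed

lemma matrix_inv_left:
  assumes "invertible M"
  shows "matrix_inv M ** M = mat 1"
proof -
  have "M ** matrix_inv M = mat 1 \<and> matrix_inv M ** M = mat 1"
    unfolding matrix_inv_def using assms unfolding invertible_def by (rule someI_ex)
  then show ?thesis by simp
qed

lemma transfer_mult_vec:
  assumes inv: "det (complexify A - mat s) \<noteq> 0"
    and eq: "complexify A *v x + complexify B *v v = s *s x"
  shows "transfer A B C s *v v = complexify C *v x"
proof -
  have "complexify B *v v = (mat s - complexify A) *v x"
    using eq by (simp add: matrix_vector_mult_diff_rdistrib mat_mult_vec algebra_simps)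
  then have "matrix_inv (mat s - complexify A) *v (complexify B *v v) = x"
    using matrix_inv_left[OF resolvent_invertible[OF inv]] by (simp add: matrix_vector_mul_assoc)
  then show ?thesis by (simp add: transfer_def flip: matrix_vector_mul_assoc)
qed

text \<open>By the Leibniz formula the determinant is a polynomial in \<open>s\<close>, and
  \<open>nz\<close> makes it nonzero.\<close>

lemma finite_det_zeros:
  fixes M :: "complex^'m^'m"
  assumes nz: "det (M - mat s0) \<noteq> 0"
  shows "finite {s. det (M - mat s) = 0}"
proof -
  define p where "p = (\<Sum>\<sigma> | \<sigma> permutes (UNIV :: 'm set). of_int (sign \<sigma>) *
      (\<Prod>i\<in>UNIV. [: M $ i $ \<sigma> i, - (if i = \<sigma> i then 1 else 0) :]))"
  have p: "poly p s = det (M - mat s)" for s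
  proof -
    have "poly [: M $ i $ j, - (if i = j then 1 else 0) :] s = (M - mat s) $ i $ j" for i j
      by (simp add: mat_def)
    then show ?thesis unfolding p_def det_def poly_sum poly_mult poly_prod by simp
  qed
  then have "p \<noteq> 0" using nz by (metis poly_0)
  then show ?thesis using poly_roots_finite[of p] by (simp add: p)
qed

text \<open>\<open>s - A\<close> maps the complexification of \<open>S\<close> injectively into
  itself, hence onto it; so the resolvent applied to \<open>b\<close> does not leave the invariant
  subspace.\<close>

lemma invariant_resolvent:
  fixes A :: "real^'m^'m"
  assumes S: "subspace S" and inv: "\<And>x. x \<in> S \<Longrightarrow> A *v x \<in> S" and b: "b \<in> S"
    and ne: "\<not> is_eigenvalue (complexify A) s"
  obtains x y where "x \<in> S" "y \<in> S" "complexify A *v cvec x y + cvec b 0 = s *s cvec x y"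
proof -
  define T where "T p = (Re s *\<^sub>R fst p - Im s *\<^sub>R snd p - A *v fst p, Im s *\<^sub>R fst p + Re s *\<^sub>R snd p - A *v snd p)" for p
  have T: "linear T"
    unfolding T_def
    by (auto intro!: linearI simp: matrix_vector_right_distrib matrix_vector_mult_scaleR algebra_simps)
  have SS: "subspace (S \<times> S)" using S by (rule subspace_Times[OF _ S])
  have TS: "T ` (S \<times> S) \<subseteq> S \<times> S"
  proof safe
    fix x y u w assume xy: "x \<in> S" "y \<in> S" and uw: "(u, w) = T (x, y)"
    show "u \<in> S" "w \<in> S"
      using uw xy by (simp_all add: T_def S inv subspace_add subspace_diff subspace_scale)
  qed
  have Tc: "T (x, y) = (u, w) \<longleftrightarrow> s *s cvec x y = cvec u w + complexify A *v cvec x y" for x y u w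
    by (simp add: T_def complexify_mult_cvec cvec_add cvec_scale cvec_eq_iff diff_eq_eq)
  have "inj_on T (S \<times> S)"
  proof (rule linear_inj_on_iff_eq_0[OF T SS, THEN iffD2], safe)
    fix x y assume "T (x, y) = 0"
    then have "complexify A *v cvec x y = s *s cvec x y"
      using Tc[of x y 0 0] cvec_eq_0_iff[of "0::real^'m" 0] by (simp add: zero_prod_def)
    then have "cvec x y = 0" using ne unfolding is_eigenvalue_def by blast
    then show "(x, y) = 0" by (simp add: cvec_eq_0_iff zero_prod_def)
  qed
  then have "dim (T ` (S \<times> S)) = dim (S \<times> S)" using T SS by (intro dim_image_eq) (metis span_eq_iff)+
  then have "T ` (S \<times> S) = S \<times> S"
    using TS SS linear_subspace_image[OF T SS] by (intro subspace_dim_equal) auto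
  moreover have "(b, 0) \<in> S \<times> S" using b S by (simp add: subspace_0)
  ultimately have "(b, 0) \<in> T ` (S \<times> S)" by simp
  then obtain x y where xy: "(b, 0) = T (x, y)" "x \<in> S" "y \<in> S" by (elim imageE SigmaE) simp
  then have "s *s cvec x y = cvec b 0 + complexify A *v cvec x y" by (intro Tc[THEN iffD1]) simp
  then have "complexify A *v cvec x y + cvec b 0 = s *s cvec x y" by (simp only: add.commute)
  with xy(2,3) show ?thesis by (rule that)
qed

section \<open>From the frequency inequality to hyperstability\<close>

text \<open>In complex notation this bounds the inverse of \<open>\<i> \<omega> - H\<close>
  uniformly in \<omega>. The Lyapunov form cannot see \<omega>, because
  \<open>\<i> \<omega> P\<close> contributes nothing to the real part of its quadratic form;
  coercivity therefore gives one constant for all frequencies, and injectivity gives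
  solvability.\<close>

lemma lyapunov_resolvent:
  fixes H :: "real^'m \<Rightarrow> real^'m"
  assumes H: "linear H" and sym: "transpose P = P" and neg: "\<And>x. x \<noteq> 0 \<Longrightarrow> x \<bullet> (P *v H x) < 0"
  obtains c where "c > 0" "\<And>\<omega> x y. norm (x, y) \<le> c * norm (- \<omega> *\<^sub>R y - H x, \<omega> *\<^sub>R x - H y)"
    "\<And>\<omega> p q. \<exists>x y. - \<omega> *\<^sub>R y - H x = p \<and> \<omega> *\<^sub>R x - H y = q"
proof -
  have comm: "x \<bullet> (P *v y) = y \<bullet> (P *v x)" for x y using inner_transpose_mult[of x P y] sym by simp
  define b where "b p q = - (fst p \<bullet> (P *v H (fst q)) + fst q \<bullet> (P *v H (fst p)))
      - (snd p \<bullet> (P *v H (snd q)) + snd q \<bullet> (P *v H (snd p)))" for p q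
  have b: "bilinear b"
    unfolding bilinear_def b_def
    by (auto intro!: linearI simp: linear_rules[OF H] form_rules algebra_simps)
  have "b p p > 0" if "p \<noteq> 0" for p
  proof -
    have le: "x \<bullet> (P *v H x) \<le> 0" for x using neg[of x] by (cases "x = 0") auto
    have "fst p \<noteq> 0 \<or> snd p \<noteq> 0" using that by (auto simp: prod_eq_iff)
    then show ?thesis using neg[of "fst p"] neg[of "snd p"] le[of "fst p"] le[of "snd p"] by (auto simp: b_def)
  qed
  then obtain c0 where c0: "c0 > 0" "\<And>p. c0 * (norm p)\<^sup>2 \<le> b p p"
    using positive_form_coercive[OF b] by (metis (no_types, lifting) add.commute b_def)
  define e where "e p q = fst p \<bullet> (P *v fst q) + snd p \<bullet> (P *v snd q)" for p q
  have e: "bilinear e"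
    unfolding bilinear_def e_def
    by (auto intro!: linearI simp: form_rules algebra_simps)
  obtain M where M: "M > 0" "\<And>p q. e p q \<le> M * norm p * norm q" by (rule bilinear_abs_bound[OF e]) blast
  define T where "T \<omega> p = (- \<omega> *\<^sub>R snd p - H (fst p), \<omega> *\<^sub>R fst p - H (snd p))" for \<omega> p
  have T: "linear (T \<omega>)" for \<omega>
    unfolding T_def by (auto intro!: linearI simp: linear_rules[OF H] algebra_simps)
  have bound: "norm p \<le> 2 * M / c0 * norm (T \<omega> p)" for \<omega> p
  proof (cases "p = 0")
    case False
    have "b p p = 2 * e p (T \<omega> p)"
      using comm[of "fst p" "snd p"]
      by (simp add: b_def e_def T_def matrix_vector_mult_diff_distrib matrix_vector_mult_scaleR inner_diff_right
          vec.neg inner_minus_right algebra_simps)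
    then have "c0 * (norm p)\<^sup>2 \<le> 2 * (M * norm p * norm (T \<omega> p))" using c0(2)[of p] M(2)[of p "T \<omega> p"] by simp
    then have "norm p * (c0 * norm p) \<le> norm p * (2 * M * norm (T \<omega> p))" by (simp add: power2_eq_square mult_ac)
    then have "c0 * norm p \<le> 2 * M * norm (T \<omega> p)" using False by simp
    then show ?thesis using c0(1) by (simp add: field_simps)
  qed (use M c0 in simp)
  have "inj (T \<omega>)" for \<omega>
  proof (rule linear_injective_0[OF T, THEN iffD2], intro allI impI)
    fix p assume "T \<omega> p = 0"
    then show "p = 0" using bound[of p \<omega>] by simp
  qed
  then have "surj (T \<omega>)" for \<omega> by (intro linear_injective_imp_surjective T refl)
  then have "\<exists>z. T \<omega> z = (p, q)" for \<omega> p q by (metis surjD)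
  then have "\<exists>x y. - \<omega> *\<^sub>R y - H x = p \<and> \<omega> *\<^sub>R x - H y = q" for \<omega> p q by (force simp: T_def)
  moreover have "norm (x, y) \<le> 2 * M / c0 * norm (- \<omega> *\<^sub>R y - H x, \<omega> *\<^sub>R x - H y)" for \<omega> x y
    using bound[of "(x, y)" \<omega>] by (simp add: T_def)
  moreover have "2 * M / c0 > 0" using M c0 by simp
  ultimately show ?thesis using that by blast
qed

lemma cdot_zero: "cdot a 0 = 0"
  by (simp add: cdot_def)

locale lure_system =
  fixes A :: "real^'m^'m" and B :: "real^'n^'m" and C :: "real^'m^'n"
    and r :: real and L :: ereal and lam \<mu> \<nu> :: real
  assumes r: "r > 0" and L: "L > 0" and lam: "lam \<ge> 0" and \<mu>: "\<mu> \<ge> 0" and \<nu>: "\<nu> \<ge> 0"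
    and hurwitz_gain: "\<exists>k::real. 0 \<le> k \<and> ereal k \<le> L \<and> hurwitz (A + k *\<^sub>R (B ** C) + mat r)"
    and Phi_nonsingular: "\<exists>\<eta> \<zeta>. \<not> is_eigenvalue (complexify A) \<eta> \<and> \<not> is_eigenvalue (complexify A) \<zeta> \<and>
           det (Phi A B C r L lam \<mu> \<nu> \<eta> \<zeta>) \<noteq> 0"
    and \<mu>_infinity: "L = \<infinity> \<Longrightarrow> \<mu> = 0"
    and frequency: "\<And>(\<omega>::real) (s::complex). s = \<i> * of_real \<omega> - of_real r \<Longrightarrow>
           det (complexify A - mat s) \<noteq> 0 \<Longrightarrow>
           hermitian_le
             (re_part ((of_real lam + of_real \<mu> * s
                          + of_real \<nu> * (\<i> * of_real \<omega> + of_real r)) *\<^sub>C transfer A B C s)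
              + of_real (\<mu> * real_of_ereal L * r)
                  *\<^sub>C (conj_transpose (transfer A B C s) ** transfer A B C s))
             (mat (of_real (lam * real_of_ereal (inverse L))))"
begin

abbreviation Linv :: real where "Linv \<equiv> real_of_ereal (inverse L)"
abbreviation Lr :: real where "Lr \<equiv> real_of_ereal L"
abbreviation F :: "real^'m \<Rightarrow> real^'m" where "F x \<equiv> A *v x + r *\<^sub>R x"

sublocale popov_form F "(*v) B" "(*v) C" "\<mu> + \<nu>" "lam - \<mu> * r + \<nu> * r" "lam * Linv" "\<mu> * Lr * r"
  by unfold_locales
    (auto simp: matrix_vector_right_distrib matrix_vector_mult_scaleR algebra_simps)

lemma L_cases:
  obtains "L = \<infinity>" "Linv = 0" "Lr = 0" "\<mu> = 0" | l where "L = ereal l" "l > 0" "Linv = 1 / l" "Lr = l"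
proof (cases L)
  case (real l)
  then show ?thesis using L that(2)[of l] by (simp add: inverse_eq_divide)
next
  case PInf
  then show ?thesis using that(1) \<mu>_infinity by simp
qed (use L in simp)

lemma Linv_nonneg: "Linv \<ge> 0" and Lr_nonneg: "Lr \<ge> 0"
  by (cases rule: L_cases; simp)+

lemma multipliers_nonzero: "lam > 0 \<or> \<mu> > 0 \<or> \<nu> > 0"
proof (rule ccontr)
  assume "\<not> ?thesis"
  then have "lam = 0" "\<mu> = 0" "\<nu> = 0" using lam \<mu> \<nu> by auto
  then have "Phi A B C r L lam \<mu> \<nu> \<eta> \<zeta> *v x = 0" for \<eta> \<zeta> x
    by (simp add: Phi_def matrix_vector_mult_add_rdistrib matrix_vector_mult_diff_rdistrib cscale_mult_vec mat_mult_vec)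
  then have "det (Phi A B C r L lam \<mu> \<nu> \<eta> \<zeta>) = 0" for \<eta> \<zeta>
    by (metis eigenvalue_iff_det[of _ 0] axis_eq_0_iff is_eigenvalue_def mat_0 diff_zero vector_smult_lzero zero_neq_one)
  then show False using Phi_nonsingular by blast
qed

text \<open>The two equations say that \<open>x + \<i> y\<close> is the response at
  \<open>s = \<i> \<omega> - r\<close> to the input \<open>v + \<i> u\<close>. The multiplier
  \<open>c\<close> equals \<open>\<theta> + \<i> \<sigma> \<omega>\<close>, so multiplying the
  output by it replaces \<open>\<i> \<omega> C x\<close> by the output of the derivative, as in
  \<open>G\<close>.\<close>

lemma frequency_regular:
  assumes det: "det (complexify A - mat (\<i> * of_real \<omega> - of_real r)) \<noteq> 0"
    and x: "F x + B *v v = - \<omega> *\<^sub>R y" and y: "F y + B *v u = \<omega> *\<^sub>R x"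
  shows "G x v + G y u \<le> 0"
proof -
  define s where "s = \<i> * of_real \<omega> - complex_of_real r"
  define c where "c = of_real lam + of_real \<mu> * s + of_real \<nu> * (\<i> * of_real \<omega> + of_real r)"
  have "A *v x + B *v v = - r *\<^sub>R x - \<omega> *\<^sub>R y" "A *v y + B *v u = \<omega> *\<^sub>R x - r *\<^sub>R y"
    using arg_cong[OF x, of "\<lambda>w. w - r *\<^sub>R x"] arg_cong[OF y, of "\<lambda>w. w - r *\<^sub>R y"] by simp_all
  then have "complexify A *v cvec x y + complexify B *v cvec v u = s *s cvec x y"
    by (simp add: complexify_mult_cvec cvec_add cvec_scale cvec_eq_iff s_def)
  then have "transfer A B C s *v cvec v u = complexify C *v cvec x y"
    using det unfolding s_def by (intro transfer_mult_vec)
  then have H: "transfer A B C s *v cvec v u = cvec (C *v x) (C *v y)"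
    by (simp only: complexify_mult_cvec)
  have "Re (hform (re_part (c *\<^sub>C transfer A B C s) + of_real (\<mu> * Lr * r) *\<^sub>C (conj_transpose (transfer A B C s) ** transfer A B C s)) (cvec v u))
      \<le> Re (hform (mat (of_real (lam * Linv))) (cvec v u))"
    using frequency[of s \<omega>] det unfolding hermitian_le_def c_def s_def by blast
  moreover have "hform (mat (of_real (lam * Linv))) (cvec v u) = of_real (lam * Linv) * cdot (cvec v u) (cvec v u)"
    by (simp add: hform_cdot mat_mult_vec cdot_simps)
  moreover have "hform (M + N) w = hform M w + hform N w" for M N :: "complex^'n^'n" and w
    by (simp add: hform_cdot matrix_vector_mult_add_rdistrib cdot_simps)
  moreover have "hform (of_real (\<mu> * Lr * r) *\<^sub>C (conj_transpose (transfer A B C s) ** transfer A B C s)) (cvec v u)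
      = of_real (\<mu> * Lr * r) * cdot (cvec (C *v x) (C *v y)) (cvec (C *v x) (C *v y))"
    by (simp add: hform_cdot cscale_mult_vec cdot_simps cdot_conj_transpose H flip: matrix_vector_mul_assoc)
  moreover have "Re (hform (re_part (c *\<^sub>C transfer A B C s)) (cvec v u)) = Re (cdot (cvec v u) (c *s cvec (C *v x) (C *v y)))"
    by (simp add: hform_re_part cscale_mult_vec H)
  ultimately have ineq: "Re (cdot (cvec v u) (c *s cvec (C *v x) (C *v y)))
      + \<mu> * Lr * r * ((C *v x) \<bullet> (C *v x) + (C *v y) \<bullet> (C *v y)) \<le> lam * Linv * (v \<bullet> v + u \<bullet> u)"
    by (simp add: cdot_cvec)
  have "C *v (F x + B *v v) = - \<omega> *\<^sub>R (C *v y)" "C *v (F y + B *v u) = \<omega> *\<^sub>R (C *v x)"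
    unfolding x y by (simp_all add: matrix_vector_mult_scaleR vec.neg)
  then have CB: "C *v (B *v v) = - \<omega> *\<^sub>R (C *v y) - C *v F x" "C *v (B *v u) = \<omega> *\<^sub>R (C *v x) - C *v F y"
    by (simp_all add: matrix_vector_right_distrib algebra_simps)
  have "Re c = lam - \<mu> * r + \<nu> * r" "Im c = (\<mu> + \<nu>) * \<omega>" by (simp_all add: c_def s_def algebra_simps)
  then have "c *s cvec (C *v x) (C *v y) = cvec (\<Gamma> x + (\<mu> + \<nu>) *\<^sub>R (C *v (B *v v))) (\<Gamma> y + (\<mu> + \<nu>) *\<^sub>R (C *v (B *v u)))"
    unfolding cvec_scale CB \<Gamma>_def by (simp add: cvec_eq_iff scaleR_right_diff_distrib)
  then have "Re (cdot (cvec v u) (c *s cvec (C *v x) (C *v y)))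
      = v \<bullet> \<Gamma> x + (\<mu> + \<nu>) * (v \<bullet> (C *v (B *v v))) + (u \<bullet> \<Gamma> y + (\<mu> + \<nu>) * (u \<bullet> (C *v (B *v u))))"
    by (simp add: cdot_cvec inner_add_right)
  then show ?thesis using ineq unfolding G_def by (simp add: algebra_simps)
qed

lemma finite_irregular: "finite {\<omega>::real. det (complexify A - mat (\<i> * of_real \<omega> - of_real r)) = 0}"
proof -
  obtain \<eta> where "det (complexify A - mat \<eta>) \<noteq> 0" using Phi_nonsingular eigenvalue_iff_det by blast
  then have "finite {s. det (complexify A - mat s) = 0}" by (rule finite_det_zeros)
  moreover have "inj (\<lambda>\<omega>::real. \<i> * of_real \<omega> - complex_of_real r)" by (auto simp: inj_def)
  ultimately have "finite ((\<lambda>\<omega>::real. \<i> * of_real \<omega> - complex_of_real r) -` {s. det (complexify A - mat s) = 0})"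
    by (intro finite_vimageI)
  then show ?thesis by (simp add: vimage_def)
qed

text \<open>The inequality is closed, so it survives limits of solutions. It is used with the filter
  at an exceptional frequency and with the one at infinity.\<close>

lemma frequency_limit:
  assumes bot: "T \<noteq> bot" and reg: "\<forall>\<^sub>F \<omega> in T. det (complexify A - mat (\<i> * of_real \<omega> - of_real r)) \<noteq> 0"
    and X: "(X \<longlongrightarrow> x) T" and Y: "(Y \<longlongrightarrow> y) T" and V: "(V \<longlongrightarrow> v) T" and U: "(U \<longlongrightarrow> u) T"
    and eq: "\<And>\<omega>. F (X \<omega>) + B *v V \<omega> = - \<omega> *\<^sub>R Y \<omega>" "\<And>\<omega>. F (Y \<omega>) + B *v U \<omega> = \<omega> *\<^sub>R X \<omega>"
  shows "G x v + G y u \<le> 0"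
proof (rule tendsto_upperbound[OF _ _ bot])
  show "((\<lambda>\<omega>. G (X \<omega>) (V \<omega>) + G (Y \<omega>) (U \<omega>)) \<longlongrightarrow> G x v + G y u) T"
    unfolding G_def \<Gamma>_def
    by (intro tendsto_intros bounded_linear.tendsto[OF matrix_vector_mul_bounded_linear] X Y V U)
  show "\<forall>\<^sub>F \<omega> in T. G (X \<omega>) (V \<omega>) + G (Y \<omega>) (U \<omega>) \<le> 0"
    using reg by eventually_elim (rule frequency_regular[OF _ eq])
qed

lemma stable_feedback:
  obtains \<kappa> P0 where "0 \<le> \<kappa>" "\<kappa> > 0 \<Longrightarrow> ereal \<kappa> < L" "transpose P0 = P0"
    "\<And>x. x \<noteq> 0 \<Longrightarrow> 0 < x \<bullet> (P0 *v x)"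
    "\<And>x. x \<noteq> 0 \<Longrightarrow> x \<bullet> (P0 *v (F x + \<kappa> *\<^sub>R (B *v (C *v x)))) < 0"
proof -
  obtain k :: real where k: "0 \<le> k" "ereal k \<le> L" "hurwitz (A + k *\<^sub>R (B ** C) + mat r)"
    using hurwitz_gain by blast
  define H where "H x = (A + k *\<^sub>R (B ** C) + mat r) *v x" for x
  have H: "linear H" unfolding H_def by simp
  have Heq: "H x = F x + k *\<^sub>R (B *v (C *v x))" for x
  proof -
    have "mat r *v x = r *\<^sub>R x"
      by (simp add: mat_def matrix_vector_mult_def vec_eq_iff if_distrib[of "\<lambda>x. x * _"] cong: if_cong)
    then show ?thesis
      by (simp add: H_def matrix_vector_mult_add_rdistrib matrix_vector_mul_assoc scaleR_matrix_vector_assoc[symmetric])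
  qed
  have "\<exists>P. transpose P = P \<and> (\<forall>x. x \<noteq> 0 \<longrightarrow> 0 < x \<bullet> (P *v x)) \<and> (\<forall>x. x \<noteq> 0 \<longrightarrow> x \<bullet> (P *v H x) < 0)"
  proof (rule lyapunov_matrix_exists[OF H])
    fix a c x y assume ne: "x \<noteq> 0 \<or> y \<noteq> 0" and eq: "H x = a *\<^sub>R x - c *\<^sub>R y" "H y = c *\<^sub>R x + a *\<^sub>R y"
    have "complexify (A + k *\<^sub>R (B ** C) + mat r) *v cvec x y = Complex a c *s cvec x y"
      using eq by (simp add: complexify_mult_cvec cvec_scale H_def)
    moreover have "cvec x y \<noteq> 0" using ne by (simp add: cvec_eq_0_iff)
    ultimately have "is_eigenvalue (complexify (A + k *\<^sub>R (B ** C) + mat r)) (Complex a c)"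
      unfolding is_eigenvalue_def by blast
    then have "Re (Complex a c) < 0" using k(3) unfolding hurwitz_def by blast
    then show "a < 0" by simp
  qed
  then obtain P where P: "transpose P = P" "\<And>x. x \<noteq> 0 \<Longrightarrow> 0 < x \<bullet> (P *v x)" "\<And>x. x \<noteq> 0 \<Longrightarrow> x \<bullet> (P *v H x) < 0"
    by blast
  have bil: "bilinear (\<lambda>x y. - (x \<bullet> (P *v H y) + y \<bullet> (P *v H x)))"
    unfolding bilinear_def
    by (auto intro!: linearI simp: linear_rules[OF H] form_rules algebra_simps)
  obtain c where c: "c > 0" "\<And>x. c * (norm x)\<^sup>2 \<le> - (x \<bullet> (P *v H x) + x \<bullet> (P *v H x))"
    by (rule positive_form_coercive[OF bil]) (use P(3) in \<open>auto simp: add.commute intro: add_neg_neg\<close>)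
  have bil2: "bilinear (\<lambda>x y. - (x \<bullet> (P *v (B *v (C *v y)))))"
    unfolding bilinear_def
    by (auto intro!: linearI simp: form_rules algebra_simps)
  obtain m where m: "m > 0" "\<And>x y. - (x \<bullet> (P *v (B *v (C *v y)))) \<le> m * norm x * norm y"
    by (rule bilinear_abs_bound[OF bil2]) blast
  \<comment> \<open>The gain is lowered slightly, as the strict inequality \<open>k < L\<close> is needed for dissipation.\<close>
  define d where "d = min k (c / (4 * m))"
  have d: "0 \<le> d" "d \<le> k" "d * m \<le> c / 4" using k c m by (auto simp: d_def min_def field_simps)
  show ?thesis
  proof (rule that[of "k - d" P])
    show "0 \<le> k - d" using d by simp
    show "ereal (k - d) < L" if "0 < k - d"
    proof -
      have "d > 0" using that c m by (auto simp: d_def min_def)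
      then have "ereal (k - d) < ereal k" by simp
      then show ?thesis using k(2) by (rule less_le_trans)
    qed
    fix x :: "real^'m" assume x: "x \<noteq> 0"
    have "x \<bullet> (P *v (F x + (k - d) *\<^sub>R (B *v (C *v x)))) = x \<bullet> (P *v H x) + d * (- (x \<bullet> (P *v (B *v (C *v x)))))"
      unfolding Heq by (simp add: matrix_vector_right_distrib matrix_vector_mult_scaleR inner_add_right algebra_simps)
    also have "\<dots> \<le> - c / 2 * (norm x)\<^sup>2 + d * (m * norm x * norm x)"
      using c(2)[of x] m(2)[of x x] d(1) by (intro add_mono mult_left_mono) auto
    also have "\<dots> = (d * m - c / 2) * (norm x)\<^sup>2" by (simp add: power2_eq_square algebra_simps)
    also have "\<dots> < 0" using d c x by (intro mult_neg_pos) auto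
    finally show "x \<bullet> (P *v (F x + (k - d) *\<^sub>R (B *v (C *v x)))) < 0" .
  qed (use P in auto)
qed

text \<open>A nonzero \<open>v\<close> with these properties would satisfy
  \<open>\<Phi>(\<eta>, \<zeta>) v = 0\<close> at every regular pair: the response to
  \<open>v\<close> stays in \<open>N\<close>, where \<Gamma> and \<open>\<rho> C\<close> vanish, and
  the response to a test input \<open>u\<close> stays in \<open>reachable\<close>, where
  \<open>v\<close> annihilates \<Gamma>. Only the constant term survives, and \<open>vu\<close>
  cancels it.\<close>

lemma nondegenerate_inputs:
  assumes N: "subspace N" "\<And>x. x \<in> N \<Longrightarrow> F x \<in> N" "B *v v \<in> N"
    and \<Gamma>N: "\<And>x. x \<in> N \<Longrightarrow> \<Gamma> x = 0" and CN: "\<And>x. x \<in> N \<Longrightarrow> (\<mu> * Lr * r) *\<^sub>R (C *v x) = 0"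
    and \<Gamma>R: "\<And>x. x \<in> reachable \<Longrightarrow> v \<bullet> \<Gamma> x = 0"
    and vu: "\<And>u. (\<mu> + \<nu>) * (v \<bullet> (C *v (B *v u)) + u \<bullet> (C *v (B *v v))) = 2 * (lam * Linv) * (v \<bullet> u)"
  shows "v = 0"
proof (rule ccontr)
  assume v: "v \<noteq> 0"
  obtain \<eta> \<zeta> where ne: "\<not> is_eigenvalue (complexify A) \<eta>" "\<not> is_eigenvalue (complexify A) \<zeta>"
    and det: "det (Phi A B C r L lam \<mu> \<nu> \<eta> \<zeta>) \<noteq> 0" using Phi_nonsingular by blast
  define c where "c s = of_real lam + of_real \<mu> * s + of_real \<nu> * (s + 2 * of_real r)" for s :: complex
  \<comment> \<open>Multiplying the output by \<open>c s\<close> trades \<open>s x\<close> for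
    \<open>A x + B u\<close>, which turns it into \<Gamma> plus the direct term
    \<open>\<sigma> C B u\<close>.\<close>
  have multiplier: "\<exists>x\<in>S. \<exists>y\<in>S. transfer A B C s *v cvec u 0 = cvec (C *v x) (C *v y) \<and>
      c s *s cvec (C *v x) (C *v y) = cvec (\<Gamma> x + (\<mu> + \<nu>) *\<^sub>R (C *v (B *v u))) (\<Gamma> y)"
    if S: "subspace S" "\<And>x. x \<in> S \<Longrightarrow> F x \<in> S" "B *v u \<in> S" and ns: "\<not> is_eigenvalue (complexify A) s" for S u s
  proof -
    have "A *v x \<in> S" if "x \<in> S" for x
    proof -
      have "F x - r *\<^sub>R x \<in> S" using S that by (intro subspace_diff subspace_scale)
      then show ?thesis by simp
    qed
    then obtain x y where xy: "x \<in> S" "y \<in> S" and eq: "complexify A *v cvec x y + cvec (B *v u) 0 = s *s cvec x y"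
      using invariant_resolvent[OF S(1) _ S(3) ns] by blast
    have "complexify A *v cvec x y + complexify B *v cvec u 0 = s *s cvec x y"
      using eq by (simp add: complexify_mult_cvec)
    then have "transfer A B C s *v cvec u 0 = complexify C *v cvec x y"
      using ns unfolding eigenvalue_iff_det by (intro transfer_mult_vec)
    then have H: "transfer A B C s *v cvec u 0 = cvec (C *v x) (C *v y)"
      by (simp only: complexify_mult_cvec)
    have "A *v x + B *v u = Re s *\<^sub>R x - Im s *\<^sub>R y" "A *v y = Im s *\<^sub>R x + Re s *\<^sub>R y"
      using eq by (simp_all add: complexify_mult_cvec cvec_add cvec_scale cvec_eq_iff)
    then have "C *v (A *v x + B *v u) = C *v (Re s *\<^sub>R x - Im s *\<^sub>R y)" "C *v (A *v y) = C *v (Im s *\<^sub>R x + Re s *\<^sub>R y)"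
      by simp_all
    then have CA: "C *v (A *v x) = Re s *\<^sub>R (C *v x) - Im s *\<^sub>R (C *v y) - C *v (B *v u)"
        "C *v (A *v y) = Im s *\<^sub>R (C *v x) + Re s *\<^sub>R (C *v y)"
      by (simp_all add: matrix_vector_right_distrib matrix_vector_mult_diff_distrib matrix_vector_mult_scaleR algebra_simps)
    have \<Gamma>: "\<Gamma> x = (\<mu> + \<nu>) *\<^sub>R (C *v (A *v x)) + (lam + 2 * \<nu> * r) *\<^sub>R (C *v x)" for x
      unfolding \<Gamma>_def
      by (simp add: matrix_vector_right_distrib matrix_vector_mult_scaleR vec_eq_iff algebra_simps)
    have "c s *s cvec (C *v x) (C *v y) = cvec (\<Gamma> x + (\<mu> + \<nu>) *\<^sub>R (C *v (B *v u))) (\<Gamma> y)"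
      unfolding \<Gamma> cvec_scale cvec_eq_iff CA by (simp add: c_def vec_eq_iff algebra_simps)
    with H xy show ?thesis by blast
  qed
  obtain x y where xy: "x \<in> N" "y \<in> N" "transfer A B C \<zeta> *v cvec v 0 = cvec (C *v x) (C *v y)"
      "c \<zeta> *s cvec (C *v x) (C *v y) = cvec (\<Gamma> x + (\<mu> + \<nu>) *\<^sub>R (C *v (B *v v))) (\<Gamma> y)"
    using multiplier[OF N ne(2)] by blast
  have cross: "of_real (2 * \<mu> * r * Lr) *s cvec (C *v x) (C *v y) = 0"
  proof -
    have "2 *\<^sub>R ((\<mu> * Lr * r) *\<^sub>R (C *v x)) = 0" "2 *\<^sub>R ((\<mu> * Lr * r) *\<^sub>R (C *v y)) = 0"
      using CN[OF xy(1)] CN[OF xy(2)] by simp_all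
    then show ?thesis by (simp add: cvec_scale cvec_eq_0_iff mult_ac)
  qed
  have cdot0: "cdot (cvec u 0) (Phi A B C r L lam \<mu> \<nu> \<eta> \<zeta> *v cvec v 0) = 0" for u
  proof -
    have FR: "\<And>x. x \<in> reachable \<Longrightarrow> F x \<in> reachable" by (rule F_reachable)
    obtain p q where pq: "p \<in> reachable" "q \<in> reachable" "transfer A B C \<eta> *v cvec u 0 = cvec (C *v p) (C *v q)"
        "c \<eta> *s cvec (C *v p) (C *v q) = cvec (\<Gamma> p + (\<mu> + \<nu>) *\<^sub>R (C *v (B *v u))) (\<Gamma> q)"
      using multiplier[OF subspace_reachable FR B_reachable ne(1)] by blast
    have "cnj (c \<eta>) * cdot (cvec (C *v p) (C *v q)) (cvec v 0)
        = cnj (cdot (cvec v 0) (c \<eta> *s cvec (C *v p) (C *v q)))"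
      by (simp add: cdot_simps cnj_cdot)
    also have "\<dots> = of_real ((\<mu> + \<nu>) * (v \<bullet> (C *v (B *v u))))"
      unfolding pq(4) using \<Gamma>R[OF pq(1)] \<Gamma>R[OF pq(2)] by (simp add: cdot_cvec inner_add_right complex_eq_iff)
    finally have 1: "cnj (c \<eta>) * cdot (cvec (C *v p) (C *v q)) (cvec v 0) = of_real ((\<mu> + \<nu>) * (v \<bullet> (C *v (B *v u))))" .
    have 2: "cdot (cvec u 0) (c \<zeta> *s cvec (C *v x) (C *v y)) = of_real ((\<mu> + \<nu>) * (u \<bullet> (C *v (B *v v))))"
      unfolding xy(4) using \<Gamma>N[OF xy(1)] \<Gamma>N[OF xy(2)] by (simp add: cdot_cvec complex_eq_iff)
    have Phi: "Phi A B C r L lam \<mu> \<nu> \<eta> \<zeta> = cnj (c \<eta>) *\<^sub>C conj_transpose (transfer A B C \<eta>) + c \<zeta> *\<^sub>C transfer A B C \<zeta>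
        + of_real (2 * \<mu> * r * Lr) *\<^sub>C (conj_transpose (transfer A B C \<eta>) ** transfer A B C \<zeta>)
        - mat (of_real (2 * lam * Linv))"
      by (simp add: Phi_def c_def)
    have "cdot (cvec u 0) (Phi A B C r L lam \<mu> \<nu> \<eta> \<zeta> *v cvec v 0)
        = cnj (c \<eta>) * cdot (cvec (C *v p) (C *v q)) (cvec v 0) + cdot (cvec u 0) (c \<zeta> *s cvec (C *v x) (C *v y))
          + cdot (cvec (C *v p) (C *v q)) (of_real (2 * \<mu> * r * Lr) *s cvec (C *v x) (C *v y))
          - of_real (2 * lam * Linv) * cdot (cvec u 0) (cvec v 0)"
      unfolding Phi
      by (simp add: matrix_vector_mult_add_rdistrib matrix_vector_mult_diff_rdistrib cscale_mult_vec mat_mult_vec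
          cdot_simps cdot_conj_transpose xy(3) pq(3) del: of_real_mult flip: matrix_vector_mul_assoc)
    also have "\<dots> = of_real ((\<mu> + \<nu>) * (v \<bullet> (C *v (B *v u))) + (\<mu> + \<nu>) * (u \<bullet> (C *v (B *v v))) - 2 * (lam * Linv) * (v \<bullet> u))"
      unfolding 1 2 cross by (simp add: cdot_cvec complex_eq_iff cdot_zero inner_commute)
    also have "\<dots> = 0" using vu[of u] by (simp add: distrib_left)
    finally show ?thesis .
  qed
  have "Phi A B C r L lam \<mu> \<nu> \<eta> \<zeta> *v cvec v 0 = 0"
  proof -
    obtain a b where ab: "Phi A B C r L lam \<mu> \<nu> \<eta> \<zeta> *v cvec v 0 = cvec a b" by (rule cvec_cases)
    have "u \<bullet> a = 0" "u \<bullet> b = 0" for u using cdot0[of u] by (simp_all add: ab cdot_cvec complex_eq_iff)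
    then have "a = 0" "b = 0" by (metis inner_eq_zero_iff)+
    then show ?thesis by (simp add: ab cvec_eq_0_iff)
  qed
  moreover have "cvec v 0 \<noteq> 0" using v by (simp add: cvec_eq_0_iff)
  ultimately have "is_eigenvalue (Phi A B C r L lam \<mu> \<nu> \<eta> \<zeta>) 0" by (auto simp: is_eigenvalue_def)
  then show False using det by (simp add: eigenvalue_iff_det)
qed

text \<open>The substance is the passage from the regular frequencies to all real ones and to
  infinity, since \<open>A + r I\<close> may have eigenvalues on the imaginary axis.\<close>

lemma popov_system_instance:
  "\<exists>\<kappa> P0. popov_system F ((*v) B) ((*v) C) (\<mu> + \<nu>) (lam - \<mu> * r + \<nu> * r) (lam * Linv) (\<mu> * Lr * r) \<kappa> P0"
proof -
  obtain \<kappa> P0 where \<kappa>: "0 \<le> \<kappa>" "\<kappa> > 0 \<Longrightarrow> ereal \<kappa> < L" and P0: "transpose P0 = P0"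
    "\<And>x. x \<noteq> 0 \<Longrightarrow> 0 < x \<bullet> (P0 *v x)"
    "\<And>x. x \<noteq> 0 \<Longrightarrow> x \<bullet> (P0 *v (F x + \<kappa> *\<^sub>R (B *v (C *v x)))) < 0"
    by (rule stable_feedback) blast
  define H where "H x = F x + \<kappa> *\<^sub>R (B *v (C *v x))" for x
  have H: "linear H"
    unfolding H_def by (auto intro!: linearI simp: matrix_vector_right_distrib matrix_vector_mult_scaleR algebra_simps)
  have neg: "x \<bullet> (P0 *v H x) < 0" if "x \<noteq> 0" for x using P0(3)[OF that] by (simp add: H_def)
  obtain c where c: "c > 0" "\<And>\<omega> x y. norm (x, y) \<le> c * norm (- \<omega> *\<^sub>R y - H x, \<omega> *\<^sub>R x - H y)"
    "\<And>\<omega> p q. \<exists>x y. - \<omega> *\<^sub>R y - H x = p \<and> \<omega> *\<^sub>R x - H y = q"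
    using lyapunov_resolvent[OF H P0(1) neg] by blast
  define D where "D = {\<omega>::real. det (complexify A - mat (\<i> * of_real \<omega> - of_real r)) = 0}"
  have D: "finite D" unfolding D_def by (rule finite_irregular)
  have Heq: "F x + B *v (w + \<kappa> *\<^sub>R (C *v x)) = H x + B *v w" for x w
    by (simp add: H_def matrix_vector_right_distrib matrix_vector_mult_scaleR)
  have freq: "G x v + G y u \<le> 0" if x: "F x + B *v v = - \<omega> *\<^sub>R y" and y: "F y + B *v u = \<omega> *\<^sub>R x" for \<omega> x y v u
  proof -
    \<comment> \<open>Inputs are rewritten for the loop closed with \<kappa>, which has no
      eigenvalue on the imaginary axis. With \<open>v'\<close>, \<open>u'\<close> fixed the response
      exists at every frequency and depends continuously on it, so an exceptional \<omega> is a
      limit of regular ones.\<close>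
    define v' u' where "v' = v - \<kappa> *\<^sub>R (C *v x)" and "u' = u - \<kappa> *\<^sub>R (C *v y)"
    have vu: "H x + B *v v' = - \<omega> *\<^sub>R y" "H y + B *v u' = \<omega> *\<^sub>R x"
      using x y Heq[of x v'] Heq[of y u'] by (simp_all add: v'_def u'_def)
    obtain X Y where XY: "\<And>\<tau>. - \<tau> *\<^sub>R Y \<tau> - H (X \<tau>) = B *v v'" "\<And>\<tau>. \<tau> *\<^sub>R X \<tau> - H (Y \<tau>) = B *v u'"
      using c(3)[of _ "B *v v'" "B *v u'"] by metis
    have near: "norm (X \<tau> - x, Y \<tau> - y) \<le> c * norm (y, - x) * \<bar>\<tau> - \<omega>\<bar>" for \<tau>
    proof -
      have "- \<tau> *\<^sub>R (Y \<tau> - y) - H (X \<tau> - x) = B *v v' + \<tau> *\<^sub>R y + H x"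
        using XY(1)[of \<tau>] by (simp add: linear_diff[OF H] algebra_simps)
      also have "\<dots> = (H x + B *v v') + \<tau> *\<^sub>R y" by simp
      also have "\<dots> = (\<tau> - \<omega>) *\<^sub>R y" unfolding vu by (simp add: algebra_simps)
      finally have 1: "- \<tau> *\<^sub>R (Y \<tau> - y) - H (X \<tau> - x) = (\<tau> - \<omega>) *\<^sub>R y" .
      have "\<tau> *\<^sub>R (X \<tau> - x) - H (Y \<tau> - y) = B *v u' - \<tau> *\<^sub>R x + H y"
        using XY(2)[of \<tau>] by (simp add: linear_diff[OF H] algebra_simps)
      also have "\<dots> = (H y + B *v u') - \<tau> *\<^sub>R x" by simp
      also have "\<dots> = (\<tau> - \<omega>) *\<^sub>R (- x)" unfolding vu by (simp add: algebra_simps)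
      finally have 2: "\<tau> *\<^sub>R (X \<tau> - x) - H (Y \<tau> - y) = (\<tau> - \<omega>) *\<^sub>R (- x)" .
      have "norm (X \<tau> - x, Y \<tau> - y) \<le> c * norm ((\<tau> - \<omega>) *\<^sub>R (y, - x))"
        using c(2)[of "X \<tau> - x" "Y \<tau> - y" \<tau>] unfolding 1 2 by simp
      then show ?thesis by (simp only: norm_scaleR mult_ac)
    qed
    have "((\<lambda>\<tau>. (X \<tau> - x, Y \<tau> - y)) \<longlongrightarrow> 0) (at \<omega>)"
    proof (rule Lim_null_comparison)
      show "\<forall>\<^sub>F \<tau> in at \<omega>. norm (X \<tau> - x, Y \<tau> - y) \<le> c * norm (y, - x) * \<bar>\<tau> - \<omega>\<bar>" using near by simp
      have "((\<lambda>\<tau>. c * norm (y, - x) * \<bar>\<tau> - \<omega>\<bar>) \<longlongrightarrow> c * norm (y, - x) * \<bar>\<omega> - \<omega>\<bar>) (at \<omega>)"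
        by (intro tendsto_intros)
      then show "((\<lambda>\<tau>. c * norm (y, - x) * \<bar>\<tau> - \<omega>\<bar>) \<longlongrightarrow> 0) (at \<omega>)" by simp
    qed
    from tendsto_fst[OF this] tendsto_snd[OF this]
    have lim: "(X \<longlongrightarrow> x) (at \<omega>)" "(Y \<longlongrightarrow> y) (at \<omega>)" by (simp_all add: LIM_zero_iff)
    have "\<forall>\<^sub>F \<tau> in at \<omega>. \<tau> \<notin> D"
    proof -
      have "open (- (D - {\<omega>}))" using D by (intro open_Compl finite_imp_closed) auto
      then show ?thesis unfolding eventually_at_topological by (intro exI[of _ "- (D - {\<omega>})"]) auto
    qed
    then have reg: "\<forall>\<^sub>F \<tau> in at \<omega>. det (complexify A - mat (\<i> * of_real \<tau> - of_real r)) \<noteq> 0"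
      by (simp add: D_def)
    have "G x (v' + \<kappa> *\<^sub>R (C *v x)) + G y (u' + \<kappa> *\<^sub>R (C *v y)) \<le> 0"
    proof (rule frequency_limit[OF _ reg lim])
      show "((\<lambda>\<tau>. v' + \<kappa> *\<^sub>R (C *v X \<tau>)) \<longlongrightarrow> v' + \<kappa> *\<^sub>R (C *v x)) (at \<omega>)"
        "((\<lambda>\<tau>. u' + \<kappa> *\<^sub>R (C *v Y \<tau>)) \<longlongrightarrow> u' + \<kappa> *\<^sub>R (C *v y)) (at \<omega>)"
        by (intro tendsto_intros bounded_linear.tendsto[OF matrix_vector_mul_bounded_linear] lim)+
      show "F (X \<tau>) + B *v (v' + \<kappa> *\<^sub>R (C *v X \<tau>)) = - \<tau> *\<^sub>R Y \<tau>" for \<tau>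
        unfolding Heq using XY(1)[of \<tau>] by (simp add: algebra_simps)
      show "F (Y \<tau>) + B *v (u' + \<kappa> *\<^sub>R (C *v Y \<tau>)) = \<tau> *\<^sub>R X \<tau>" for \<tau>
        unfolding Heq using XY(2)[of \<tau>] by (simp add: algebra_simps)
    qed simp
    then show ?thesis by (simp add: v'_def u'_def)
  qed
  have freq_inf: "G 0 v \<le> 0" for v
  proof -
    \<comment> \<open>For a fixed input of the closed loop the response is
      \<open>O(1/\<tau>)\<close> as the frequency \<tau> grows, and the limiting inequality retains
      only the input.\<close>
    obtain X Y where XY: "\<And>\<tau>. - \<tau> *\<^sub>R Y \<tau> - H (X \<tau>) = B *v v" "\<And>\<tau>. \<tau> *\<^sub>R X \<tau> - H (Y \<tau>) = 0"
      using c(3)[of _ "B *v v" 0] by metis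
    obtain K where K: "K > 0" "\<And>x. norm (H x) \<le> K * norm x" using linear_bounded_pos[OF H] by blast
    define m where "m = norm (B *v v) + K * (c * norm (B *v v, 0 :: real^'m))"
    have bd: "norm (X \<tau>, Y \<tau>) \<le> c * norm (B *v v, 0 :: real^'m)" for \<tau>
      using c(2)[of "X \<tau>" "Y \<tau>" \<tau>] unfolding XY .
    have HX: "norm (H (X \<tau>)) \<le> K * (c * norm (B *v v, 0 :: real^'m))"
      and HY: "norm (H (Y \<tau>)) \<le> K * (c * norm (B *v v, 0 :: real^'m))" for \<tau>
      using K(2)[of "X \<tau>"] K(2)[of "Y \<tau>"] K(1) order_trans[OF norm_fst_le bd[of \<tau>]] order_trans[OF norm_snd_le bd[of \<tau>]]
      by (auto intro: order_trans mult_left_mono)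
    have small: "norm (X \<tau>) \<le> m * inverse \<tau>" "norm (Y \<tau>) \<le> m * inverse \<tau>" if "\<tau> > 0" for \<tau>
    proof -
      have "\<tau> *\<^sub>R X \<tau> = H (Y \<tau>)" using XY(2)[of \<tau>] by simp
      then have "\<tau> * norm (X \<tau>) = norm (H (Y \<tau>))" using that by (metis abs_of_pos norm_scaleR)
      then have 1: "\<tau> * norm (X \<tau>) \<le> m" using HY[of \<tau>] by (simp add: m_def add_increasing)
      have "\<tau> *\<^sub>R Y \<tau> = - (B *v v + H (X \<tau>))" unfolding XY(1)[of \<tau>, symmetric] by simp
      then have "\<tau> * norm (Y \<tau>) = norm (B *v v + H (X \<tau>))" using that by (metis abs_of_pos norm_scaleR norm_minus_cancel)
      then have 2: "\<tau> * norm (Y \<tau>) \<le> m"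
        using norm_triangle_ineq[of "B *v v" "H (X \<tau>)"] HX[of \<tau>] by (simp add: m_def)
      show "norm (X \<tau>) \<le> m * inverse \<tau>" "norm (Y \<tau>) \<le> m * inverse \<tau>"
        using 1 2 that by (simp_all add: field_simps)
    qed
    have "((\<lambda>\<tau>::real. m * inverse \<tau>) \<longlongrightarrow> m * 0) at_top" by (intro tendsto_intros tendsto_inverse_0_at_top filterlim_ident)
    then have m0: "((\<lambda>\<tau>::real. m * inverse \<tau>) \<longlongrightarrow> 0) at_top" by simp
    have lim: "(X \<longlongrightarrow> 0) at_top" "(Y \<longlongrightarrow> 0) at_top"
      by (rule Lim_null_comparison[OF _ m0], rule eventually_mono[OF eventually_gt_at_top[of 0]], use small in blast)+
    have "\<forall>\<^sub>F \<tau> in at_top. \<tau> \<notin> D"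
    proof (rule eventually_mono[OF eventually_gt_at_top[of "Max (insert 0 D)"]])
      show "\<tau> \<notin> D" if "\<tau> > Max (insert 0 D)" for \<tau>
        using Max_ge[of "insert 0 D" \<tau>] D that by auto
    qed
    then have reg: "\<forall>\<^sub>F \<tau> in at_top. det (complexify A - mat (\<i> * of_real \<tau> - of_real r)) \<noteq> 0"
      by (simp add: D_def)
    have "G 0 (v + \<kappa> *\<^sub>R (C *v 0)) + G 0 (0 + \<kappa> *\<^sub>R (C *v 0)) \<le> 0"
    proof (rule frequency_limit[OF _ reg lim])
      show "((\<lambda>\<tau>. v + \<kappa> *\<^sub>R (C *v X \<tau>)) \<longlongrightarrow> v + \<kappa> *\<^sub>R (C *v 0)) at_top"
        "((\<lambda>\<tau>. 0 + \<kappa> *\<^sub>R (C *v Y \<tau>)) \<longlongrightarrow> 0 + \<kappa> *\<^sub>R (C *v 0)) at_top"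
        by (intro tendsto_intros bounded_linear.tendsto[OF matrix_vector_mul_bounded_linear] lim)+
      show "F (X \<tau>) + B *v (v + \<kappa> *\<^sub>R (C *v X \<tau>)) = - \<tau> *\<^sub>R Y \<tau>" for \<tau>
        unfolding Heq using XY(1)[of \<tau>] by (simp add: algebra_simps)
      show "F (Y \<tau>) + B *v (0 + \<kappa> *\<^sub>R (C *v Y \<tau>)) = \<tau> *\<^sub>R X \<tau>" for \<tau>
        unfolding Heq using XY(2)[of \<tau>] by (simp add: algebra_simps)
    qed simp
    moreover have "G 0 0 = 0" unfolding G_def by simp
    ultimately show ?thesis by simp
  qed
  have "popov_system F ((*v) B) ((*v) C) (\<mu> + \<nu>) (lam - \<mu> * r + \<nu> * r) (lam * Linv) (\<mu> * Lr * r) \<kappa> P0"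
  proof
    show "0 \<le> \<mu> + \<nu>" using \<mu> \<nu> by simp
    show "0 \<le> \<mu> * Lr * r" using \<mu> r Lr_nonneg by simp
    show "0 < \<mu> * Lr * r \<or> 0 < lam - \<mu> * r + \<nu> * r"
    proof (cases "\<mu> > 0")
      case True
      then have "Lr > 0" by (cases rule: L_cases) auto
      then show ?thesis using True r by simp
    next
      case False
      then show ?thesis using multipliers_nonzero lam \<mu> \<nu> r by (auto simp: add_nonneg_pos add_pos_nonneg)
    qed
    fix k assume k: "0 < k" "k \<le> \<kappa>"
    have kL: "k * Linv < 1" "\<mu> * (Lr - k) \<ge> 0" "\<mu> > 0 \<Longrightarrow> \<mu> * (Lr - k) > 0"
    proof -
      have "ereal k < L" using \<kappa>(2) k by (meson ereal_less_eq(3) le_less_trans less_le_trans)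
      then show "k * Linv < 1" "\<mu> * (Lr - k) \<ge> 0" "\<mu> > 0 \<Longrightarrow> \<mu> * (Lr - k) > 0"
        by (cases rule: L_cases; use \<mu> in simp)+
    qed
    \<comment> \<open>Each multiplier contributes a nonnegative term here, strictly positive if that
      multiplier is, and they are not all zero.\<close>
    have "k * (lam - \<mu> * r + \<nu> * r) - lam * Linv * k\<^sup>2 + \<mu> * Lr * r
        = lam * (k * (1 - k * Linv)) + \<nu> * (r * k) + (\<mu> * (Lr - k)) * r"
      by (simp add: power2_eq_square algebra_simps)
    also have "\<dots> > 0"
    proof -
      have n: "lam * (k * (1 - k * Linv)) \<ge> 0" "\<nu> * (r * k) \<ge> 0" "(\<mu> * (Lr - k)) * r \<ge> 0"
        using lam \<nu> r k kL by auto
      from multipliers_nonzero show ?thesis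
      proof (elim disjE)
        assume "lam > 0"
        then have "lam * (k * (1 - k * Linv)) > 0" using k kL by simp
        then show ?thesis using n by linarith
      next
        assume "\<mu> > 0"
        then have "(\<mu> * (Lr - k)) * r > 0" using kL r by simp
        then show ?thesis using n by linarith
      next
        assume "\<nu> > 0"
        then have "\<nu> * (r * k) > 0" using r k by simp
        then show ?thesis using n by linarith
      qed
    qed
    finally show "0 < k * (lam - \<mu> * r + \<nu> * r) - lam * Linv * k\<^sup>2 + \<mu> * Lr * r" .
  next
    fix N v
    assume "subspace N" "F ` N \<subseteq> N" "B *v v \<in> N" "\<And>x. x \<in> N \<Longrightarrow> \<Gamma> x = 0"
      "\<And>x. x \<in> N \<Longrightarrow> (\<mu> * Lr * r) *\<^sub>R (C *v x) = 0" "\<And>x. x \<in> reachable \<Longrightarrow> v \<bullet> \<Gamma> x = 0"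
      "\<And>u. (\<mu> + \<nu>) * (v \<bullet> (C *v (B *v u)) + u \<bullet> (C *v (B *v v))) = 2 * (lam * Linv) * (v \<bullet> u)"
    then show "v = 0" by (intro nondegenerate_inputs[of N v]) auto
  qed (use \<kappa>(1) P0 freq freq_inf in auto)
  then show ?thesis by blast
qed

end

section \<open>Gradient systems\<close>

lemma GDERIV_gradient:
  fixes f :: "'a::euclidean_space \<Rightarrow> real"
  assumes "f differentiable (at x)"
  shows "GDERIV f x :> gradient f x"
proof -
  obtain f' where f': "(f has_derivative f') (at x)" using assms unfolding differentiable_def by blast
  then have l: "linear f'" by (rule has_derivative_linear)
  have "f' = (\<lambda>h. h \<bullet> adjoint f' 1)" using adjoint_works[OF l, of _ 1] by (intro ext) simp
  then have D: "GDERIV f x :> adjoint f' 1" using f' unfolding gderiv_def by metis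
  have "D' = adjoint f' 1" if "GDERIV f x :> D'" for D'
  proof -
    have "(\<lambda>h. h \<bullet> D') = (\<lambda>h. h \<bullet> adjoint f' 1)"
      using that D unfolding gderiv_def by (rule has_derivative_unique)
    then show ?thesis by (metis vector_eq_ldot)
  qed
  with D show ?thesis unfolding gradient_def by (rule theI)
qed

lemma gradient_chain:
  fixes f :: "'a::euclidean_space \<Rightarrow> real"
  assumes "f differentiable (at (w t))" and "(w has_vector_derivative w') (at t within S)"
  shows "((\<lambda>t. f (w t)) has_real_derivative gradient f (w t) \<bullet> w') (at t within S)"
proof -
  have "(f has_derivative (\<lambda>h. h \<bullet> gradient f (w t))) (at (w t))"
    using GDERIV_gradient[OF assms(1)] by (simp add: gderiv_def)
  from has_derivative_compose[OF assms(2)[unfolded has_vector_derivative_def] this]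
  show ?thesis by (simp add: has_field_derivative_def inner_commute mult.commute[of _ "_ \<bullet> _"])
qed

lemma radial_derivative:
  fixes f :: "'a::euclidean_space \<Rightarrow> real"
  assumes "\<And>x. f differentiable (at x)"
  shows "((\<lambda>s. f (s *\<^sub>R w)) has_real_derivative gradient f (s *\<^sub>R w) \<bullet> w) (at s within S)"
proof (rule gradient_chain[OF assms])
  show "((\<lambda>s. s *\<^sub>R w) has_vector_derivative w) (at s within S)"
    by (auto intro!: derivative_eq_intros)
qed

text \<open>Test the sign condition at \<open>w = - e \<phi>(0)\<close> and let \<open>e\<close>
  decrease to \<open>0\<close>: continuity leaves
  \<open>\<phi>(0) \<bullet> \<phi>(0) \<le> 0\<close>.\<close>

lemma sector_at_zero:
  fixes \<phi> :: "'a::euclidean_space \<Rightarrow> 'a"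
  assumes cont: "continuous_on UNIV \<phi>" and mono: "\<And>w. \<phi> w \<bullet> w \<ge> 0"
  shows "\<phi> 0 = 0"
proof -
  have "((\<lambda>e. \<phi> (- e *\<^sub>R \<phi> 0) \<bullet> \<phi> 0) \<longlongrightarrow> \<phi> (- 0 *\<^sub>R \<phi> 0) \<bullet> \<phi> 0) (at_right 0)"
  proof (intro tendsto_intros)
    have "isCont \<phi> (- 0 *\<^sub>R \<phi> 0)" using cont by (simp add: continuous_on_eq_continuous_at)
    then show "((\<lambda>e. \<phi> (- e *\<^sub>R \<phi> 0)) \<longlongrightarrow> \<phi> (- 0 *\<^sub>R \<phi> 0)) (at_right 0)"
      by (rule isCont_tendsto_compose) (intro tendsto_intros)
  qed
  moreover have "\<forall>\<^sub>F e in at_right 0. \<phi> (- e *\<^sub>R \<phi> 0) \<bullet> \<phi> 0 \<le> 0"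
  proof (rule eventually_at_right_less[of 0, THEN eventually_mono])
    fix e :: real assume "0 < e"
    then show "\<phi> (- e *\<^sub>R \<phi> 0) \<bullet> \<phi> 0 \<le> 0" using mono[of "- e *\<^sub>R \<phi> 0"] by (simp add: mult_le_0_iff)
  qed
  ultimately have "\<phi> (- 0 *\<^sub>R \<phi> 0) \<bullet> \<phi> 0 \<le> 0"
    by (rule tendsto_upperbound) simp
  then have "\<phi> 0 \<bullet> \<phi> 0 \<le> 0" by simp
  then show ?thesis by (metis antisym inner_eq_zero_iff inner_ge_zero)
qed

text \<open>The maximum over the ball of radius \<open>s\<close>, written on the fixed unit ball by
  scaling, so that uniform continuity on a compact product gives continuity in
  \<open>s\<close>.\<close>

lemma radial_majorant:
  fixes \<phi> :: "'a::euclidean_space \<Rightarrow> real"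
  assumes cont: "continuous_on UNIV \<phi>" and zero: "\<phi> 0 = 0"
  shows "\<exists>m. continuous_on {0..} m \<and> m 0 = (0::real) \<and> (\<forall>s. m s \<ge> 0) \<and>
    (\<forall>s t. 0 \<le> s \<longrightarrow> s \<le> t \<longrightarrow> m s \<le> m t) \<and> (\<forall>x. \<phi> x \<le> m (norm x))"
proof -
  define m where "m s = (SUP x\<in>cball 0 1. \<phi> (s *\<^sub>R x))" for s
  have bdd: "bdd_above ((\<lambda>x. \<phi> (s *\<^sub>R x)) ` cball 0 1)" for s
    by (intro compact_imp_bounded[THEN bounded_imp_bdd_above] compact_continuous_image
        continuous_on_compose2[OF cont] continuous_intros compact_cball) auto
  have le: "\<phi> (s *\<^sub>R x) \<le> m s" if "norm x \<le> 1" for s x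
    unfolding m_def using that by (intro cSUP_upper[OF _ bdd]) auto
  have least: "m s \<le> b" if "\<And>x. norm x \<le> 1 \<Longrightarrow> \<phi> (s *\<^sub>R x) \<le> b" for s b
    unfolding m_def using that by (intro cSUP_least) auto
  have mono: "m s \<le> m t" if st: "0 \<le> s" "s \<le> t" for s t
  proof (rule least)
    fix x :: 'a assume x: "norm x \<le> 1"
    show "\<phi> (s *\<^sub>R x) \<le> m t"
    proof (cases "t = 0")
      case True then show ?thesis using le[of x 0] x st by simp
    next
      case False
      have "norm ((s / t) *\<^sub>R x) \<le> 1 * 1"
        unfolding norm_scaleR using st x False by (intro mult_mono) auto
      then have "\<phi> (t *\<^sub>R ((s / t) *\<^sub>R x)) \<le> m t" by (intro le) simp
      then show ?thesis using False by simp
    qed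
  qed
  have m0: "m 0 = 0" using le[of 0 0] least[of 0 0] zero by (simp add: antisym)
  have "continuous_on {0..} m"
    unfolding continuous_on_iff
  proof (intro ballI allI impI)
    fix s e :: real assume s: "s \<in> {0..}" and e: "e > 0"
    have "uniformly_continuous_on ({0..s + 1} \<times> cball 0 1) (\<lambda>p. \<phi> (fst p *\<^sub>R snd p))"
      by (intro compact_uniformly_continuous continuous_on_compose2[OF cont] continuous_intros compact_Times compact_cball) auto
    then obtain d where d: "d > 0" "\<And>p q. p \<in> {0..s + 1} \<times> cball 0 1 \<Longrightarrow> q \<in> {0..s + 1} \<times> cball 0 1 \<Longrightarrow>
        dist q p < d \<Longrightarrow> dist (\<phi> (fst q *\<^sub>R snd q)) (\<phi> (fst p *\<^sub>R snd p)) < e / 2"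
      using e unfolding uniformly_continuous_on_def by (metis half_gt_zero)
    show "\<exists>d>0. \<forall>t\<in>{0..}. dist t s < d \<longrightarrow> dist (m t) (m s) < e"
    proof (intro exI[of _ "min d 1"] conjI ballI impI)
      show "min d 1 > 0" using d by simp
      fix t assume t: "t \<in> {0..}" "dist t s < min d 1"
      have close: "m u \<le> m w + e / 2" if uw: "u \<in> {0..s + 1}" "w \<in> {0..s + 1}" "dist u w < d" for u w
      proof (rule least)
        fix x :: 'a assume x: "norm x \<le> 1"
        have "dist (\<phi> (u *\<^sub>R x)) (\<phi> (w *\<^sub>R x)) < e / 2"
          using d(2)[of "(w, x)" "(u, x)"] uw x by (simp add: dist_Pair_Pair)
        then show "\<phi> (u *\<^sub>R x) \<le> m w + e / 2" using le[OF x, of w] unfolding dist_real_def by linarith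
      qed
      have "t \<in> {0..s + 1}" "s \<in> {0..s + 1}" using s t by (auto simp: dist_real_def)
      then have "m t \<le> m s + e / 2" "m s \<le> m t + e / 2" using close t by (auto simp: dist_commute)
      then show "dist (m t) (m s) < e" using e by (simp add: dist_real_def)
    qed
  qed
  moreover have "m s \<ge> 0" for s using le[of 0 s] zero by simp
  moreover have "\<phi> x \<le> m (norm x)" for x
  proof -
    have "\<phi> (norm x *\<^sub>R sgn x) \<le> m (norm x)" by (intro le) (simp add: norm_sgn)
    moreover have "norm x *\<^sub>R sgn x = x" by (cases "x = 0") (simp_all add: sgn_div_norm)
    ultimately show ?thesis by simp
  qed
  ultimately show ?thesis using m0 mono by (intro exI[of _ m]) blast
qed

section \<open>Comparison of the supply with the gradient energy\<close>

context lure_system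
begin

lemma G_scale: "G (c *\<^sub>R x) (c *\<^sub>R v) = c\<^sup>2 * G x v"
  unfolding G_def lin_simps by (simp add: power2_eq_square algebra_simps)

text \<open>Undoing the shift by \<open>r\<close> separates the derivative of the potential from
  three groups, which are governed in turn by the sector, the quasi-strong convexity and the
  quadratic upper bound on \<open>f\<close>.\<close>

lemma G_unshifted:
  "G x u = (\<mu> + \<nu>) * (u \<bullet> (C *v (A *v x + B *v u))) + lam * (u \<bullet> (C *v x) - Linv * (u \<bullet> u))
     + 2 * \<nu> * r * (u \<bullet> (C *v x)) + \<mu> * Lr * r * ((C *v x) \<bullet> (C *v x))"
proof -
  define a b w where "a = u \<bullet> (C *v (A *v x))" and "b = u \<bullet> (C *v (B *v u))" and "w = u \<bullet> (C *v x)"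
  have "u \<bullet> \<Gamma> x = (\<mu> + \<nu>) * (a + r * w) + (lam - \<mu> * r + \<nu> * r) * w"
    by (simp only: \<Gamma>_def inner_add_right inner_scaleR_right matrix_vector_right_distrib matrix_vector_mult_scaleR a_def w_def)
  moreover have "u \<bullet> (C *v (A *v x + B *v u)) = a + b"
    by (simp only: inner_add_right matrix_vector_right_distrib a_def b_def)
  ultimately show ?thesis unfolding G_def b_def[symmetric] w_def[symmetric] by (simp only:) (simp add: algebra_simps)
qed

lemma solution_bound:
  assumes C1: "is_C1 f" and sector: "in_sector (gradient f) 0 L"
    and qsc: "\<not> zero_quasi_strongly_convex f \<Longrightarrow> \<nu> = 0"
  shows "gradient f 0 = 0" "\<And>w. f w \<ge> f 0"
    "\<exists>K>0. \<forall>J z. is_solution (\<lambda>z. A *v z + B *v gradient f (C *v z)) J z \<longrightarrow> (\<forall>T\<in>J. 0 \<le> T \<longrightarrow>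
        (norm (z T))\<^sup>2 \<le> K * ((norm (z 0))\<^sup>2 + (\<mu> + \<nu>) * (f (C *v z 0) - f 0)) * exp (- 2 * r * T))"
proof -
  define \<phi> where "\<phi> = gradient f"
  have diff: "f differentiable (at x)" for x using C1 by (simp add: is_C1_def)
  have cont: "continuous_on UNIV \<phi>" using C1 by (simp add: is_C1_def \<phi>_def)
  have sec: "Linv * (\<phi> w \<bullet> \<phi> w) \<le> \<phi> w \<bullet> w" for w
  proof -
    have "(0 *\<^sub>R w - \<phi> w) \<bullet> (w - Linv *\<^sub>R \<phi> w) \<le> 0" using sector unfolding in_sector_def \<phi>_def by blast
    then show ?thesis by (simp add: inner_diff_right)
  qed
  have mono: "\<phi> w \<bullet> w \<ge> 0" for w
    using sec[of w] mult_nonneg_nonneg[OF Linv_nonneg inner_ge_zero[of "\<phi> w"]] by linarith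
  show \<phi>0: "gradient f 0 = 0" using sector_at_zero[OF cont mono] by (simp add: \<phi>_def)
  show f0: "f w \<ge> f 0" for w
  proof -
    have "- f (1 *\<^sub>R w) \<le> - f (0 *\<^sub>R w)"
    proof (rule nonincreasing_from_0[where T = 1 and f' = "\<lambda>s. - (gradient f (s *\<^sub>R w) \<bullet> w)"])
      show "((\<lambda>s. - f (s *\<^sub>R w)) has_real_derivative - (gradient f (s *\<^sub>R w) \<bullet> w)) (at s within {0..1})" for s
        by (rule DERIV_minus[OF radial_derivative[OF diff]])
      fix s :: real assume s: "s \<in> {0..1}"
      have "s * (gradient f (s *\<^sub>R w) \<bullet> w) \<ge> 0" using mono[of "s *\<^sub>R w"] by (simp add: \<phi>_def)
      then show "- (gradient f (s *\<^sub>R w) \<bullet> w) \<le> 0"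
        using s \<phi>0 by (cases "s = 0") (auto simp: zero_le_mult_iff)
    qed simp
    then show ?thesis by simp
  qed
  \<comment> \<open>The sector gives \<open>|\<phi>(x)| \<le> L |x|\<close>; integrating along rays
    bounds \<open>f w - f 0\<close> by \<open>L |w|^2 / 2\<close>. For infinite \<open>L\<close>
    both sides vanish with \<mu>.\<close>
  have upper: "\<mu> * (f w - f 0) \<le> \<mu> * Lr * (w \<bullet> w) / 2" for w
  proof (cases rule: L_cases)
    case 1 then show ?thesis by simp
  next
    case (2 l)
    have lip: "norm (\<phi> x) \<le> l * norm x" for x
    proof (cases "\<phi> x = 0")
      case False
      have "norm (\<phi> x) * norm (\<phi> x) = \<phi> x \<bullet> \<phi> x" by (simp add: power2_norm_eq_inner flip: power2_eq_square)
      also have "\<dots> \<le> l * (\<phi> x \<bullet> x)" using sec[of x] 2 by (simp add: field_simps)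
      also have "\<dots> \<le> l * (norm (\<phi> x) * norm x)" using 2 by (intro mult_left_mono norm_cauchy_schwarz) auto
      finally have "norm (\<phi> x) * norm (\<phi> x) \<le> norm (\<phi> x) * (l * norm x)" by (simp add: mult_ac)
      then show ?thesis using False by simp
    qed (use 2 in simp)
    have "f (1 *\<^sub>R w) - l * (w \<bullet> w) * 1\<^sup>2 / 2 \<le> f (0 *\<^sub>R w) - l * (w \<bullet> w) * 0\<^sup>2 / 2"
    proof (rule nonincreasing_from_0[where T = 1 and f' = "\<lambda>s. gradient f (s *\<^sub>R w) \<bullet> w - l * (w \<bullet> w) * s"])
      show "((\<lambda>s. f (s *\<^sub>R w) - l * (w \<bullet> w) * s\<^sup>2 / 2) has_real_derivative
          gradient f (s *\<^sub>R w) \<bullet> w - l * (w \<bullet> w) * s) (at s within {0..1})" for s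
        by (rule derivative_eq_intros radial_derivative[OF diff] refl | simp)+
      fix s :: real assume s: "s \<in> {0..1}"
      have "gradient f (s *\<^sub>R w) \<bullet> w \<le> norm (\<phi> (s *\<^sub>R w)) * norm w" unfolding \<phi>_def by (rule norm_cauchy_schwarz)
      also have "\<dots> \<le> (l * norm (s *\<^sub>R w)) * norm w" by (intro mult_right_mono lip) simp
      also have "\<dots> = l * (w \<bullet> w) * s" using s by (simp add: power2_norm_eq_inner[symmetric] power2_eq_square)
      finally show "gradient f (s *\<^sub>R w) \<bullet> w - l * (w \<bullet> w) * s \<le> 0" by simp
    qed simp
    then have "f w - f 0 \<le> l * (w \<bullet> w) / 2" by simp
    then have "\<mu> * (f w - f 0) \<le> \<mu> * (l * (w \<bullet> w) / 2)" using \<mu> by (rule mult_left_mono)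
    then show ?thesis using 2 by simp
  qed
  have convex: "\<nu> * (f w - f 0) \<le> \<nu> * (\<phi> w \<bullet> w)" for w
  proof (cases "\<nu> = 0")
    case False
    then have "zero_quasi_strongly_convex f" using qsc by blast
    then have "f w - gradient f w \<bullet> w \<le> f 0" unfolding zero_quasi_strongly_convex_def by blast
    then show ?thesis using \<nu> by (intro mult_left_mono) (auto simp: \<phi>_def)
  qed simp
  obtain \<kappa> P0 where ps: "popov_system F ((*v) B) ((*v) C) (\<mu> + \<nu>) (lam - \<mu> * r + \<nu> * r) (lam * Linv) (\<mu> * Lr * r) \<kappa> P0"
    using popov_system_instance by blast
  obtain K where K: "K > 0" and bound: "\<And>T y v h h'. 0 \<le> T \<Longrightarrow>
      (\<forall>t\<in>{0..T}. (y has_vector_derivative F (y t) + B *v (v t)) (at t within {0..T}) \<and>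
        (h has_real_derivative h' t) (at t within {0..T}) \<and> 0 \<le> h t \<and> h' t \<le> G (y t) (v t)) \<Longrightarrow>
      (norm (y T))\<^sup>2 \<le> K * ((norm (y 0))\<^sup>2 + h 0)"
    using popov_system.bounded_response[OF ps] by blast
  show "\<exists>K>0. \<forall>J z. is_solution (\<lambda>z. A *v z + B *v gradient f (C *v z)) J z \<longrightarrow> (\<forall>T\<in>J. 0 \<le> T \<longrightarrow>
        (norm (z T))\<^sup>2 \<le> K * ((norm (z 0))\<^sup>2 + (\<mu> + \<nu>) * (f (C *v z 0) - f 0)) * exp (- 2 * r * T))"
  proof (intro exI[of _ K] conjI K allI impI ballI)
    fix J z T assume sol: "is_solution (\<lambda>z. A *v z + B *v gradient f (C *v z)) J z" and TJ: "T \<in> J" and T: "0 \<le> T"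
    have sub: "{0..T} \<subseteq> J" using sol TJ unfolding is_solution_def is_interval_1 by fastforce
    define dz where "dz t = A *v z t + B *v \<phi> (C *v z t)" for t
    have z: "(z has_vector_derivative dz t) (at t within {0..T})" if "t \<in> {0..T}" for t
      using sol sub that unfolding is_solution_def dz_def \<phi>_def
      by (blast intro: has_vector_derivative_within_subset)
    define y where "y t = exp (r * t) *\<^sub>R z t" for t
    define v where "v t = exp (r * t) *\<^sub>R \<phi> (C *v z t)" for t
    define h where "h t = (\<mu> + \<nu>) * (exp (2 * r * t) * (f (C *v z t) - f 0))" for t
    define h' where "h' t = (\<mu> + \<nu>) * (2 * r * exp (2 * r * t) * (f (C *v z t) - f 0)
        + exp (2 * r * t) * (\<phi> (C *v z t) \<bullet> (C *v dz t)))" for t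
    have "(norm (y T))\<^sup>2 \<le> K * ((norm (y 0))\<^sup>2 + h 0)"
    proof (rule bound[OF T], intro ballI conjI)
      fix t assume t: "t \<in> {0..T}"
      have "(y has_vector_derivative exp (r * t) *\<^sub>R dz t + (r * exp (r * t)) *\<^sub>R z t) (at t within {0..T})"
        unfolding y_def using z[OF t]
        by (auto intro!: derivative_eq_intros simp: has_real_derivative_iff_has_vector_derivative[symmetric])
      then show "(y has_vector_derivative F (y t) + B *v v t) (at t within {0..T})"
        by (simp add: y_def v_def dz_def matrix_vector_mult_scaleR scaleR_add_right algebra_simps)
      have "((\<lambda>t. C *v z t) has_vector_derivative C *v dz t) (at t within {0..T})"
        by (rule bounded_linear.has_vector_derivative[OF matrix_vector_mul_bounded_linear z[OF t]])
      from gradient_chain[OF diff this]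
      have fz: "((\<lambda>t. f (C *v z t)) has_real_derivative \<phi> (C *v z t) \<bullet> (C *v dz t)) (at t within {0..T})"
        by (simp add: \<phi>_def)
      show "(h has_real_derivative h' t) (at t within {0..T})"
        unfolding h_def h'_def by (rule derivative_eq_intros fz refl | simp add: algebra_simps)+
      show "0 \<le> h t" unfolding h_def using \<mu> \<nu> f0 by (intro mult_nonneg_nonneg) auto
      define E u w d where "E = exp (2 * r * t)" and "u = \<phi> (C *v z t)" and "w = C *v z t" and "d = f w - f 0"
      have "(exp (r * t))\<^sup>2 = E" by (simp add: E_def exp_double[symmetric] mult.assoc)
      then have "G (y t) (v t) = E * G (z t) u" by (simp only: y_def v_def u_def G_scale)
      also have "G (z t) u = (\<mu> + \<nu>) * (u \<bullet> (C *v dz t)) + lam * (u \<bullet> w - Linv * (u \<bullet> u)) + 2 * \<nu> * r * (u \<bullet> w)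
          + \<mu> * Lr * r * (w \<bullet> w)"
        unfolding dz_def u_def[symmetric] w_def by (rule G_unshifted)
      finally have "G (y t) (v t) = E * ((\<mu> + \<nu>) * (u \<bullet> (C *v dz t)) + lam * (u \<bullet> w - Linv * (u \<bullet> u)) + 2 * \<nu> * r * (u \<bullet> w)
          + \<mu> * Lr * r * (w \<bullet> w))" .
      moreover have "h' t = E * ((\<mu> + \<nu>) * (u \<bullet> (C *v dz t)) + 2 * r * ((\<mu> + \<nu>) * d))"
        by (simp add: h'_def E_def u_def w_def d_def algebra_simps)
      \<comment> \<open>The cost of the weight \<open>exp (2 * r * t)\<close> in \<open>h\<close>.
        Its \<mu> part is paid by the quadratic upper bound and its \<nu> part by quasi-strong
        convexity; the sector term is a surplus.\<close>
      moreover have "2 * r * ((\<mu> + \<nu>) * d) \<le> lam * (u \<bullet> w - Linv * (u \<bullet> u)) + 2 * \<nu> * r * (u \<bullet> w) + \<mu> * Lr * r * (w \<bullet> w)"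
      proof -
        have "lam * (u \<bullet> w - Linv * (u \<bullet> u)) \<ge> 0" using lam sec[of w] by (simp add: u_def w_def)
        moreover have "2 * r * (\<mu> * d) \<le> 2 * r * (\<mu> * Lr * (w \<bullet> w) / 2)"
        proof (rule mult_left_mono)
          show "\<mu> * d \<le> \<mu> * Lr * (w \<bullet> w) / 2" unfolding d_def by (rule upper)
        qed (use r in simp)
        moreover have "2 * r * (\<nu> * d) \<le> 2 * r * (\<nu> * (u \<bullet> w))"
        proof (rule mult_left_mono)
          show "\<nu> * d \<le> \<nu> * (u \<bullet> w)" unfolding d_def u_def w_def by (rule convex)
        qed (use r in simp)
        ultimately show ?thesis by (simp add: algebra_simps)
      qed
      moreover have "E > 0" by (simp add: E_def)
      ultimately show "h' t \<le> G (y t) (v t)" by (simp add: mult_left_mono)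
    qed
    then have "exp (2 * r * T) * (norm (z T))\<^sup>2 \<le> K * ((norm (z 0))\<^sup>2 + (\<mu> + \<nu>) * (f (C *v z 0) - f 0))"
      by (simp add: y_def h_def power_mult_distrib exp_double[symmetric] mult.assoc)
    then have "exp (- 2 * r * T) * (exp (2 * r * T) * (norm (z T))\<^sup>2)
        \<le> exp (- 2 * r * T) * (K * ((norm (z 0))\<^sup>2 + (\<mu> + \<nu>) * (f (C *v z 0) - f 0)))"
      by (rule mult_left_mono) simp
    moreover have "exp (- 2 * r * T) * (exp (2 * r * T) * (norm (z T))\<^sup>2) = (norm (z T))\<^sup>2"
      by (simp flip: mult.assoc exp_add)
    ultimately have "(norm (z T))\<^sup>2 \<le> exp (- 2 * r * T) * (K * ((norm (z 0))\<^sup>2 + (\<mu> + \<nu>) * (f (C *v z 0) - f 0)))"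
      by (simp only:)
    then show "(norm (z T))\<^sup>2 \<le> K * ((norm (z 0))\<^sup>2 + (\<mu> + \<nu>) * (f (C *v z 0) - f 0)) * exp (- 2 * r * T)"
      by (subst mult.commute)
  qed
qed

lemma exponential_stability:
  assumes C1: "is_C1 f" and sector: "in_sector (gradient f) 0 L"
    and qsc: "\<not> zero_quasi_strongly_convex f \<Longrightarrow> \<nu> = 0"
  shows "exp_stable r (\<lambda>z. A *v z + B *v gradient f (C *v z))"
proof -
  note sb = solution_bound[OF C1 sector qsc]
  have mat: "continuous_on UNIV (\<lambda>z. M *v z)" for M :: "real^'x^'y"
    by (rule linear_continuous_on[OF matrix_vector_mul_bounded_linear])
  have "continuous_on UNIV (gradient f)" using C1 by (simp add: is_C1_def)
  then have "continuous_on UNIV (\<lambda>z. gradient f (C *v z))" by (rule continuous_on_compose2[OF _ mat]) simp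
  then have "continuous_on UNIV (\<lambda>z. B *v gradient f (C *v z))" by (rule continuous_on_compose2[OF mat]) simp
  then have cont: "continuous_on UNIV (\<lambda>z. A *v z + B *v gradient f (C *v z))" by (rule continuous_on_add[OF mat])
  have "continuous_on UNIV f"
    using C1 by (auto simp: is_C1_def continuous_on_eq_continuous_at intro: differentiable_imp_continuous_within)
  then have "continuous_on UNIV (\<lambda>z. f (C *v z))" by (rule continuous_on_compose2[OF _ mat]) simp
  then have "continuous_on UNIV (\<lambda>z. (\<mu> + \<nu>) * (f (C *v z) - f 0))" by (intro continuous_intros)
  then have "\<exists>m. continuous_on {0..} m \<and> m 0 = (0::real) \<and> (\<forall>s. m s \<ge> 0) \<and>
    (\<forall>s t. 0 \<le> s \<longrightarrow> s \<le> t \<longrightarrow> m s \<le> m t) \<and> (\<forall>z. (\<mu> + \<nu>) * (f (C *v z) - f 0) \<le> m (norm z))"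
    by (rule radial_majorant) simp
  then obtain m where m: "continuous_on {0..} m" "m 0 = 0" "\<And>s. m s \<ge> 0"
      "\<And>s t. 0 \<le> s \<Longrightarrow> s \<le> t \<Longrightarrow> m s \<le> m t" "\<And>z. (\<mu> + \<nu>) * (f (C *v z) - f 0) \<le> m (norm z)"
    by blast
  obtain K where K: "K > 0" and bound: "\<And>J z T. is_solution (\<lambda>z. A *v z + B *v gradient f (C *v z)) J z \<Longrightarrow> T \<in> J \<Longrightarrow> 0 \<le> T \<Longrightarrow>
        (norm (z T))\<^sup>2 \<le> K * ((norm (z 0))\<^sup>2 + (\<mu> + \<nu>) * (f (C *v z 0) - f 0)) * exp (- 2 * r * T)"
    using sb(3) by blast
  \<comment> \<open>\<open>m\<close> is only nondecreasing; the square makes \<kappa> strictly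
    increasing.\<close>
  define \<kappa> where "\<kappa> s = sqrt (K * (s\<^sup>2 + m s))" for s
  have "continuous_on {0..} \<kappa>" unfolding \<kappa>_def by (intro continuous_intros m)
  moreover have "strict_mono_on {0..} \<kappa>"
  proof (rule strict_mono_onI)
    fix s t :: real assume st: "s \<in> {0..}" "t \<in> {0..}" "s < t"
    have "s\<^sup>2 < t\<^sup>2" using st by (intro power_strict_mono) auto
    then have "s\<^sup>2 + m s < t\<^sup>2 + m t" using m(4)[of s t] st by simp
    then show "\<kappa> s < \<kappa> t" using K by (simp add: \<kappa>_def)
  qed
  moreover have "\<kappa> ` {0..} \<subseteq> {0..}" using K m(3) by (auto simp: \<kappa>_def)
  moreover have "\<kappa> 0 = 0" by (simp add: \<kappa>_def m)
  moreover have "norm (z T) \<le> \<kappa> (norm (z 0)) * exp (- r * T)"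
    if "is_solution (\<lambda>z. A *v z + B *v gradient f (C *v z)) J z" "T \<in> J" "0 \<le> T" for J z T
  proof -
    have "(norm (z T))\<^sup>2 \<le> K * ((norm (z 0))\<^sup>2 + (\<mu> + \<nu>) * (f (C *v z 0) - f 0)) * exp (- 2 * r * T)"
      by (rule bound[OF that])
    also have "\<dots> \<le> K * ((norm (z 0))\<^sup>2 + m (norm (z 0))) * exp (- 2 * r * T)"
      using K m(5)[of "z 0"] by (intro mult_right_mono mult_left_mono add_left_mono) auto
    also have "\<dots> = (\<kappa> (norm (z 0)) * exp (- r * T))\<^sup>2"
      using K m(3)[of "norm (z 0)"] by (simp add: \<kappa>_def power_mult_distrib exp_double[symmetric])
    finally show ?thesis
      using K m(3)[of "norm (z 0)"] by (intro power2_le_imp_le[of "norm (z T)"]) (auto simp: \<kappa>_def)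
  qed
  ultimately show ?thesis using cont sb(1) unfolding exp_stable_def by auto
qed

end

theorem lemma2p19:
  fixes A :: "real^'m^'m" and B :: "real^'n^'m" and C :: "real^'m^'n"
    and r :: real and L :: ereal and f :: "real^'n \<Rightarrow> real"
    and lam \<mu> \<nu> :: real
  assumes "r > 0" and "L > 0"
    and "is_C1 f" and "in_sector (gradient f) 0 L"
    and "lam \<ge> 0" and "\<mu> \<ge> 0" and "\<nu> \<ge> 0"
    and "B \<noteq> 0"
    and "\<exists>k::real. 0 \<le> k \<and> ereal k \<le> L \<and> hurwitz (A + k *\<^sub>R (B ** C) + mat r)"
    and "\<exists>\<eta> \<zeta>. \<not> is_eigenvalue (complexify A) \<eta> \<and> \<not> is_eigenvalue (complexify A) \<zeta> \<and>
           det (Phi A B C r L lam \<mu> \<nu> \<eta> \<zeta>) \<noteq> 0"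
    and "L = \<infinity> \<Longrightarrow> \<mu> = 0"
    and "\<not> zero_quasi_strongly_convex f \<Longrightarrow> \<nu> = 0"
    and "\<And>(\<omega>::real) (s::complex). s = \<i> * of_real \<omega> - of_real r \<Longrightarrow>
           det (complexify A - mat s) \<noteq> 0 \<Longrightarrow>
           hermitian_le
             (re_part ((of_real lam + of_real \<mu> * s
                          + of_real \<nu> * (\<i> * of_real \<omega> + of_real r)) *\<^sub>C transfer A B C s)
              + of_real (\<mu> * real_of_ereal L * r)
                  *\<^sub>C (conj_transpose (transfer A B C s) ** transfer A B C s))
             (mat (of_real (lam * real_of_ereal (inverse L))))"
  shows "exp_stable r (\<lambda>z. A *v z + B *v gradient f (C *v z))"
proof -
  interpret lure_system A B C r L lam \<mu> \<nu>
    by (rule lure_system.intro[OF assms(1,2,5,6,7,9,10,11,13)])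
  show ?thesis by (rule exponential_stability[OF assms(3,4,12)])
qed

end
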